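(* Let $k$ be a fixed positive integer. As the degree $d$ of $a\in A$ tends to infinity, ${}_a\tilde\ell_k$ tends to $\tilde\alpha_k$ locally uniformly on $\Omega^r$ (i.e. uniformly on each member of some admissible covering of $\Omega^r$), where $${}_a\tilde\ell_k:=\overline\pi^{\,1-q^k}\,({}_ac_k)^{-1}\,{}_a\ell_k,\qquad\tilde\alpha_k:=\overline\pi^{\,1-q^k}D_k\,\alpha_k.$$
   Context: Let $q$ be a prime power, $\mathbb F=\mathbb F_q$, $A=\mathbb F[T]$, $K_\infty=\mathbb F((T^{-1}))$ with $|T|=q$, $C_\infty$ the completion of an algebraic closure of $K_\infty$. Fix $r\ge2$. $\Omega^r$ is the rigid analytic space of $\omega=(\omega_1:\dots:\omega_r)\in\mathbb P^{r-1}(C_\infty)$ with $K_\infty$-linearly independent coordinates, normalized by $\omega_r=1$; $\Lambda_\omega=\sum A\omega_i$, $e_{\Lambda_\omega}(X)=X\prod_{0\ne\mu\in\Lambda_\omega}(1-X/\mu)=\sum_i\alpha_i(\omega)X^{q^i}$, and ${}_a\ell_k(\omega)$ is defined by $e_{\Lambda_\omega}(aX)=\sum_{0\le k\le r\deg a}{}_a\ell_k(\omega)e_{\Lambda_\omega}(X)^{q^k}$. The Carlitz module $\rho$ is given by $\rho_T(X)=TX+X^q$, with $\rho_a(X)=\sum_{0\le k\le\deg a}{}_ac_kX^{q^k}$ (so ${}_ac_k\ne0$ for $k\le\deg a$). $\overline\pi\in C_\infty$ is an element (well-defined up to a $(q-1)$-th root of unity) such that $\rho$ is the Drinfeld module of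 the rank-one lattice $\overline\pi A$, i.e. $e_{\overline\pi A}(aX)=\rho_a(e_{\overline\pi A}(X))$ for all $a\in A$; one has $|\overline\pi|=q^{q/(q-1)}$. $D_k=[k][k-1]^q\cdots[1]^{q^{k-1}}$ with $[i]=T^{q^i}-T$. *)

theory Defs
  imports
    "HOL-Analysis.Analysis"
    "HOL-Computational_Algebra.Formal_Laurent_Series"
    "HOL-Algebra.Algebraic_Closure_Type"
begin

section \<open>The field \<open>C\<^sub>\<infinity>\<close>\<close>

text \<open>
  \<open>\<F>\<^sub>q\<close> is a type \<open>'f\<close> of class \<open>finite_field\<close>, \<open>q = CARD('f)\<close>, and \<open>A = 'f poly\<close>.
  \<open>K\<^sub>\<infinity> = \<F>\<^sub>q((T\<^sup>-\<^sup>1))\<close> is \<open>'f fls\<close>, the variable of the Laurent series being \<open>T\<^sup>-\<^sup>1\<close>;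
  thus \<open>T\<close> is \<open>fls_X_inv\<close>.
\<close>

definition abs_Kinf :: "'f::finite_field fls \<Rightarrow> real" where
  "abs_Kinf f = (if f = 0 then 0 else real CARD('f) powi (- fls_subdegree f))"

definition absv :: "'c::{zero,metric_space} \<Rightarrow> real" where
  "absv x = dist x 0"

text \<open>
  The type \<open>'c\<close>, with its metric, is the completion of the algebraic closure of \<open>K\<^sub>\<infinity>\<close> via
  the embedding \<open>\<iota>\<close>: the metric is given by a non-archimedean absolute value which extends
  that of \<open>K\<^sub>\<infinity>\<close>, the algebraic closure is dense, and \<open>'c\<close> is complete (class \<open>complete_space\<close>).
  This determines \<open>'c\<close> up to isometric isomorphism.
\<close>

locale C_infinity =
  fixes \<iota> :: "'f::finite_field fls alg_closure \<Rightarrow> 'c::{field,complete_space}"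
  assumes emb_one: "\<iota> 1 = 1"
    and emb_add: "\<iota> (x + y) = \<iota> x + \<iota> y"
    and emb_mult: "\<iota> (x * y) = \<iota> x * \<iota> y"
    and dist_absv: "dist (u :: 'c) v = absv (u - v)"
    and absv_mult: "absv ((u :: 'c) * v) = absv u * absv v"
    and absv_ultrametric: "absv ((u :: 'c) + v) \<le> max (absv u) (absv v)"
    and absv_extends: "absv (\<iota> (to_ac f)) = abs_Kinf f"
    and dense: "closure (range \<iota>) = UNIV"

definition embK :: "('f::finite_field fls alg_closure \<Rightarrow> 'c) \<Rightarrow> 'f fls \<Rightarrow> 'c" where
  "embK \<iota> f = \<iota> (to_ac f)"

definition embA :: "('f::finite_field fls alg_closure \<Rightarrow> 'c) \<Rightarrow> 'f poly \<Rightarrow> 'c" where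
  "embA \<iota> a = embK \<iota> (poly (map_poly fls_const a) fls_X_inv)"


section \<open>The period domain\<close>

text \<open>
  A point of \<open>\<Omega>\<^sup>r\<close> is stored by its affine coordinates \<open>(\<omega>\<^sub>1, \<dots>, \<omega>\<^bsub>r-1\<^esub>)\<close>;
  \<open>normalized r \<omega>\<close> is the full tuple \<open>(\<omega>\<^sub>1, \<dots>, \<omega>\<^bsub>r-1\<^esub>, 1)\<close>.
\<close>

definition affine_space :: "nat \<Rightarrow> (nat \<Rightarrow> 'c) set" where
  "affine_space n = {1..n} \<rightarrow>\<^sub>E UNIV"

definition normalized :: "nat \<Rightarrow> (nat \<Rightarrow> 'c::one) \<Rightarrow> nat \<Rightarrow> 'c" where
  "normalized r \<omega> = fun_upd \<omega> r 1"

definition Omega :: "('f::finite_field fls alg_closure \<Rightarrow> 'c::field) \<Rightarrow> nat \<Rightarrow> (nat \<Rightarrow> 'c) set" where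
  "Omega \<iota> r = {\<omega> \<in> affine_space (r - 1).
     \<forall>c :: nat \<Rightarrow> 'f fls. (\<Sum>i=1..r. embK \<iota> (c i) * normalized r \<omega> i) = 0
        \<longrightarrow> (\<forall>i\<in>{1..r}. c i = 0)}"


section \<open>Admissible coverings\<close>

definition polydisc :: "nat \<Rightarrow> real \<Rightarrow> (nat \<Rightarrow> 'c::{zero,metric_space}) set" where
  "polydisc n R = {z \<in> affine_space n. \<forall>i\<in>{1..n}. absv (z i) \<le> R}"

definition multiindices :: "nat \<Rightarrow> (nat \<Rightarrow> nat) set" where
  "multiindices n = {1..n} \<rightarrow>\<^sub>E UNIV"

text \<open>
  Power series in \<open>n\<close> variables that converge on the closed polydisc of radius \<open>R\<close>
  (the Tate algebra of that polydisc), viewed as functions; the values off the polydisc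
  are irrelevant.
\<close>

definition tate :: "nat \<Rightarrow> real \<Rightarrow> ((nat \<Rightarrow> 'c::{field,metric_space}) \<Rightarrow> 'c) set" where
  "tate n R = {f. \<exists>c :: (nat \<Rightarrow> nat) \<Rightarrow> 'c.
     (\<forall>\<epsilon>>0. finite {\<nu> \<in> multiindices n. absv (c \<nu>) * R ^ (\<Sum>i=1..n. \<nu> i) \<ge> \<epsilon>}) \<and>
     (\<forall>z\<in>polydisc n R. ((\<lambda>\<nu>. c \<nu> * (\<Prod>i=1..n. z i ^ \<nu> i)) has_sum f z) (multiindices n))}"

text \<open>
  Rational subdomains of an affinoid with point set \<open>S\<close>, whose affinoid functions are the
  restrictions to \<open>S\<close> of the functions in \<open>F\<close>. The defining functions generate the unit ideal.
\<close>

definition rational_subdomain ::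
  "'x set \<Rightarrow> ('x \<Rightarrow> 'c::{field,metric_space}) set \<Rightarrow> 'x set \<Rightarrow> bool" where
  "rational_subdomain S F W \<longleftrightarrow> (\<exists>(s::nat) f g.
     (\<forall>j\<le>s. f j \<in> F \<and> g j \<in> F) \<and>
     (\<forall>x\<in>S. (\<Sum>j\<le>s. g j x * f j x) = 1) \<and>
     W = {x \<in> S. \<forall>j\<le>s. absv (f j x) \<le> absv (f 0 x)})"

text \<open>
  The open affinoids of affine \<open>n\<close>-space used below: rational subdomains of closed polydiscs.
  By the theorem of Gerritzen and Grauert every open affinoid is a finite union of these, so
  refinements by, and tests on, arbitrary open affinoids reduce to them.
\<close>

definition open_affinoid :: "nat \<Rightarrow> (nat \<Rightarrow> 'c::{field,metric_space}) set \<Rightarrow> bool" where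
  "open_affinoid n V \<longleftrightarrow>
     (\<exists>\<rho>::'c. \<rho> \<noteq> 0 \<and> rational_subdomain (polydisc n (absv \<rho>)) (tate n (absv \<rho>)) V)"

text \<open>
  Every (reduced) affinoid space is a Zariski closed subset of a closed unit polydisc, and a
  morphism from it to affine \<open>n\<close>-space is an \<open>n\<close>-tuple of affinoid functions. Since only the
  underlying point sets matter for the G-topology, non-reduced structures can be ignored.
\<close>

definition affinoid_space :: "nat \<Rightarrow> (nat \<Rightarrow> 'c::{field,metric_space}) set \<Rightarrow> bool" where
  "affinoid_space m Y \<longleftrightarrow> (\<exists>T \<subseteq> tate m 1. Y = {y \<in> polydisc m 1. \<forall>f\<in>T. f y = 0})"

definition affinoid_morphism ::
  "nat \<Rightarrow> (nat \<Rightarrow> 'c) set \<Rightarrow> nat \<Rightarrow> ((nat \<Rightarrow> 'c::{field,metric_space}) \<Rightarrow> nat \<Rightarrow> 'c) \<Rightarrow> bool" where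
  "affinoid_morphism m Y n \<phi> \<longleftrightarrow>
     (\<forall>y\<in>Y. \<phi> y \<in> affine_space n) \<and> (\<forall>i\<in>{1..n}. \<exists>f \<in> tate m 1. \<forall>y\<in>Y. \<phi> y i = f y)"

text \<open>Admissible open subsets of affine \<open>n\<close>-space for the strong G-topology.\<close>

definition admissible_open :: "nat \<Rightarrow> (nat \<Rightarrow> 'c::{field,metric_space}) set \<Rightarrow> bool" where
  "admissible_open n U \<longleftrightarrow>
     (\<exists>\<W>. (\<forall>W\<in>\<W>. open_affinoid n W) \<and> \<Union>\<W> = U \<and>
       (\<forall>m Y \<phi>. affinoid_space m Y \<and> affinoid_morphism m Y n \<phi> \<and> \<phi> ` Y \<subseteq> U \<longrightarrow>
         (\<exists>\<V>. finite \<V> \<and> \<Union>\<V> = Y \<and>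
           (\<forall>V\<in>\<V>. rational_subdomain Y (tate m 1) V \<and> (\<exists>W\<in>\<W>. \<phi> ` V \<subseteq> W)))))"

text \<open>
  Admissible coverings of a rigid analytic space \<open>S\<close> which is an admissible open subspace of
  affine \<open>n\<close>-space, as \<open>\<Omega>\<^sup>r\<close> is for \<open>n = r - 1\<close> (Drinfeld): a family of admissible open subsets covering \<open>S\<close> is admissible iff its
  restriction to each open affinoid \<open>V\<close> of \<open>S\<close> is admissible, i.e. has a finite refinement by
  open affinoids of \<open>V\<close>.
\<close>

definition admissible_covering ::
  "nat \<Rightarrow> (nat \<Rightarrow> 'c::{field,metric_space}) set \<Rightarrow> (nat \<Rightarrow> 'c) set set \<Rightarrow> bool" where
  "admissible_covering n S \<U> \<longleftrightarrow>
     (\<forall>U\<in>\<U>. admissible_open n U) \<and> \<Union>\<U> = S \<and>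
     (\<forall>V. open_affinoid n V \<and> V \<subseteq> S \<longrightarrow>
       (\<exists>\<V>. finite \<V> \<and> \<Union>\<V> = V \<and> (\<forall>W\<in>\<V>. open_affinoid n W \<and> (\<exists>U\<in>\<U>. W \<subseteq> U))))"


section \<open>Lattices and their exponential functions\<close>

definition period_lattice ::
  "('f::finite_field fls alg_closure \<Rightarrow> 'c::field) \<Rightarrow> nat \<Rightarrow> (nat \<Rightarrow> 'c) \<Rightarrow> 'c set" where
  "period_lattice \<iota> r \<omega> =
     range (\<lambda>a :: nat \<Rightarrow> 'f poly. \<Sum>i=1..r. embA \<iota> (a i) * normalized r \<omega> i)"

text \<open>The infinite product is the limit of its finite subproducts.\<close>

definition lattice_exp :: "'c::{field,metric_space} set \<Rightarrow> 'c \<Rightarrow> 'c" where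
  "lattice_exp \<Lambda> z =
     z * Lim (finite_subsets_at_top (\<Lambda> - {0})) (\<lambda>M. \<Prod>\<mu>\<in>M. 1 - z / \<mu>)"

definition alpha ::
  "('f::finite_field fls alg_closure \<Rightarrow> 'c::{field,metric_space}) \<Rightarrow> nat \<Rightarrow> nat \<Rightarrow> (nat \<Rightarrow> 'c) \<Rightarrow> 'c"
  where
  "alpha \<iota> r k \<omega> =
     (THE \<alpha> :: nat \<Rightarrow> 'c. \<forall>z.
        (\<lambda>i. \<alpha> i * z ^ (CARD('f) ^ i)) sums lattice_exp (period_lattice \<iota> r \<omega>) z) k"

definition ell ::
  "('f::finite_field fls alg_closure \<Rightarrow> 'c::{field,metric_space}) \<Rightarrow>
     nat \<Rightarrow> 'f poly \<Rightarrow> nat \<Rightarrow> (nat \<Rightarrow> 'c) \<Rightarrow> 'c" where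
  "ell \<iota> r a k \<omega> =
     (THE l :: nat \<Rightarrow> 'c.
        (\<forall>i > r * Polynomial.degree a. l i = 0) \<and>
        (\<forall>z. lattice_exp (period_lattice \<iota> r \<omega>) (embA \<iota> a * z) =
           (\<Sum>i \<le> r * Polynomial.degree a.
              l i * lattice_exp (period_lattice \<iota> r \<omega>) z ^ (CARD('f) ^ i)))) k"


section \<open>The Carlitz module\<close>

definition carlitz_T :: "'f::finite_field poly poly" where
  "carlitz_T = [:0, [:0, 1:]:] + Polynomial.monom 1 CARD('f)"

text \<open>
  \<open>\<rho>\<^sub>a(X) \<in> A[X]\<close>; since \<open>\<rho>\<close> is a homomorphism of \<open>\<F>\<^sub>q\<close>-algebras,
  \<open>\<rho>\<^sub>a\<close> is the sum of the \<open>a\<^sub>i \<rho>\<^sub>T \<circ> \<dots> \<circ> \<rho>\<^sub>T\<close> (\<open>i\<close> factors) for \<open>a = \<Sum> a\<^sub>i T\<^sup>i\<close>.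
\<close>

definition carlitz :: "'f::finite_field poly \<Rightarrow> 'f poly poly" where
  "carlitz a = (\<Sum>i \<le> Polynomial.degree a.
     Polynomial.smult [:Polynomial.coeff a i:] ((pcompose carlitz_T ^^ i) [:0, 1:]))"

definition carlitz_coeff :: "'f::finite_field poly \<Rightarrow> nat \<Rightarrow> 'f poly" where
  "carlitz_coeff a k = Polynomial.coeff (carlitz a) (CARD('f) ^ k)"

definition carlitz_period ::
  "('f::finite_field fls alg_closure \<Rightarrow> 'c::{field,metric_space}) \<Rightarrow> 'c \<Rightarrow> bool" where
  "carlitz_period \<iota> \<pi> \<longleftrightarrow> \<pi> \<noteq> 0 \<and>
     (\<forall>a z. lattice_exp (range (\<lambda>b. \<pi> * embA \<iota> b)) (embA \<iota> a * z) =
        poly (map_poly (embA \<iota>) (carlitz a)) (lattice_exp (range (\<lambda>b. \<pi> * embA \<iota> b)) z))"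

definition bracket :: "nat \<Rightarrow> 'f::finite_field poly" where
  "bracket i = Polynomial.monom 1 (CARD('f) ^ i) - Polynomial.monom 1 1"

definition carlitz_D :: "nat \<Rightarrow> 'f::finite_field poly" where
  "carlitz_D k = (\<Prod>i=1..k. bracket i ^ (CARD('f) ^ (k - i)))"


section \<open>The normalized forms\<close>

definition ell_tilde ::
  "('f::finite_field fls alg_closure \<Rightarrow> 'c::{field,metric_space}) \<Rightarrow>
     'c \<Rightarrow> nat \<Rightarrow> 'f poly \<Rightarrow> nat \<Rightarrow> (nat \<Rightarrow> 'c) \<Rightarrow> 'c" where
  "ell_tilde \<iota> \<pi> r a k \<omega> =
     \<pi> powi (1 - int (CARD('f) ^ k)) * inverse (embA \<iota> (carlitz_coeff a k)) * ell \<iota> r a k \<omega>"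

definition alpha_tilde ::
  "('f::finite_field fls alg_closure \<Rightarrow> 'c::{field,metric_space}) \<Rightarrow>
     'c \<Rightarrow> nat \<Rightarrow> nat \<Rightarrow> (nat \<Rightarrow> 'c) \<Rightarrow> 'c" where
  "alpha_tilde \<iota> \<pi> r k \<omega> =
     \<pi> powi (1 - int (CARD('f) ^ k)) * embA \<iota> (carlitz_D k) * alpha \<iota> r k \<omega>"

end

theory Submission
  imports Defs
begin

text \<open>
  Put \<open>e = e\<^sub>\<Lambda>\<close>. Comparing coefficients in \<open>e (a z) = \<Sum>\<^sub>k \<ell>\<^sub>k e(z)^(q^k)\<close> gives
  \<open>\<alpha>\<^sub>m a^(q^m) = \<Sum>\<^sub>k \<ell>\<^sub>k \<alpha>\<^bsub>m-k\<^esub>^(q^k)\<close>, where \<open>k \<le> m\<close>. If all nonzero lattice vectors have absolute value at least \<open>\<delta>\<close>,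
  then \<open>|\<alpha>\<^sub>m| \<le> \<delta>^(1 - q^m)\<close>, so by induction \<open>\<ell>\<^sub>m / a^(q^m) = \<alpha>\<^sub>m + O(1/|a|)\<close> with a constant
  depending only on \<open>m\<close> and \<open>\<delta>\<close>. For the Carlitz module, commutation with \<open>\<rho>\<^sub>T\<close> gives
  \<open>[k] c\<^sub>k = c\<^bsub>k-1\<^esub>^q - c\<^bsub>k-1\<^esub>\<close>, hence \<open>c\<^sub>k / a^(q^k) = 1 / D\<^sub>k + O(1/|a|)\<close>, and the theorem follows on any set
  where \<open>\<delta>\<close> can be chosen uniformly.

  Every open affinoid \<open>V\<close> of \<open>\<Omega>\<^sup>r\<close> is such a set: an inequality \<open>|f\<^sub>j| \<le> |f\<^sub>0|\<close> with \<open>|f\<^sub>0|\<close> bounded below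
  survives small perturbations, uniformly on \<open>V\<close>, so \<open>V\<close> keeps a positive distance from all the
  \<open>K\<^sub>\<infinity>\<close>-rational hyperplanes. Therefore one may take the covering by all open affinoids contained in \<open>\<Omega>\<^sup>r\<close>.
\<close>

section \<open>The Frobenius endomorphism\<close>

text \<open>The functional equation cannot be taken for granted: \<open>lattice_exp\<close> is a
  limit over all finite subsets, and \<open>alpha\<close> and \<open>ell\<close> are definite
  descriptions. The lattice is therefore exhausted by the finite F_q-spaces
  \<open>level r \<omega> n\<close> of combinations with coefficients of degree below n. The product
  of z - s over such a space is a q-polynomial, hence additive in z, and division with remainder by
  a splits the space of level n + deg a into remainders plus a-multiples of level n. This proves a
  finite form of the equation; its limit gives the division formula for e and the existence of
  \<open>ell\<close>, whose uniqueness comes out of the recursion because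
  \<open>\<alpha> 0 = 1\<close>. The constant \<delta> is demanded not just for lattice vectors but
  for every coefficient of a linear form over the local field (\<open>separated\<close>): this also
  makes bounded parts of the lattice finite and coefficient vectors unique. The bound on the
  \<alpha> m arises because each factor 1 - z/\<mu> has Gauss norm at most 1 on the disc of radius
  \<delta>.\<close>

lemma of_nat_choose_card_finite_field:
  assumes "0 < j" "j < CARD('f::finite_field)"
  shows "(of_nat (CARD('f) choose j) :: 'f) = 0"
proof -
  let ?q = "CARD('f)"
  \<comment> \<open>The polynomial \<open>(1 + X)^q - X^q - 1\<close> has degree below q, yet it
    vanishes at all q field elements since \<open>x^q = x\<close>. Its coefficients are the inner
    binomial coefficients.\<close>
  define D :: "'f poly" where "D = [:1, 1:] ^ ?q - Polynomial.monom 1 ?q - 1"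
  have q: "?q > 0" by (simp add: finite_UNIV_card_ge_0)
  have cD: "Polynomial.coeff D i = (if 0 < i \<and> i < ?q then of_nat (?q choose i) else 0)" for i
  proof -
    have "Polynomial.coeff ([:1, 1:] ^ ?q :: 'f poly) i = of_nat (?q choose i)"
    proof (cases "i \<le> ?q")
      case True
      then show ?thesis by (simp add: coeff_linear_poly_power)
    next
      case False
      then show ?thesis by (simp add: coeff_eq_0 degree_linear_power binomial_eq_0)
    qed
    then show ?thesis using q by (auto simp: D_def coeff_1 binomial_eq_0)
  qed
  have "D = 0"
  proof (rule ccontr)
    assume D: "D \<noteq> 0"
    have deg: "Polynomial.degree D < ?q"
      using q D by (intro degree_lessI) (auto simp: cD)
    have "poly D x = 0" for x
      by (simp add: D_def poly_monom finite_field_power_card_eq_same)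
    then have "{x. poly D x = 0} = UNIV" by auto
    then have "?q \<le> Polynomial.degree D" using card_poly_roots_bound[OF D] by simp
    with deg show False by simp
  qed
  then show ?thesis using cD[of j] assms by simp
qed

text \<open>The inner binomial coefficients vanish in the finite field, so they are divisible by its
  characteristic and vanish in every commutative ring of the same characteristic. This generality
  serves \<open>'c\<close>, \<open>'f poly\<close> and polynomials over the latter.\<close>

lemma power_card_add:
  assumes "CHAR('a::comm_ring_1) = CHAR('f::finite_field)"
  shows "(x + y :: 'a) ^ CARD('f) = x ^ CARD('f) + y ^ CARD('f)"
proof -
  let ?q = "CARD('f)"
  have q: "?q > 0" by (simp add: finite_UNIV_card_ge_0)
  have "(x + y) ^ ?q = (\<Sum>k\<le>?q. of_nat (?q choose k) * x ^ k * y ^ (?q - k))"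
    by (rule binomial_ring)
  also have "\<dots> = (\<Sum>k\<in>{0,?q}. of_nat (?q choose k) * x ^ k * y ^ (?q - k))"
  proof (intro sum.mono_neutral_right ballI)
    fix k assume "k \<in> {..?q} - {0, ?q}"
    then have "(of_nat (?q choose k) :: 'f) = 0"
      by (intro of_nat_choose_card_finite_field) auto
    then have "(of_nat (?q choose k) :: 'a) = 0"
      using assms by (simp add: of_nat_eq_0_iff_char_dvd)
    then show "of_nat (?q choose k) * x ^ k * y ^ (?q - k) = 0" by simp
  qed auto
  finally show ?thesis using q by (simp add: add_ac)
qed

lemma power_card_power_add:
  assumes "CHAR('a::comm_ring_1) = CHAR('f::finite_field)"
  shows "(x + y :: 'a) ^ (CARD('f) ^ n) = x ^ (CARD('f) ^ n) + y ^ (CARD('f) ^ n)"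
  by (induction n) (simp_all add: power_mult power_card_add[OF assms] mult.commute[of "CARD('f)"])

lemma power_card_power_sum:
  assumes "CHAR('a::comm_ring_1) = CHAR('f::finite_field)"
  shows "(\<Sum>i\<in>I. g i :: 'a) ^ (CARD('f) ^ n) = (\<Sum>i\<in>I. g i ^ (CARD('f) ^ n))"
  by (induction I rule: infinite_finite_induct)
    (simp_all add: power_card_power_add[OF assms] power_0_left)

lemma card_finite_field_ge_2: "CARD('f::finite_field) \<ge> 2"
proof -
  have "card {0, 1::'f} \<le> CARD('f)" by (intro card_mono) auto
  then show ?thesis by simp
qed

section \<open>The absolute value\<close>

context C_infinity
begin

lemma q_ge_2: "CARD('f) \<ge> 2" by (rule card_finite_field_ge_2)

lemma q_pos [simp]: "CARD('f) > 0" using q_ge_2 by linarith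

lemma absv_nonneg [simp]: "absv (x::'c) \<ge> 0"
  by (simp add: absv_def)

lemma absv_0 [simp]: "absv (0::'c) = 0"
  by (simp add: absv_def)

lemma absv_eq_0 [simp]: "absv (x::'c) = 0 \<longleftrightarrow> x = 0"
  by (simp add: absv_def)

lemma absv_pos [simp]: "0 < absv (x::'c) \<longleftrightarrow> x \<noteq> 0"
  by (simp add: absv_def)

lemma absv_1 [simp]: "absv (1::'c) = 1"
  using absv_mult[of 1 1] by simp

lemma absv_minus [simp]: "absv (- x::'c) = absv x"
proof -
  have "absv (-1::'c) * absv (-1::'c) = 1" using absv_mult[of "-1" "-1"] by simp
  then have "absv (-1::'c) = 1"
    by (metis absv_nonneg abs_of_nonneg real_sqrt_abs2 real_sqrt_one)
  then show ?thesis using absv_mult[of "-1" x] by simp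
qed

lemma absv_power: "absv ((x::'c) ^ n) = absv x ^ n"
  by (induction n) (simp_all add: absv_mult)

lemma absv_inverse: "absv (inverse (x::'c)) = inverse (absv x)"
proof (cases "x = 0")
  case False
  then have "absv x * absv (inverse x) = 1" by (simp flip: absv_mult)
  then show ?thesis by (simp add: inverse_unique)
qed simp

lemma absv_divide: "absv ((x::'c) / y) = absv x / absv y"
  by (simp add: divide_inverse absv_mult absv_inverse)

lemma absv_prod: "absv (\<Prod>i\<in>I. f i :: 'c) = (\<Prod>i\<in>I. absv (f i))"
  by (induction I rule: infinite_finite_induct) (simp_all add: absv_mult)

lemma absv_diff_le: "absv ((x::'c) - y) \<le> max (absv x) (absv y)"
  using absv_ultrametric[of x "-y"] by simp

lemma absv_commute: "absv ((x::'c) - y) = absv (y - x)"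
  by (metis absv_minus minus_diff_eq)

lemma absv_add_leI: "absv (x::'c) \<le> B \<Longrightarrow> absv y \<le> B \<Longrightarrow> absv (x + y) \<le> B"
  using absv_ultrametric[of x y] by simp

lemma absv_diff_leI: "absv (x::'c) \<le> B \<Longrightarrow> absv y \<le> B \<Longrightarrow> absv (x - y) \<le> B"
  using absv_diff_le[of x y] by simp

lemma absv_add_lessI: "absv (x::'c) < B \<Longrightarrow> absv y < B \<Longrightarrow> absv (x + y) < B"
  using absv_ultrametric[of x y] by simp

lemma absv_diff_lessI: "absv (x::'c) < B \<Longrightarrow> absv y < B \<Longrightarrow> absv (x - y) < B"
  using absv_diff_le[of x y] by simp

lemma absv_sum_le:
  assumes "\<And>i. i \<in> I \<Longrightarrow> absv (f i :: 'c) \<le> B" "B \<ge> 0"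
  shows "absv (\<Sum>i\<in>I. f i) \<le> B"
  using assms by (induction I rule: infinite_finite_induct) (auto intro!: absv_add_leI)

lemma absv_sum_less:
  assumes "\<And>i. i \<in> I \<Longrightarrow> absv (f i :: 'c) < B" "B > 0"
  shows "absv (\<Sum>i\<in>I. f i) < B"
  using assms by (induction I rule: infinite_finite_induct) (auto intro!: absv_add_lessI)

text \<open>The isosceles principle of ultrametric spaces. It is the means by which lower bounds and
  nonvanishing survive perturbations and limits.\<close>

lemma absv_eqI: "absv ((x::'c) - y) < absv y \<Longrightarrow> absv x = absv y"
  using absv_ultrametric[of "x - y" y] absv_diff_le[of x "x - y"] by (auto simp: max_def split: if_splits)

lemma absv_add_eq: "absv (y::'c) < absv x \<Longrightarrow> absv (x + y) = absv x"
  by (intro absv_eqI) auto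

lemma tendsto_absv:
  "(f \<longlongrightarrow> (l::'c)) F \<longleftrightarrow> (\<forall>e>0. eventually (\<lambda>x. absv (f x - l) < e) F)"
  by (simp add: tendsto_iff dist_absv)

section \<open>The embeddings of the Laurent series field and of the polynomial ring\<close>

lemma embK_0 [simp]: "embK \<iota> 0 = 0"
  using emb_add[of 0 0] add_left_cancel[of "\<iota> 0" "\<iota> 0" 0] by (simp add: embK_def)

lemma embK_1 [simp]: "embK \<iota> 1 = 1"
  by (simp add: embK_def emb_one)

lemma embK_add: "embK \<iota> (x + y) = embK \<iota> x + embK \<iota> y"
  by (simp add: embK_def emb_add)

lemma embK_mult: "embK \<iota> (x * y) = embK \<iota> x * embK \<iota> y"
  by (simp add: embK_def emb_mult)

lemma embK_minus: "embK \<iota> (- x) = - embK \<iota> x"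
  using embK_add[of x "-x"] by (simp add: eq_neg_iff_add_eq_0 add.commute)

lemma embK_diff: "embK \<iota> (x - y) = embK \<iota> x - embK \<iota> y"
  using embK_add[of x "-y"] by (simp add: embK_minus)

lemma absv_embK: "absv (embK \<iota> f) = abs_Kinf f"
  by (simp add: embK_def absv_extends)

lemma embK_eq_0 [simp]: "embK \<iota> f = 0 \<longleftrightarrow> f = 0"
  using absv_embK[of f] by (auto simp: abs_Kinf_def split: if_splits)

lemma embK_inverse: "embK \<iota> (inverse x) = inverse (embK \<iota> x)"
proof (cases "x = 0")
  case False
  then have "embK \<iota> x * embK \<iota> (inverse x) = 1" by (simp flip: embK_mult)
  then show ?thesis by (metis inverse_unique)
qed simp

lemma embK_divide: "embK \<iota> (x / y) = embK \<iota> x / embK \<iota> y"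
  by (simp add: divide_inverse embK_mult embK_inverse)

abbreviation TT :: 'c where "TT \<equiv> embK \<iota> fls_X_inv"

abbreviation con :: "'f \<Rightarrow> 'c" where "con c \<equiv> embK \<iota> (fls_const c)"

lemma absv_TT: "absv TT = CARD('f)"
  by (simp add: absv_embK abs_Kinf_def fls_X_inv_subdegree)

lemma absv_TT_gt_1: "absv TT > 1"
  using q_ge_2 by (simp add: absv_TT)

lemma TT_nonzero [simp]: "TT \<noteq> 0"
  using absv_TT_gt_1 by auto

lemma absv_con: "absv (con c) = (if c = 0 then 0 else 1)"
  by (simp add: absv_embK abs_Kinf_def fls_const_subdegree)

lemma con_eq_iff: "con c = con c' \<longleftrightarrow> c = c'"
proof
  assume "con c = con c'"
  then have "con (c - c') = 0" by (simp add: embK_diff flip: fls_minus_const)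
  then show "c = c'" by (simp add: fls_const_nonzero)
qed simp

lemma con_power_q: "con c ^ CARD('f) = con c"
proof -
  have "con c ^ n = con (c ^ n)" for n
    by (induction n) (simp_all add: embK_mult flip: fls_const_mult_const)
  then show ?thesis by (simp add: finite_field_power_card_eq_same)
qed

lemma embA_0 [simp]: "embA \<iota> 0 = 0"
  by (simp add: embA_def)

lemma embA_pCons: "embA \<iota> (pCons c p) = con c + TT * embA \<iota> p"
  by (simp add: embA_def map_poly_pCons embK_add embK_mult)

lemma embA_const: "embA \<iota> [:c:] = con c"
  by (simp add: embA_pCons)

lemma embA_1 [simp]: "embA \<iota> 1 = 1"
  by (simp add: one_pCons embA_const)

lemma embA_add: "embA \<iota> (a + b) = embA \<iota> a + embA \<iota> b"
proof (induction a b rule: poly_induct2)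
  case (pCons a p b r)
  then show ?case by (simp add: embA_pCons embK_add algebra_simps flip: fls_plus_const)
qed simp

lemma embA_smult: "embA \<iota> (Polynomial.smult c a) = con c * embA \<iota> a"
  by (induction a) (simp_all add: embA_pCons algebra_simps embK_mult flip: fls_const_mult_const)

lemma embA_mult: "embA \<iota> (a * b) = embA \<iota> a * embA \<iota> b"
  by (induction a) (simp_all add: embA_pCons embA_add embA_smult algebra_simps)

lemma embA_minus: "embA \<iota> (- a) = - embA \<iota> a"
  using embA_add[of a "-a"] by (simp add: eq_neg_iff_add_eq_0 add.commute)

lemma embA_diff: "embA \<iota> (a - b) = embA \<iota> a - embA \<iota> b"
  using embA_add[of a "-b"] by (simp add: embA_minus)

lemma embA_power: "embA \<iota> (a ^ n) = embA \<iota> a ^ n"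
  by (induction n) (simp_all add: embA_mult)

text \<open>Horner step: for p \<noteq> 0 the term \<open>TT * embA \<iota> p\<close> has absolute
  value at least q, the constant term at most 1, so the former decides.\<close>

lemma absv_embA: "absv (embA \<iota> a) = (if a = 0 then 0 else real CARD('f) ^ Polynomial.degree a)"
proof (induction a)
  case (pCons c p)
  show ?case
  proof (cases "p = 0")
    case False
    have "1 \<le> real CARD('f) ^ Polynomial.degree p" using q_ge_2 by simp
    then have "1 * 1 < real CARD('f) * real CARD('f) ^ Polynomial.degree p"
      using q_ge_2 by (intro mult_less_le_imp_less) auto
    then have "absv (con c) < absv (TT * embA \<iota> p)"
      using False pCons by (simp add: absv_con absv_mult absv_TT)
    then have "absv (TT * embA \<iota> p + con c) = absv (TT * embA \<iota> p)"
      by (rule absv_add_eq)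
    then show ?thesis using False pCons by (simp add: embA_pCons absv_mult absv_TT add.commute)
  qed (use pCons in \<open>auto simp: embA_const absv_con\<close>)
qed simp

lemma embA_eq_0 [simp]: "embA \<iota> a = 0 \<longleftrightarrow> a = 0"
proof -
  have "absv (embA \<iota> a) = 0 \<longleftrightarrow> a = 0" by (simp only: absv_embA) simp
  then show ?thesis by simp
qed

lemma absv_embA_ge_1: "a \<noteq> 0 \<Longrightarrow> absv (embA \<iota> a) \<ge> 1"
  using q_ge_2 by (simp add: absv_embA)

section \<open>Characteristic and Frobenius powers in the complete field\<close>

lemma CHAR_c: "CHAR('c) = CHAR('f)"
proof (rule CHAR_eqI)
  have of_nat: "(of_nat n :: 'c) = con (of_nat n)" for n
    by (induction n) (simp_all add: embK_add flip: fls_plus_const)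
  show "(of_nat CHAR('f) :: 'c) = 0" by (simp add: of_nat)
  show "CHAR('f) dvd n" if "(of_nat n :: 'c) = 0" for n
    using that by (simp add: of_nat fls_const_nonzero of_nat_eq_0_iff_char_dvd)
qed

lemma frob_add: "((x::'c) + y) ^ (CARD('f) ^ n) = x ^ (CARD('f) ^ n) + y ^ (CARD('f) ^ n)"
  by (rule power_card_power_add[OF CHAR_c])

lemma frob_sum: "(\<Sum>i\<in>I. g i :: 'c) ^ (CARD('f) ^ n) = (\<Sum>i\<in>I. g i ^ (CARD('f) ^ n))"
  by (rule power_card_power_sum[OF CHAR_c])

lemma frob_minus: "(- (x::'c)) ^ (CARD('f) ^ n) = - (x ^ (CARD('f) ^ n))"
  using frob_add[of x "-x" n] by (simp add: eq_neg_iff_add_eq_0 add.commute power_0_left)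

lemma frob_diff: "((x::'c) - y) ^ (CARD('f) ^ n) = x ^ (CARD('f) ^ n) - y ^ (CARD('f) ^ n)"
  using frob_add[of x "-y" n] by (simp add: frob_minus)

text \<open>Homogeneous form of the identity \<Prod>(X - c) = \<open>X^q - X\<close> over the field
  with q elements, obtained by comparing two monic polynomials of degree q at q common roots. It is
  the step by which \<open>prod_span_q_polynomial\<close> adjoins one generator to a space of
  roots.\<close>

lemma prod_diff_con_mult: "(\<Prod>c\<in>UNIV. (x::'c) - con c * y) = x ^ CARD('f) - y ^ (CARD('f) - 1) * x"
proof (cases "y = 0")
  case True
  then show ?thesis using q_ge_2 by (simp add: power_0_left)
next
  case False
  define P :: "'c poly" where "P = (\<Prod>c\<in>UNIV. [:- con c, 1:])"
  define Q :: "'c poly" where "Q = P - (Polynomial.monom 1 CARD('f) - Polynomial.monom 1 1)"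
  have degP: "Polynomial.degree P = CARD('f)"
    unfolding P_def by (subst degree_prod_eq_sum_degree) auto
  have monic: "Polynomial.lead_coeff P = 1"
    unfolding P_def by (subst Polynomial.lead_coeff_prod) auto
  have "Q = 0"
  proof (rule ccontr)
    assume Q: "Q \<noteq> 0"
    have c: "Polynomial.coeff Q i = 0" if "i \<ge> CARD('f)" for i
      using that q_ge_2 degP monic by (cases "i = CARD('f)") (auto simp: Q_def coeff_eq_0)
    have deg: "Polynomial.degree Q < CARD('f)"
      using Q by (intro degree_lessI) (auto simp: c)
    have "poly P (con c) = 0" for c by (auto simp: P_def poly_prod)
    then have "con ` UNIV \<subseteq> {x. poly Q x = 0}"
      by (auto simp: Q_def poly_monom con_power_q)
    then have "card (con ` UNIV) \<le> card {x. poly Q x = 0}"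
      by (intro card_mono poly_roots_finite Q)
    also have "card (con ` UNIV) = CARD('f)"
      by (intro card_image) (auto simp: inj_on_def con_eq_iff)
    finally have "CARD('f) \<le> Polynomial.degree Q" using card_poly_roots_bound[OF Q] by linarith
    with deg show False by simp
  qed
  then have P: "poly P (x / y) = (x / y) ^ CARD('f) - x / y"
    by (simp add: Q_def poly_monom)
  have "(\<Prod>c\<in>UNIV. x - con c * y) = (\<Prod>c\<in>UNIV. y * (x / y - con c))"
    using False by (intro prod.cong) (auto simp: field_simps)
  also have "\<dots> = y ^ CARD('f) * poly P (x / y)"
    by (simp add: prod.distrib P_def poly_prod)
  also have "\<dots> = x ^ CARD('f) - y ^ CARD('f) * (x / y)"
    using False by (simp add: P algebra_simps power_divide)
  also have "y ^ CARD('f) * (x / y) = y ^ (CARD('f) - 1) * x"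
    using False q_pos by (cases "CARD('f)") simp_all
  finally show ?thesis .
qed

section \<open>Linear independence over \<open>K\<^sub>\<infinity>\<close>\<close>

lemma abs_Kinf_lessD:
  assumes "abs_Kinf (h :: 'f fls) < real CARD('f) powi (- k)" "z \<le> k"
  shows "fls_nth h z = 0"
proof (cases "h = 0")
  case False
  then have "real CARD('f) powi (- fls_subdegree h) < real CARD('f) powi (- k)"
    using assms by (simp add: abs_Kinf_def)
  then have "fls_subdegree h > k"
    using q_ge_2 power_int_increasing[of "- k" "- fls_subdegree h" "real CARD('f)"]
    by (cases "fls_subdegree h > k") auto
  then show ?thesis using assms by (intro fls_eq0_below_subdegree) auto
qed simp

lemma abs_Kinf_leI:
  assumes "\<And>z. z < k \<Longrightarrow> fls_nth (h :: 'f fls) z = 0"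
  shows "abs_Kinf h \<le> real CARD('f) powi (- k)"
proof (cases "h = 0")
  case False
  then have "fls_subdegree h \<ge> k" using assms by (intro fls_subdegree_geI) auto
  then show ?thesis using False q_ge_2 by (auto simp: abs_Kinf_def intro!: power_int_increasing)
qed (simp add: abs_Kinf_def)

text \<open>Closeness within \<open>q^(-k)\<close> fixes all coefficients of index at most k at
  once, so a Cauchy sequence stabilizes coefficientwise and the stable coefficients form a Laurent
  series.\<close>

lemma Kinf_complete:
  fixes f :: "nat \<Rightarrow> 'f fls"
  assumes "\<And>e. e > 0 \<Longrightarrow> \<exists>N. \<forall>m\<ge>N. \<forall>n\<ge>N. abs_Kinf (f m - f n) < e"
  shows "\<exists>g. \<forall>e>0. \<exists>N. \<forall>n\<ge>N. abs_Kinf (f n - g) < e"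
proof -
  have "\<exists>N. \<forall>m\<ge>N. \<forall>n\<ge>N. \<forall>z\<le>int k. fls_nth (f m) z = fls_nth (f n) z" for k :: nat
  proof -
    have "real CARD('f) powi (- int k) > 0" by simp
    from assms[OF this] obtain N where "\<forall>m\<ge>N. \<forall>n\<ge>N. abs_Kinf (f m - f n) < real CARD('f) powi (- int k)"
      by blast
    then have "\<forall>m\<ge>N. \<forall>n\<ge>N. \<forall>z\<le>int k. fls_nth (f m - f n) z = 0"
      using abs_Kinf_lessD by blast
    then show ?thesis by auto
  qed
  then obtain N where N: "\<And>k m n z. m \<ge> N k \<Longrightarrow> n \<ge> N k \<Longrightarrow> z \<le> int k \<Longrightarrow> fls_nth (f m) z = fls_nth (f n) z"
    by metis
  \<comment> \<open>\<open>nat\<close> sends every negative index to 0, so all coefficients of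
    negative index are taken from the single series \<open>f (N 0)\<close>. This bounds the support
    of \<open>g\<close> from below.\<close>
  define g where "g = Abs_fls (\<lambda>z. fls_nth (f (N (nat z))) z)"
  have g_nth: "fls_nth g z = fls_nth (f (N (nat z))) z" for z
    unfolding g_def
    by (rule nth_Abs_fls_lower_bound[of "min 0 (fls_subdegree (f (N 0)))"])
      (auto simp: fls_eq0_below_subdegree)
  have agree: "fls_nth (f n) z = fls_nth g z" if "n \<ge> N k" "z \<le> int k" for n k z
  proof -
    have "fls_nth (f n) z = fls_nth (f (max n (N (nat z)))) z" using that by (intro N[of k]) auto
    also have "\<dots> = fls_nth g z" unfolding g_nth by (intro N[of "nat z"]) auto
    finally show ?thesis .
  qed
  have "\<exists>N. \<forall>n\<ge>N. abs_Kinf (f n - g) < e" if e: "e > 0" for e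
  proof -
    obtain k where k: "(1 / real CARD('f)) ^ k < e"
      using real_arch_pow_inv[OF e, of "1 / real CARD('f)"] q_ge_2 by auto
    have "abs_Kinf (f n - g) < e" if "n \<ge> N k" for n
    proof -
      have "abs_Kinf (f n - g) \<le> real CARD('f) powi (- int k)"
        using agree[OF that] by (intro abs_Kinf_leI) auto
      also have "\<dots> = (1 / real CARD('f)) ^ k"
        by (simp add: power_int_minus power_one_over inverse_eq_divide)
      finally show ?thesis using k by simp
    qed
    then show ?thesis by blast
  qed
  then show ?thesis by blast
qed

text \<open>A finite-dimensional \<open>K\<^sub>\<infinity>\<close>-space is closed, by completeness, so the distance from the
  last vector to the span of the others is positive.\<close>

lemma independent_imp_lower_bound:
  fixes w :: "nat \<Rightarrow> 'c"
  assumes "\<And>c :: nat \<Rightarrow> 'f fls. (\<Sum>i<m. embK \<iota> (c i) * w i) = 0 \<Longrightarrow> \<forall>i<m. c i = 0"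
  shows "\<exists>\<delta>>0. \<forall>(c :: nat \<Rightarrow> 'f fls). \<forall>j<m. \<delta> * absv (embK \<iota> (c j)) \<le> absv (\<Sum>i<m. embK \<iota> (c i) * w i)"
  using assms
proof (induction m)
  case 0
  then show ?case by (auto intro: exI[of _ 1])
next
  case (Suc m)
  have "\<forall>i<m. c i = 0" if "(\<Sum>i<m. embK \<iota> (c i) * w i) = 0" for c :: "nat \<Rightarrow> 'f fls"
    using Suc.prems[of "c(m := 0)"] that by (auto simp: less_Suc_eq)
  from Suc.IH[OF this] obtain \<delta> where \<delta>: "\<delta> > 0"
    "\<And>(c :: nat \<Rightarrow> 'f fls) j. j < m \<Longrightarrow> \<delta> * absv (embK \<iota> (c j)) \<le> absv (\<Sum>i<m. embK \<iota> (c i) * w i)"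
    by blast
  have "\<exists>\<eta>>0. \<forall>c :: nat \<Rightarrow> 'f fls. \<eta> \<le> absv ((\<Sum>i<m. embK \<iota> (c i) * w i) - w m)"
  proof (rule ccontr)
    assume "\<not> ?thesis"
    then have "\<exists>c :: nat \<Rightarrow> 'f fls. absv ((\<Sum>i<m. embK \<iota> (c i) * w i) - w m) < \<eta>" if "\<eta> > 0" for \<eta>
      using that by (auto simp: not_le)
    from this[of "1 / Suc n" for n]
    have "\<exists>c :: nat \<Rightarrow> 'f fls. absv ((\<Sum>i<m. embK \<iota> (c i) * w i) - w m) < 1 / Suc n" for n
      by simp
    then obtain c :: "nat \<Rightarrow> nat \<Rightarrow> 'f fls"
      where c: "\<And>n. absv ((\<Sum>i<m. embK \<iota> (c n i) * w i) - w m) < 1 / Suc n" by metis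
    have conv: "\<exists>g. \<forall>e>0. \<exists>N. \<forall>n\<ge>N. abs_Kinf (c n i - g) < e" if i: "i < m" for i
    proof (rule Kinf_complete)
      fix e :: real assume e: "e > 0"
      obtain N where N: "1 / Suc N < \<delta> * e"
        using \<delta>(1) e by (metis mult_pos_pos nat_approx_posE)
      have "abs_Kinf (c k i - c l i) < e" if "k \<ge> N" "l \<ge> N" for k l
      proof -
        have le: "1 / Suc n \<le> 1 / Suc N" if "n \<ge> N" for n
          using that by (intro divide_left_mono) auto
        have eq: "(\<Sum>i<m. embK \<iota> (c k i - c l i) * w i) =
            ((\<Sum>i<m. embK \<iota> (c k i) * w i) - w m) - ((\<Sum>i<m. embK \<iota> (c l i) * w i) - w m)"
          by (simp add: embK_diff algebra_simps sum_subtractf)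
        have "absv ((\<Sum>i<m. embK \<iota> (c k i) * w i) - w m) < 1 / Suc N"
          using c[of k] le[OF that(1)] by linarith
        moreover have "absv ((\<Sum>i<m. embK \<iota> (c l i) * w i) - w m) < 1 / Suc N"
          using c[of l] le[OF that(2)] by linarith
        ultimately have "absv (\<Sum>i<m. embK \<iota> (c k i - c l i) * w i) < 1 / Suc N"
          unfolding eq by (rule absv_diff_lessI)
        then have "\<delta> * absv (embK \<iota> (c k i - c l i)) < \<delta> * e"
          using \<delta>(2)[of i "\<lambda>i. c k i - c l i"] i N by linarith
        then show ?thesis using \<delta>(1) by (simp add: absv_embK)
      qed
      then show "\<exists>N. \<forall>k\<ge>N. \<forall>l\<ge>N. abs_Kinf (c k i - c l i) < e" by blast
    qed
    then obtain g where g: "\<And>i e. i < m \<Longrightarrow> e > 0 \<Longrightarrow> \<exists>N. \<forall>n\<ge>N. abs_Kinf (c n i - g i) < e"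
      by metis
    have "absv ((\<Sum>i<m. embK \<iota> (g i) * w i) - w m) < e" if e: "e > 0" for e
    proof -
      define W where "W = 1 + (\<Sum>i<m. absv (w i))"
      have W: "absv (w i) < W" "W > 0" if "i < m" for i
      proof -
        have "absv (w i) \<le> (\<Sum>i<m. absv (w i))" using that by (intro member_le_sum) auto
        then show "absv (w i) < W" by (simp add: W_def)
        with absv_nonneg[of "w i"] show "W > 0" by linarith
      qed
      have "\<forall>i<m. \<exists>N. \<forall>n\<ge>N. abs_Kinf (c n i - g i) < e / W"
        using g W e by (metis divide_pos_pos)
      then obtain N where N: "\<And>i n. i < m \<Longrightarrow> n \<ge> N i \<Longrightarrow> abs_Kinf (c n i - g i) < e / W" by metis
      obtain N' where N': "1 / Suc N' < e" using e by (metis nat_approx_posE)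
      define n where "n = N' + (\<Sum>i<m. N i)"
      have nN: "n \<ge> N i" if "i < m" for i
        using member_le_sum[of i "{..<m}" N] that by (simp add: n_def)
      have "N' \<le> n" by (simp add: n_def)
      then have "1 / Suc n \<le> 1 / Suc N'" by (intro divide_left_mono) auto
      with N' c[of n] have 1: "absv ((\<Sum>i<m. embK \<iota> (c n i) * w i) - w m) < e" by linarith
      have 2: "absv (\<Sum>i<m. embK \<iota> (c n i - g i) * w i) < e"
      proof (rule absv_sum_less[OF _ e])
        fix i assume "i \<in> {..<m}"
        then have i: "i < m" by simp
        have "absv (embK \<iota> (c n i - g i) * w i) \<le> abs_Kinf (c n i - g i) * W"
          using W(1)[OF i] by (simp add: absv_mult mult_left_mono flip: absv_embK)
        also have "\<dots> < e / W * W"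
          using N[OF i nN[OF i]] W(2)[OF i] by (intro mult_strict_right_mono) auto
        also have "\<dots> = e" using W(2)[OF i] by simp
        finally show "absv (embK \<iota> (c n i - g i) * w i) < e" .
      qed
      have eq: "(\<Sum>i<m. embK \<iota> (g i) * w i) - w m =
          ((\<Sum>i<m. embK \<iota> (c n i) * w i) - w m) - (\<Sum>i<m. embK \<iota> (c n i - g i) * w i)"
        by (simp add: embK_diff algebra_simps sum_subtractf)
      show ?thesis unfolding eq by (rule absv_diff_lessI[OF 1 2])
    qed
    then have "absv ((\<Sum>i<m. embK \<iota> (g i) * w i) - w m) = 0"
      by (metis absv_nonneg less_eq_real_def less_irrefl)
    \<comment> \<open>The limit coefficients together with -1 at index m are a nontrivial
      relation.\<close>
    then have "(\<Sum>i<Suc m. embK \<iota> ((g(m := -1)) i) * w i) = 0"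
      by (simp add: embK_minus)
    from Suc.prems[OF this] show False by (metis fun_upd_same lessI neg_equal_0_iff_equal one_neq_zero)
  qed
  then obtain \<eta> where \<eta>: "\<eta> > 0" "\<And>c :: nat \<Rightarrow> 'f fls. \<eta> \<le> absv ((\<Sum>i<m. embK \<iota> (c i) * w i) - w m)"
    by blast
  \<comment> \<open>\<open>\<theta>\<close> transfers control from the last coefficient to the
    others: once \<eta> times the size of \<open>c m\<close> is at most that of s, the term
    \<open>c m * w m\<close> is at most \<theta> times the size of s.\<close>
  define \<theta> where "\<theta> = max 1 (absv (w m) / \<eta>)"
  have \<theta>: "\<theta> \<ge> 1" "absv (w m) \<le> \<theta> * \<eta>"
    using \<eta>(1) by (auto simp: \<theta>_def max_def field_simps)
  show ?case
  proof (intro exI[of _ "min \<eta> (\<delta> / \<theta>)"] conjI allI impI)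
    show "min \<eta> (\<delta> / \<theta>) > 0" using \<delta>(1) \<eta>(1) \<theta> by auto
    fix c :: "nat \<Rightarrow> 'f fls" and j assume j: "j < Suc m"
    define s where "s = (\<Sum>i<Suc m. embK \<iota> (c i) * w i)"
    have sm: "\<eta> * absv (embK \<iota> (c m)) \<le> absv s"
    proof (cases "c m = 0")
      case False
      \<comment> \<open>Normalizing the last coefficient to -1 exhibits \<open>s\<close> as a
        multiple of a vector bounded below by \<open>\<eta>\<close>.\<close>
      have "- embK \<iota> (c m) * ((\<Sum>i<m. embK \<iota> (- (c i / c m)) * w i) - w m) = s"
        using False by (simp add: s_def embK_minus embK_divide algebra_simps sum_distrib_left sum_negf)
      then have "absv s = absv (embK \<iota> (c m)) * absv ((\<Sum>i<m. embK \<iota> (- (c i / c m)) * w i) - w m)"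
        by (metis absv_minus absv_mult)
      also have "\<dots> \<ge> absv (embK \<iota> (c m)) * \<eta>"
        by (intro mult_left_mono \<eta>(2)) auto
      finally show ?thesis by (simp add: mult.commute)
    qed simp
    show "min \<eta> (\<delta> / \<theta>) * absv (embK \<iota> (c j)) \<le> absv (\<Sum>i<Suc m. embK \<iota> (c i) * w i)"
    proof (cases "j = m")
      case True
      have "min \<eta> (\<delta> / \<theta>) * absv (embK \<iota> (c j)) \<le> \<eta> * absv (embK \<iota> (c m))"
        unfolding True by (intro mult_right_mono) auto
      with sm show ?thesis by (simp add: s_def)
    next
      case False
      have "\<delta> * absv (embK \<iota> (c j)) \<le> absv (s - embK \<iota> (c m) * w m)"
        using \<delta>(2)[of j c] j False by (simp add: s_def)
      also have "\<dots> \<le> max (absv s) (absv (embK \<iota> (c m) * w m))" by (rule absv_diff_le)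
      also have "\<dots> \<le> \<theta> * absv s"
      proof (rule max.boundedI)
        show "absv s \<le> \<theta> * absv s" using mult_right_mono[of 1 \<theta> "absv s"] \<theta>(1) by simp
        have "absv (embK \<iota> (c m) * w m) \<le> absv (embK \<iota> (c m)) * (\<theta> * \<eta>)"
          using \<theta>(2) by (simp add: absv_mult mult_left_mono)
        also have "\<dots> = \<theta> * (\<eta> * absv (embK \<iota> (c m)))" by simp
        also have "\<dots> \<le> \<theta> * absv s" using sm \<theta>(1) by (intro mult_left_mono) auto
        finally show "absv (embK \<iota> (c m) * w m) \<le> \<theta> * absv s" .
      qed
      finally have "\<delta> / \<theta> * absv (embK \<iota> (c j)) \<le> absv s"
        using \<theta>(1) by (simp add: field_simps)
      moreover have "min \<eta> (\<delta> / \<theta>) * absv (embK \<iota> (c j)) \<le> \<delta> / \<theta> * absv (embK \<iota> (c j))"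
        by (intro mult_right_mono) auto
      ultimately show ?thesis by (simp add: s_def)
    qed
  qed
qed

text \<open>Quantitative form of the linear independence that defines \<open>Omega\<close>. Since
  the coefficients range over the whole local field, the condition bounds the distance to all
  rational hyperplanes; \<open>\<delta>\<close> is the only datum of \<omega> on which the later
  error constants depend.\<close>

definition separated :: "nat \<Rightarrow> real \<Rightarrow> (nat \<Rightarrow> 'c) \<Rightarrow> bool" where
  "separated r \<delta> \<omega> \<longleftrightarrow> (\<forall>c :: nat \<Rightarrow> 'f fls. \<forall>j\<in>{1..r}.
     \<delta> * absv (embK \<iota> (c j)) \<le> absv (\<Sum>i=1..r. embK \<iota> (c i) * normalized r \<omega> i))"

text \<open>A pointwise constant, with no uniformity in \<omega>; it serves to find an affinoid
  neighbourhood of each point inside the period domain.\<close>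

lemma Omega_separated:
  assumes "\<omega> \<in> Omega \<iota> r"
  shows "\<exists>\<delta>>0. separated r \<delta> \<omega>"
proof -
  have "\<forall>i<r. c i = 0" if "(\<Sum>i<r. embK \<iota> (c i) * normalized r \<omega> (Suc i)) = 0" for c :: "nat \<Rightarrow> 'f fls"
  proof -
    have "(\<Sum>i=1..r. embK \<iota> ((c \<circ> (\<lambda>i. i - 1)) i) * normalized r \<omega> i) = 0"
      using that by (simp add: sum.atLeast1_atMost_eq)
    then have "\<forall>i\<in>{1..r}. (c \<circ> (\<lambda>i. i - 1)) i = 0"
      using assms unfolding Omega_def by blast
    then show ?thesis by (force simp: Suc_le_eq)
  qed
  from independent_imp_lower_bound[where m = r and w = "\<lambda>i. normalized r \<omega> (Suc i)", OF this]
  obtain \<delta> where \<delta>: "\<delta> > 0" "\<And>(c :: nat \<Rightarrow> 'f fls) j. j < r \<Longrightarrow>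
      \<delta> * absv (embK \<iota> (c j)) \<le> absv (\<Sum>i<r. embK \<iota> (c i) * normalized r \<omega> (Suc i))" by blast
  have "separated r \<delta> \<omega>"
    unfolding separated_def
  proof (intro allI ballI)
    fix c :: "nat \<Rightarrow> 'f fls" and j assume "j \<in> {1..r}"
    moreover from this have "j - 1 < r" by auto
    ultimately show "\<delta> * absv (embK \<iota> (c j)) \<le> absv (\<Sum>i=1..r. embK \<iota> (c i) * normalized r \<omega> i)"
      using \<delta>(2)[of "j - 1" "c \<circ> Suc"] by (simp add: sum.atLeast1_atMost_eq)
  qed
  with \<delta>(1) show ?thesis by blast
qed

section \<open>Affinoid subsets of the period domain\<close>

text \<open>If s \<noteq> 0, partial sums close to s have exactly the absolute value of s, and each
  partial sum obeys the ultrametric bound.\<close>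

lemma has_sum_absv_le:
  assumes "(f has_sum (s::'c)) A" "\<And>x. x \<in> A \<Longrightarrow> absv (f x) \<le> B" "B \<ge> 0"
  shows "absv s \<le> B"
proof (cases "s = 0")
  case False
  have "eventually (\<lambda>M. absv (sum f M - s) < absv s) (finite_subsets_at_top A)"
    using assms(1) False by (simp add: has_sum_def tendsto_absv)
  moreover have "eventually (\<lambda>M. finite M \<and> M \<subseteq> A) (finite_subsets_at_top A)"
    by (simp add: eventually_finite_subsets_at_top_weakI)
  ultimately obtain M where M: "absv (sum f M - s) < absv s" "M \<subseteq> A"
    by (metis (mono_tags, lifting) eventually_conj eventually_happens finite_subsets_at_top_neq_bot)
  have "absv (sum f M) \<le> B" using M(2) assms(2,3) by (intro absv_sum_le) auto
  with absv_eqI[OF M(1)] show ?thesis by simp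
qed (use assms in simp)

lemma has_sum_diff_absv:
  assumes "(f has_sum (s::'c)) A" "(g has_sum t) A"
  shows "((\<lambda>x. f x - g x) has_sum (s - t)) A"
  unfolding has_sum_def tendsto_absv
proof (intro allI impI)
  fix e :: real assume "e > 0"
  with assms have "eventually (\<lambda>M. absv (sum f M - s) < e) (finite_subsets_at_top A)"
    "eventually (\<lambda>M. absv (sum g M - t) < e) (finite_subsets_at_top A)"
    by (simp_all add: has_sum_def tendsto_absv)
  then show "eventually (\<lambda>M. absv (sum (\<lambda>x. f x - g x) M - (s - t)) < e) (finite_subsets_at_top A)"
  proof eventually_elim
    case (elim M)
    have eq: "sum (\<lambda>x. f x - g x) M - (s - t) = (sum f M - s) - (sum g M - t)"
      by (simp add: sum_subtractf)
    show ?case unfolding eq using elim by (rule absv_diff_lessI)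
  qed
qed

text \<open>Telescoping with the strong triangle inequality: the relative error \<theta> of a
  product is no larger than that of its factors, however many there are. Hence all monomials share
  one Lipschitz constant.\<close>

lemma absv_prod_diff_le:
  fixes a b :: "'i \<Rightarrow> 'c"
  assumes "\<And>i. i \<in> I \<Longrightarrow> absv (a i) \<le> R i" "\<And>i. i \<in> I \<Longrightarrow> absv (b i) \<le> R i"
    and "\<And>i. i \<in> I \<Longrightarrow> absv (a i - b i) \<le> \<theta> * R i" "\<theta> \<ge> 0"
  shows "absv ((\<Prod>i\<in>I. a i) - (\<Prod>i\<in>I. b i)) \<le> \<theta> * (\<Prod>i\<in>I. R i)"
  using assms
proof (induction I rule: infinite_finite_induct)
  case (insert i I)
  have R: "R i \<ge> 0" "(\<Prod>i\<in>I. R i) \<ge> 0"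
    using insert.prems by (auto intro!: prod_nonneg intro: order_trans[OF absv_nonneg])
  have 1: "absv (\<Prod>i\<in>I. a i) \<le> (\<Prod>i\<in>I. R i)"
    using insert.prems by (auto simp: absv_prod intro!: prod_mono)
  have eq: "(\<Prod>i\<in>insert i I. a i) - (\<Prod>i\<in>insert i I. b i) =
      (a i - b i) * (\<Prod>i\<in>I. a i) + b i * ((\<Prod>i\<in>I. a i) - (\<Prod>i\<in>I. b i))"
    using insert by (simp add: algebra_simps)
  have "absv ((a i - b i) * (\<Prod>i\<in>I. a i)) \<le> (\<theta> * R i) * (\<Prod>i\<in>I. R i)"
    unfolding absv_mult using insert.prems R 1 by (intro mult_mono) auto
  moreover have "absv (b i * ((\<Prod>i\<in>I. a i) - (\<Prod>i\<in>I. b i))) \<le> R i * (\<theta> * (\<Prod>i\<in>I. R i))"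
    unfolding absv_mult using insert R by (intro mult_mono) auto
  ultimately show ?case
    unfolding eq using insert by (intro absv_add_leI) (auto simp: algebra_simps)
qed auto

lemma absv_power_diff_le:
  assumes "absv (x::'c) \<le> R" "absv y \<le> R" "absv (x - y) \<le> \<theta> * R" "\<theta> \<ge> 0"
  shows "absv (x ^ n - y ^ n) \<le> \<theta> * R ^ n"
  using absv_prod_diff_le[of "{..<n}" "\<lambda>_. x" "\<lambda>_. R" "\<lambda>_. y" \<theta>] assms by simp

text \<open>Only finitely many weighted coefficients reach 1, so 1 plus their sum is a
  bound.\<close>

lemma tate_coeff_bound:
  assumes "\<forall>\<epsilon>>0. finite {\<nu> \<in> I. absv (c \<nu> :: 'c) * R ^ N \<nu> \<ge> \<epsilon>}"
  shows "\<exists>M>0. \<forall>\<nu>\<in>I. absv (c \<nu>) * R ^ N \<nu> \<le> M"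
proof -
  define F where "F = {\<nu> \<in> I. absv (c \<nu>) * R ^ N \<nu> \<ge> 1}"
  have F: "finite F" using assms unfolding F_def by (metis zero_less_one)
  have "absv (c \<nu>) * R ^ N \<nu> \<le> 1 + (\<Sum>\<nu>\<in>F. absv (c \<nu>) * R ^ N \<nu>)" if "\<nu> \<in> I" for \<nu>
  proof (cases "\<nu> \<in> F")
    case True
    then have "absv (c \<nu>) * R ^ N \<nu> \<le> (\<Sum>\<nu>\<in>F. absv (c \<nu>) * R ^ N \<nu>)"
      using F by (intro member_le_sum) (auto simp: F_def)
    then show ?thesis by simp
  next
    case False
    moreover have "0 \<le> (\<Sum>\<nu>\<in>F. absv (c \<nu>) * R ^ N \<nu>)" by (intro sum_nonneg) (auto simp: F_def)
    ultimately show ?thesis using that by (auto simp: F_def)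
  qed
  moreover have "0 \<le> (\<Sum>\<nu>\<in>F. absv (c \<nu>) * R ^ N \<nu>)" by (intro sum_nonneg) (auto simp: F_def)
  ultimately show ?thesis
    by (intro exI[of _ "1 + (\<Sum>\<nu>\<in>F. absv (c \<nu>) * R ^ N \<nu>)"]) auto
qed

text \<open>Both estimates hold term by term with M a bound for the weighted coefficients, and pass
  to the sum by \<open>has_sum_absv_le\<close>. Increments are measured relative to the radius R, so
  that \<open>\<eta>\<close> is the relative error of \<open>absv_prod_diff_le\<close>.\<close>

lemma tate_bounded_Lipschitz:
  assumes "f \<in> tate n R" "R > 0"
  shows "\<exists>M>0. (\<forall>x\<in>polydisc n R. absv (f x :: 'c) \<le> M) \<and>
    (\<forall>x\<in>polydisc n R. \<forall>y\<in>polydisc n R. \<forall>\<eta>\<ge>0. (\<forall>i\<in>{1..n}. absv (x i - y i) \<le> \<eta> * R) \<longrightarrow>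
       absv (f x - f y) \<le> M * \<eta>)"
proof -
  obtain c where c: "\<forall>\<epsilon>>0. finite {\<nu> \<in> multiindices n. absv (c \<nu> :: 'c) * R ^ (\<Sum>i=1..n. \<nu> i) \<ge> \<epsilon>}"
    and sum: "\<And>z. z \<in> polydisc n R \<Longrightarrow>
      ((\<lambda>\<nu>. c \<nu> * (\<Prod>i=1..n. z i ^ \<nu> i)) has_sum f z) (multiindices n)"
    using assms(1) unfolding tate_def by blast
  obtain M where M: "M > 0"
    "\<And>\<nu>. \<nu> \<in> multiindices n \<Longrightarrow> absv (c \<nu>) * R ^ (\<Sum>i=1..n. \<nu> i) \<le> M"
    using tate_coeff_bound[OF c] by blast
  have le: "absv (c \<nu> * t) \<le> M * \<eta>"
    if "\<nu> \<in> multiindices n" "absv t \<le> \<eta> * (\<Prod>i=1..n. R ^ \<nu> i)" "\<eta> \<ge> 0" for \<nu> t \<eta>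
  proof -
    have "absv (c \<nu> * t) \<le> absv (c \<nu>) * (\<eta> * R ^ (\<Sum>i=1..n. \<nu> i))"
      unfolding absv_mult using that by (intro mult_left_mono) (auto simp: power_sum)
    also have "\<dots> = (absv (c \<nu>) * R ^ (\<Sum>i=1..n. \<nu> i)) * \<eta>" by simp
    also have "\<dots> \<le> M * \<eta>" using M(2)[OF that(1)] that(3) by (intro mult_right_mono)
    finally show ?thesis .
  qed
  have "absv (f x) \<le> M" if x: "x \<in> polydisc n R" for x
  proof (rule has_sum_absv_le[OF sum[OF x]])
    fix \<nu> assume \<nu>: "\<nu> \<in> multiindices n"
    have "absv (\<Prod>i=1..n. x i ^ \<nu> i) \<le> 1 * (\<Prod>i=1..n. R ^ \<nu> i)"
      using x by (auto simp: absv_prod absv_power polydisc_def intro!: prod_mono power_mono)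
    from le[OF \<nu> this] show "absv (c \<nu> * (\<Prod>i=1..n. x i ^ \<nu> i)) \<le> M" by simp
  qed (use M in simp)
  moreover have "absv (f x - f y) \<le> M * \<eta>"
    if x: "x \<in> polydisc n R" and y: "y \<in> polydisc n R" and \<eta>: "\<eta> \<ge> 0"
      and d: "\<forall>i\<in>{1..n}. absv (x i - y i) \<le> \<eta> * R" for x y \<eta>
  proof (rule has_sum_absv_le[OF has_sum_diff_absv[OF sum[OF x] sum[OF y]]])
    fix \<nu> assume \<nu>: "\<nu> \<in> multiindices n"
    have "absv ((\<Prod>i=1..n. x i ^ \<nu> i) - (\<Prod>i=1..n. y i ^ \<nu> i)) \<le> \<eta> * (\<Prod>i=1..n. R ^ \<nu> i)"
      using x y \<eta> d
      by (intro absv_prod_diff_le) (auto simp: absv_power polydisc_def intro!: power_mono absv_power_diff_le)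
    from le[OF \<nu> this \<eta>] show "absv (c \<nu> * (\<Prod>i=1..n. x i ^ \<nu> i) - c \<nu> * (\<Prod>i=1..n. y i ^ \<nu> i)) \<le> M * \<eta>"
      by (simp add: right_diff_distrib)
  qed (use M \<eta> in simp)
  ultimately show ?thesis using M(1) by (intro exI[of _ M]) auto
qed

lemma tate_family_bound:
  fixes f :: "nat \<Rightarrow> (nat \<Rightarrow> 'c) \<Rightarrow> 'c"
  assumes "\<forall>j\<le>s::nat. f j \<in> tate n R" "R > 0"
  shows "\<exists>M>0. \<forall>j\<le>s. (\<forall>x\<in>polydisc n R. absv (f j x) \<le> M) \<and>
    (\<forall>x\<in>polydisc n R. \<forall>y\<in>polydisc n R. \<forall>\<eta>\<ge>0. (\<forall>i\<in>{1..n}. absv (x i - y i) \<le> \<eta> * R) \<longrightarrow>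
       absv (f j x - f j y) \<le> M * \<eta>)" (is "\<exists>M>0. \<forall>j\<le>s. ?P j M")
proof -
  have mono: "?P j M'" if "?P j M" "M \<le> M'" for j M M'
  proof (intro conjI ballI allI impI)
    fix x y :: "nat \<Rightarrow> 'c" and \<eta> assume *: "x \<in> polydisc n R" "y \<in> polydisc n R" "(0::real) \<le> \<eta>"
      "\<forall>i\<in>{1..n}. absv (x i - y i) \<le> \<eta> * R"
    then have "absv (f j x - f j y) \<le> M * \<eta>" using that(1) by blast
    also have "\<dots> \<le> M' * \<eta>" using that(2) *(3) by (rule mult_right_mono)
    finally show "absv (f j x - f j y) \<le> M' * \<eta>" .
  next
    fix x :: "nat \<Rightarrow> 'c" assume "x \<in> polydisc n R"
    then have "absv (f j x) \<le> M" using that(1) by blast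
    with that(2) show "absv (f j x) \<le> M'" by simp
  qed
  have "\<forall>j\<le>s. \<exists>M>0. ?P j M" using assms tate_bounded_Lipschitz by blast
  then obtain M where M: "\<And>j. j \<le> s \<Longrightarrow> M j > 0" "\<And>j. j \<le> s \<Longrightarrow> ?P j (M j)" by metis
  have "M j \<le> (\<Sum>j\<le>s. M j)" if "j \<le> s" for j
    using that M(1) by (intro member_le_sum) (auto intro: less_imp_le)
  then have "?P j (\<Sum>j\<le>s. M j)" if "j \<le> s" for j using that M(2) mono by blast
  moreover have "(\<Sum>j\<le>s. M j) > 0" using M(1) by (intro sum_pos) auto
  ultimately show ?thesis by blast
qed

text \<open>On a rational subdomain \<open>f\<^sub>0\<close> is bounded away from \<open>0\<close> because the \<open>f\<^sub>j\<close> generate the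
  unit ideal; hence the defining inequalities persist under uniformly small perturbations.\<close>

lemma open_affinoid_uniformly_open:
  assumes "open_affinoid n (V :: (nat \<Rightarrow> 'c) set)"
  shows "\<exists>R \<eta>. 0 < \<eta> \<and> \<eta> \<le> R \<and> V \<subseteq> polydisc n R \<and>
    (\<forall>x\<in>V. \<forall>y\<in>polydisc n R. (\<forall>i\<in>{1..n}. absv (x i - y i) \<le> \<eta>) \<longrightarrow> y \<in> V)"
proof -
  obtain \<rho> :: 'c and s f g where \<rho>: "\<rho> \<noteq> 0"
    and fg: "\<forall>j\<le>s::nat. f j \<in> tate n (absv \<rho>)" "\<forall>j\<le>s. g j \<in> tate n (absv \<rho>)"
    and one: "\<And>x. x \<in> polydisc n (absv \<rho>) \<Longrightarrow> (\<Sum>j\<le>s. g j x * f j x) = 1"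
    and V: "V = {x \<in> polydisc n (absv \<rho>). \<forall>j\<le>s. absv (f j x) \<le> absv (f 0 x)}"
    using assms unfolding open_affinoid_def rational_subdomain_def by blast
  define R where "R = absv \<rho>"
  have R: "R > 0" using \<rho> by (simp add: R_def)
  obtain L where L: "L > 0" "\<And>j x y \<eta>. j \<le> s \<Longrightarrow> x \<in> polydisc n R \<Longrightarrow> y \<in> polydisc n R \<Longrightarrow> \<eta> \<ge> 0 \<Longrightarrow>
      \<forall>i\<in>{1..n}. absv (x i - y i) \<le> \<eta> * R \<Longrightarrow> absv (f j x - f j y) \<le> L * \<eta>"
    using tate_family_bound[OF fg(1)[folded R_def] R] by blast
  obtain M where M: "M > 0" "\<And>j x. j \<le> s \<Longrightarrow> x \<in> polydisc n R \<Longrightarrow> absv (g j x) \<le> M"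
    using tate_family_bound[OF fg(2)[folded R_def] R] by blast
  have f0: "1 \<le> M * absv (f 0 x)" if x: "x \<in> V" for x
  proof -
    have "absv (\<Sum>j\<le>s. g j x * f j x) \<le> M * absv (f 0 x)"
      using x M by (intro absv_sum_le) (auto simp: absv_mult V R_def intro!: mult_mono)
    then show ?thesis using x one by (simp add: V)
  qed
  \<comment> \<open>The second entry makes \<open>L * \<theta>\<close> at most 1/(2M), strictly
    below the lower bound 1/M of the size of \<open>f 0\<close> on V; the first ensures
    \<open>\<theta> * R \<le> R\<close>.\<close>
  define \<theta> where "\<theta> = min 1 (1 / (2 * L * M))"
  have \<theta>: "\<theta> > 0" "\<theta> \<le> 1" using L M by (auto simp: \<theta>_def)
  have "L * \<theta> \<le> L * (1 / (2 * L * M))" using L by (intro mult_left_mono) (auto simp: \<theta>_def)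
  also have "\<dots> = 1 / (2 * M)" using L M by (simp add: field_simps)
  finally have L\<theta>: "L * \<theta> \<le> 1 / (2 * M)" .
  have "y \<in> V" if x: "x \<in> V" and y: "y \<in> polydisc n R" and d: "\<forall>i\<in>{1..n}. absv (x i - y i) \<le> \<theta> * R" for x y
  proof -
    have xR: "x \<in> polydisc n R" using x by (simp add: V R_def)
    have "1 / (2 * M) < absv (f 0 x)"
      using f0[OF x] M(1) by (simp add: field_simps)
    then have small: "absv (f j x - f j y) < absv (f 0 x)" if "j \<le> s" for j
      using L(2)[OF that xR y less_imp_le[OF \<theta>(1)] d] L\<theta> by linarith
    have 0: "absv (f 0 y) = absv (f 0 x)"
      using small[of 0] by (intro absv_eqI) (simp add: absv_commute)
    have "absv (f j y) \<le> absv (f 0 y)" if j: "j \<le> s" for j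
    proof -
      have "absv (f j x - (f j x - f j y)) \<le> absv (f 0 x)"
        using x j less_imp_le[OF small[OF j]] by (intro absv_diff_leI[of "f j x" _ "f j x - f j y"]) (auto simp: V)
      then show ?thesis by (simp add: 0)
    qed
    with y show ?thesis by (simp add: V R_def)
  qed
  moreover have "V \<subseteq> polydisc n R" by (auto simp: V R_def)
  ultimately show ?thesis
    using mult_pos_pos[OF \<theta>(1) R] mult_right_mono[OF \<theta>(2) less_imp_le[OF R]]
    by (intro exI[of _ R] exI[of _ "\<theta> * R"] conjI) auto
qed

text \<open>If a \<open>K\<^sub>\<infinity>\<close>-linear form were too small at a point of \<open>V\<close>, moving one coordinate slightly
  would lead to a zero of the form that still lies in \<open>V\<close>.\<close>

lemma open_affinoid_separated:
  assumes V: "open_affinoid (r - 1) V" "V \<subseteq> Omega \<iota> r" and r: "r \<ge> 2"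
  shows "\<exists>\<delta>>0. \<forall>\<omega>\<in>V. separated r \<delta> \<omega>"
proof -
  obtain R \<eta> where \<eta>: "0 < \<eta>" "\<eta> \<le> R" and VR: "V \<subseteq> polydisc (r - 1) R"
    and op: "\<And>x y. x \<in> V \<Longrightarrow> y \<in> polydisc (r - 1) R \<Longrightarrow>
      \<forall>i\<in>{1..r - 1}. absv (x i - y i) \<le> \<eta> \<Longrightarrow> y \<in> V"
    using open_affinoid_uniformly_open[OF V(1)] by blast
  have sum_r: "(\<Sum>i=1..r. embK \<iota> (c i) * normalized r \<omega> i) =
      (\<Sum>i=1..r - 1. embK \<iota> (c i) * \<omega> i) + embK \<iota> (c r)" for c :: "nat \<Rightarrow> 'f fls" and \<omega>
  proof -
    have "{1..r} = insert r {1..r - 1}" using r by auto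
    moreover have "(\<Sum>i=1..r - 1. embK \<iota> (c i) * normalized r \<omega> i) = (\<Sum>i=1..r - 1. embK \<iota> (c i) * \<omega> i)"
      using r by (intro sum.cong) (auto simp: normalized_def)
    ultimately show ?thesis using r by (simp add: normalized_def add.commute)
  qed
  have lin: "\<eta> * absv (embK \<iota> (c j)) \<le> absv (\<Sum>i=1..r. embK \<iota> (c i) * normalized r \<omega> i)"
    if \<omega>: "\<omega> \<in> V" and j: "j \<in> {1..r - 1}" for c :: "nat \<Rightarrow> 'f fls" and j \<omega>
  proof (rule ccontr)
    define s where "s = (\<Sum>i=1..r. embK \<iota> (c i) * normalized r \<omega> i)"
    assume "\<not> ?thesis"
    then have s: "absv s < \<eta> * absv (embK \<iota> (c j))" by (simp add: s_def)
    then have cj: "c j \<noteq> 0" using absv_nonneg[of s] by (metis absv_0 embK_0 mult_zero_right not_less)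
    define t where "t = s / embK \<iota> (c j)"
    have t: "absv t \<le> \<eta>" using s cj by (simp add: t_def absv_divide field_simps)
    \<comment> \<open>Subtracting \<open>t\<close> from coordinate j removes exactly
      \<open>s\<close> from the form, and the new point stays in the polydisc because \<eta> \<le>
      R.\<close>
    define y where "y = fun_upd \<omega> j (\<omega> j - t)"
    have \<omega>R: "\<omega> \<in> polydisc (r - 1) R" using \<omega> VR by blast
    have "y \<in> polydisc (r - 1) R"
      using \<omega>R j t \<eta> unfolding polydisc_def affine_space_def y_def
      by (auto simp: PiE_iff extensional_def intro!: absv_diff_leI)
    then have "y \<in> V" using \<omega> t \<eta> by (rule_tac op[OF \<omega>]) (auto simp: y_def)
    then have y\<Omega>: "y \<in> Omega \<iota> r" using V by blast
    have "(\<Sum>i=1..r - 1. embK \<iota> (c i) * y i) = (\<Sum>i=1..r - 1. embK \<iota> (c i) * \<omega> i - (if i = j then s else 0))"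
      using cj by (intro sum.cong) (auto simp: y_def t_def right_diff_distrib)
    also have "\<dots> = (\<Sum>i=1..r - 1. embK \<iota> (c i) * \<omega> i) - s"
      using j by (simp add: sum_subtractf)
    finally have "(\<Sum>i=1..r. embK \<iota> (c i) * normalized r y i) = 0"
      unfolding sum_r[of c y] s_def sum_r[of c \<omega>] by simp
    moreover have "j \<in> {1..r}" using j by auto
    ultimately have "c j = 0" using y\<Omega> unfolding Omega_def by blast
    with cj show False by simp
  qed
  \<comment> \<open>For j < r the constant \<eta> works. The last coordinate is normalized to 1 and
    cannot be moved, so \<open>c r\<close> is recovered from s and the other terms, each at most
    R/\<eta> times the size of s; this costs the factor \<eta>/R.\<close>
  show ?thesis
  proof (intro exI[of _ "min \<eta> (\<eta> / R)"] conjI ballI)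
    show "min \<eta> (\<eta> / R) > 0" using \<eta> by auto
    fix \<omega> assume \<omega>: "\<omega> \<in> V"
    show "separated r (min \<eta> (\<eta> / R)) \<omega>"
      unfolding separated_def
    proof (intro allI ballI)
      fix c :: "nat \<Rightarrow> 'f fls" and j assume j: "j \<in> {1..r}"
      define s where "s = (\<Sum>i=1..r. embK \<iota> (c i) * normalized r \<omega> i)"
      have "min \<eta> (\<eta> / R) * absv (embK \<iota> (c j)) \<le> absv s"
      proof (cases "j = r")
        case False
        then have "\<eta> * absv (embK \<iota> (c j)) \<le> absv s" unfolding s_def using j by (intro lin \<omega>) auto
        moreover have "min \<eta> (\<eta> / R) * absv (embK \<iota> (c j)) \<le> \<eta> * absv (embK \<iota> (c j))"
          by (intro mult_right_mono) auto
        ultimately show ?thesis by linarith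
      next
        case True
        have R\<eta>: "R / \<eta> \<ge> 1" using \<eta> by simp
        have "embK \<iota> (c r) = s - (\<Sum>i=1..r - 1. embK \<iota> (c i) * \<omega> i)" unfolding s_def sum_r[of c \<omega>] by simp
        moreover have "absv (\<Sum>i=1..r - 1. embK \<iota> (c i) * \<omega> i) \<le> R / \<eta> * absv s"
        proof (rule absv_sum_le)
          fix i assume i: "i \<in> {1..r - 1}"
          have "absv (\<omega> i) \<le> R" using \<omega> VR i by (auto simp: polydisc_def)
          then have "absv (embK \<iota> (c i) * \<omega> i) \<le> absv (embK \<iota> (c i)) * R"
            by (simp add: absv_mult mult_left_mono)
          also have "\<dots> = R / \<eta> * (\<eta> * absv (embK \<iota> (c i)))" using \<eta> by simp
          also have "\<dots> \<le> R / \<eta> * absv s"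
            using lin[OF \<omega> i, of c] \<eta> by (intro mult_left_mono) (auto simp: s_def)
          finally show "absv (embK \<iota> (c i) * \<omega> i) \<le> R / \<eta> * absv s" .
        qed (use \<eta> in auto)
        moreover have "absv s \<le> R / \<eta> * absv s" using mult_right_mono[OF R\<eta>, of "absv s"] by simp
        ultimately have "absv (embK \<iota> (c r)) \<le> R / \<eta> * absv s" by (metis absv_diff_leI)
        then have "\<eta> / R * absv (embK \<iota> (c r)) \<le> absv s" using \<eta> by (simp add: field_simps)
        moreover have "min \<eta> (\<eta> / R) * absv (embK \<iota> (c r)) \<le> \<eta> / R * absv (embK \<iota> (c r))"
          by (intro mult_right_mono) auto
        ultimately show ?thesis using True by simp
      qed
      then show "min \<eta> (\<eta> / R) * absv (embK \<iota> (c j)) \<le> absv (\<Sum>i=1..r. embK \<iota> (c i) * normalized r \<omega> i)"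
        by (simp add: s_def)
    qed
  qed
qed

section \<open>Affinoid neighbourhoods and the covering of the period domain\<close>

lemma has_sum_finite_subset:
  assumes "finite F" "F \<subseteq> A" "\<And>x. x \<in> A - F \<Longrightarrow> f x = (0::'c)"
  shows "(f has_sum sum f F) A"
proof -
  have "(f has_sum sum f F) F" using assms(1) by (rule has_sum_finite)
  then show ?thesis
    by (subst has_sum_cong_neutral[of F A f f]) (use assms in auto)
qed

lemma finite_support_tate:
  assumes "finite F" "F \<subseteq> multiindices n" "\<And>\<nu>. \<nu> \<notin> F \<Longrightarrow> c \<nu> = (0::'c)"
    "\<And>z. f z = (\<Sum>\<nu>\<in>F. c \<nu> * (\<Prod>i=1..n. z i ^ \<nu> i))"
  shows "f \<in> tate n R"
  unfolding tate_def
proof (safe intro!: exI[of _ c])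
  fix \<epsilon> :: real assume "\<epsilon> > 0"
  then have "{\<nu> \<in> multiindices n. \<epsilon> \<le> absv (c \<nu>) * R ^ (\<Sum>i=1..n. \<nu> i)} \<subseteq> F"
    using assms(3) by (force simp: not_le[symmetric])
  then show "finite {\<nu> \<in> multiindices n. \<epsilon> \<le> absv (c \<nu>) * R ^ (\<Sum>i=1..n. \<nu> i)}"
    using assms(1) finite_subset by blast
next
  fix z
  show "((\<lambda>\<nu>. c \<nu> * (\<Prod>i=1..n. z i ^ \<nu> i)) has_sum f z) (multiindices n)"
    unfolding assms(4) using assms(1-3) by (intro has_sum_finite_subset) auto
qed

lemma tate_const: "(\<lambda>_. a::'c) \<in> tate n R"
proof -
  define z where "z = restrict (\<lambda>_. 0::nat) {1..n}"
  show ?thesis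
    by (rule finite_support_tate[of "{z}" n "\<lambda>\<nu>. if \<nu> = z then a else 0"])
      (auto simp: z_def multiindices_def)
qed

lemma tate_coordinate:
  assumes j: "j \<in> {1..n}"
  shows "(\<lambda>z. z j - (a::'c)) \<in> tate n R"
proof -
  define o' where "o' = restrict (\<lambda>_. 0::nat) {1..n}"
  define e where "e = restrict (\<lambda>i. if i = j then 1 else 0::nat) {1..n}"
  have "e j \<noteq> o' j" using j by (simp add: e_def o'_def)
  then have ne: "e \<noteq> o'" by metis
  have "(\<Prod>i=1..n. z i ^ e i) = z j" for z :: "nat \<Rightarrow> 'c"
  proof -
    have "(\<Prod>i=1..n. z i ^ e i) = (\<Prod>i=1..n. if i = j then z i else 1)"
      by (intro prod.cong) (auto simp: e_def)
    then show ?thesis using j by simp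
  qed
  moreover have "(\<Prod>i=1..n. z i ^ o' i) = 1" for z :: "nat \<Rightarrow> 'c" by (simp add: o'_def)
  ultimately show ?thesis
    using ne
    by (intro finite_support_tate[of "{e, o'}" n "\<lambda>\<nu>. if \<nu> = e then 1 else if \<nu> = o' then - a else 0"])
      (auto simp: e_def o'_def multiindices_def)
qed

text \<open>A closed ball is a rational subdomain with \<open>f 0\<close> a nonzero constant
  \<epsilon> and \<open>f j\<close> the j-th coordinate centred at \<omega>; the unit ideal
  condition is immediate as \<epsilon> is invertible. Powers of T supply both the ambient radius and
  an \<epsilon> smaller than \<delta>.\<close>

lemma ex_open_affinoid_ball:
  assumes \<omega>: "\<omega> \<in> affine_space n" and "\<delta> > 0"
  shows "\<exists>V. open_affinoid n V \<and> \<omega> \<in> V \<and> V \<subseteq> affine_space n \<and>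
    (\<forall>x\<in>V. \<forall>i\<in>{1..n}. absv (x i - \<omega> i :: 'c) < \<delta>)"
proof -
  obtain N where "(\<Sum>i=1..n. absv (\<omega> i)) < absv TT ^ N"
    using real_arch_pow[OF absv_TT_gt_1] by blast
  then have N: "absv (\<omega> i) \<le> absv (TT ^ N)" if "i \<in> {1..n}" for i
    using member_le_sum[of i "{1..n}" "\<lambda>i. absv (\<omega> i)"] that by (simp add: absv_power)
  obtain k where k: "(1 / absv TT) ^ k < \<delta>"
    using real_arch_pow_inv[OF \<open>\<delta> > 0\<close>, of "1 / absv TT"] absv_TT_gt_1 by auto
  define \<epsilon> :: 'c where "\<epsilon> = inverse TT ^ k"
  have \<epsilon>: "\<epsilon> \<noteq> 0" "absv \<epsilon> < \<delta>"
    using k by (auto simp: \<epsilon>_def absv_power absv_divide inverse_eq_divide)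
  define f where "f j z = (if j = 0 then \<epsilon> else z j - \<omega> j)" for j and z :: "nat \<Rightarrow> 'c"
  define g where "g j z = (if j = 0 then inverse \<epsilon> else 0)" for j :: nat and z :: "nat \<Rightarrow> 'c"
  define V where "V = {z \<in> polydisc n (absv (TT ^ N)). \<forall>j\<le>n. absv (f j z) \<le> absv (f 0 z)}"
  have ft: "f j \<in> tate n R" if "j \<le> n" for j R
    using tate_coordinate[of j n "\<omega> j"] that by (cases "j = 0") (auto simp: f_def[abs_def] tate_const)
  have gt: "g j \<in> tate n R" for j R
    by (cases "j = 0") (auto simp: g_def[abs_def] tate_const)
  have "(\<Sum>j\<le>n. g j x * f j x) = 1" for x
  proof -
    have "(\<Sum>j\<le>n. g j x * f j x) = (\<Sum>j\<in>{0}. g j x * f j x)"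
      by (intro sum.mono_neutral_right) (auto simp: g_def)
    then show ?thesis using \<epsilon> by (simp add: g_def f_def)
  qed
  then have "rational_subdomain (polydisc n (absv (TT ^ N))) (tate n (absv (TT ^ N))) V"
    unfolding rational_subdomain_def
    by (intro exI[of _ n] exI[of _ f] exI[of _ g]) (use ft gt in \<open>auto simp: V_def\<close>)
  then have "open_affinoid n V"
    unfolding open_affinoid_def by (intro exI[of _ "TT ^ N"]) auto
  moreover have "\<omega> \<in> V" using \<omega> N by (auto simp: V_def polydisc_def f_def)
  moreover have "V \<subseteq> affine_space n" by (auto simp: V_def polydisc_def)
  moreover have "absv (x i - \<omega> i) < \<delta>" if "x \<in> V" "i \<in> {1..n}" for x i
  proof -
    have "absv (f i x) \<le> absv (f 0 x)" using that by (auto simp: V_def)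
    then show ?thesis using that \<epsilon>(2) by (simp add: f_def)
  qed
  ultimately show ?thesis by blast
qed

text \<open>The period domain is open: a form vanishing at a point less than \<delta> away from
  \<omega> would take at \<omega> a value below \<delta> times its largest coefficient, against
  separation.\<close>

lemma open_affinoids_cover_Omega:
  assumes "r \<ge> 2"
  shows "\<Union>{V. open_affinoid (r - 1) V \<and> V \<subseteq> Omega \<iota> r} = Omega \<iota> r"
proof (intro equalityI subsetI)
  fix \<omega> assume \<omega>: "\<omega> \<in> Omega \<iota> r"
  then obtain \<delta> where \<delta>: "\<delta> > 0" "separated r \<delta> \<omega>" using Omega_separated by blast
  have "\<omega> \<in> affine_space (r - 1)" using \<omega> by (simp add: Omega_def)
  then obtain V where V: "open_affinoid (r - 1) V" "\<omega> \<in> V" "V \<subseteq> affine_space (r - 1)"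
    "\<And>x i. x \<in> V \<Longrightarrow> i \<in> {1..r - 1} \<Longrightarrow> absv (x i - \<omega> i) < \<delta>"
    using ex_open_affinoid_ball \<delta>(1) by meson
  have "x \<in> Omega \<iota> r" if x: "x \<in> V" for x
    unfolding Omega_def
  proof (safe)
    show "x \<in> affine_space (r - 1)" using x V(3) by blast
    fix c :: "nat \<Rightarrow> 'f fls" and i
    assume c: "(\<Sum>i=1..r. embK \<iota> (c i) * normalized r x i) = 0" and i: "i \<in> {1..r}"
    show "c i = 0"
    proof (rule ccontr)
      assume "c i \<noteq> 0"
      define m where "m = Max ((\<lambda>i. absv (embK \<iota> (c i))) ` {1..r})"
      have "m \<in> (\<lambda>i. absv (embK \<iota> (c i))) ` {1..r}" unfolding m_def using i by (intro Max_in) auto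
      then obtain j where j: "j \<in> {1..r}" "m = absv (embK \<iota> (c j))" by blast
      have m: "absv (embK \<iota> (c i)) \<le> m" if "i \<in> {1..r}" for i
        unfolding m_def using that by (intro Max_ge) auto
      have "absv (embK \<iota> (c i)) > 0" using \<open>c i \<noteq> 0\<close> by simp
      with m[OF i] have mpos: "m > 0" by linarith
      have "absv (\<Sum>i=1..r. embK \<iota> (c i) * (normalized r \<omega> i - normalized r x i)) < \<delta> * m"
      proof (rule absv_sum_less)
        fix i assume i: "i \<in> {1..r}"
        have "absv (normalized r \<omega> i - normalized r x i) < \<delta>"
          using V(4)[OF x, of i] i \<delta> by (auto simp: normalized_def absv_commute)
        then have "m * absv (normalized r \<omega> i - normalized r x i) < m * \<delta>"
          using mpos by (intro mult_strict_left_mono)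
        moreover have "absv (embK \<iota> (c i)) * absv (normalized r \<omega> i - normalized r x i) \<le>
            m * absv (normalized r \<omega> i - normalized r x i)"
          using m[OF i] by (intro mult_right_mono) auto
        ultimately have "absv (embK \<iota> (c i)) * absv (normalized r \<omega> i - normalized r x i) < m * \<delta>"
          by linarith
        then show "absv (embK \<iota> (c i) * (normalized r \<omega> i - normalized r x i)) < \<delta> * m"
          by (simp add: absv_mult mult.commute)
      qed (use mpos \<delta> in auto)
      moreover have "(\<Sum>i=1..r. embK \<iota> (c i) * (normalized r \<omega> i - normalized r x i)) =
          (\<Sum>i=1..r. embK \<iota> (c i) * normalized r \<omega> i)"
        using c by (simp add: right_diff_distrib sum_subtractf)
      moreover have "\<delta> * m \<le> absv (\<Sum>i=1..r. embK \<iota> (c i) * normalized r \<omega> i)"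
        using \<delta>(2) j unfolding separated_def by blast
      ultimately show False by simp
    qed
  qed
  then show "\<omega> \<in> \<Union>{V. open_affinoid (r - 1) V \<and> V \<subseteq> Omega \<iota> r}" using V by blast
qed auto

text \<open>The covering by V alone suffices: a morphism into V needs no subdivision of its source
  Y, and Y is rational in itself with the single defining function 1.\<close>

lemma open_affinoid_imp_admissible_open:
  assumes "open_affinoid n (V :: (nat \<Rightarrow> 'c) set)"
  shows "admissible_open n V"
  unfolding admissible_open_def
proof (rule exI[of _ "{V}"], intro conjI allI impI)
  fix m and Y :: "(nat \<Rightarrow> 'c) set" and \<phi> :: "(nat \<Rightarrow> 'c) \<Rightarrow> nat \<Rightarrow> 'c"
  assume Y: "affinoid_space m Y \<and> affinoid_morphism m Y n \<phi> \<and> \<phi> ` Y \<subseteq> V"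
  have "rational_subdomain Y (tate m 1) Y"
    unfolding rational_subdomain_def
    by (intro exI[of _ 0] exI[of _ "\<lambda>_ _. 1"]) (auto simp: tate_const)
  then show "\<exists>\<V>. finite \<V> \<and> \<Union>\<V> = Y \<and>
      (\<forall>V'\<in>\<V>. rational_subdomain Y (tate m 1) V' \<and> (\<exists>W\<in>{V}. \<phi> ` V' \<subseteq> W))"
    using Y by (intro exI[of _ "{Y}"]) auto
qed (use assms in auto)

text \<open>Every test affinoid V is itself a member of the family and so refines it; what remains
  is that the members are admissible open and cover.\<close>

lemma open_affinoids_admissible_covering:
  assumes "r \<ge> 2"
  shows "admissible_covering (r - 1) (Omega \<iota> r) {V. open_affinoid (r - 1) V \<and> V \<subseteq> Omega \<iota> r}"
  unfolding admissible_covering_def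
proof (intro conjI ballI allI impI)
  fix V assume "open_affinoid (r - 1) V \<and> V \<subseteq> Omega \<iota> r"
  then show "\<exists>\<V>. finite \<V> \<and> \<Union>\<V> = V \<and>
      (\<forall>W\<in>\<V>. open_affinoid (r - 1) W \<and> (\<exists>U\<in>{V. open_affinoid (r - 1) V \<and> V \<subseteq> Omega \<iota> r}. W \<subseteq> U))"
    by (intro exI[of _ "{V}"]) auto
qed (use open_affinoids_cover_Omega[OF assms] open_affinoid_imp_admissible_open in auto)

section \<open>Limits and \<open>q\<close>-power series\<close>

text \<open>The operations of \<open>'c\<close> are tied to its metric through the locale
  assumptions, so the limit laws are derived from the absolute value. The strong triangle inequality
  lets one e serve for both summands.\<close>

lemma tendsto_add_absv:
  assumes "(f \<longlongrightarrow> (l::'c)) F" "(g \<longlongrightarrow> m) F"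
  shows "((\<lambda>x. f x + g x) \<longlongrightarrow> l + m) F"
  unfolding tendsto_absv
proof (intro allI impI)
  fix e :: real assume e: "e > 0"
  have "eventually (\<lambda>x. absv (f x - l) < e) F" "eventually (\<lambda>x. absv (g x - m) < e) F"
    using assms e by (simp_all add: tendsto_absv)
  then show "eventually (\<lambda>x. absv (f x + g x - (l + m)) < e) F"
  proof eventually_elim
    case (elim x)
    have eq: "f x + g x - (l + m) = (f x - l) + (g x - m)" by simp
    show ?case unfolding eq using elim by (rule absv_add_lessI)
  qed
qed

lemma tendsto_cmult_absv:
  assumes "(f \<longlongrightarrow> (l::'c)) F"
  shows "((\<lambda>x. c * f x) \<longlongrightarrow> c * l) F"
proof (cases "c = 0")
  case False
  show ?thesis
    unfolding tendsto_absv
  proof (intro allI impI)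
    fix e :: real assume e: "e > 0"
    then have "e / absv c > 0" using False by simp
    then have "eventually (\<lambda>x. absv (f x - l) < e / absv c) F"
      using assms by (simp add: tendsto_absv)
    then show "eventually (\<lambda>x. absv (c * f x - c * l) < e) F"
    proof eventually_elim
      case (elim x)
      have "c * f x - c * l = c * (f x - l)" by (simp add: algebra_simps)
      then show ?case using elim False by (simp only: absv_mult) (simp add: field_simps)
    qed
  qed
qed simp

lemma tendsto_diff_absv:
  assumes "(f \<longlongrightarrow> (l::'c)) F" "(g \<longlongrightarrow> m) F"
  shows "((\<lambda>x. f x - g x) \<longlongrightarrow> l - m) F"
  using tendsto_add_absv[OF assms(1) tendsto_cmult_absv[OF assms(2), of "-1"]] by simp

lemma tendsto_mult_absv:
  assumes "(f \<longlongrightarrow> (l::'c)) F" "(g \<longlongrightarrow> m) F"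
  shows "((\<lambda>x. f x * g x) \<longlongrightarrow> l * m) F"
proof -
  have "((\<lambda>x. (f x - l) * (g x - m)) \<longlongrightarrow> 0) F"
    unfolding tendsto_absv
  proof (intro allI impI)
    fix e :: real assume e: "e > 0"
    have "eventually (\<lambda>x. absv (f x - l) < e) F" "eventually (\<lambda>x. absv (g x - m) < 1) F"
      using assms e by (simp_all add: tendsto_absv)
    then show "eventually (\<lambda>x. absv ((f x - l) * (g x - m) - 0) < e) F"
    proof eventually_elim
      case (elim x)
      have "absv (f x - l) * absv (g x - m) \<le> absv (f x - l) * 1"
        using elim by (intro mult_left_mono) auto
      with elim show ?case by (simp add: absv_mult)
    qed
  qed
  from tendsto_add_absv[OF this tendsto_add_absv[OF tendsto_cmult_absv[OF assms(1), of m]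
      tendsto_cmult_absv[OF assms(2), of l]]]
  have "((\<lambda>x. (f x - l) * (g x - m) + (m * f x + l * g x)) \<longlongrightarrow> 0 + (m * l + l * m)) F" .
  from tendsto_diff_absv[OF this tendsto_const[of "l * m"]]
  show ?thesis by (simp add: algebra_simps)
qed

lemma tendsto_prod_absv:
  assumes "\<And>i. i \<in> I \<Longrightarrow> (f i \<longlongrightarrow> (l i::'c)) F"
  shows "((\<lambda>x. \<Prod>i\<in>I. f i x) \<longlongrightarrow> (\<Prod>i\<in>I. l i)) F"
  using assms by (induction I rule: infinite_finite_induct) (auto intro: tendsto_mult_absv)

lemma tendsto_inverse_absv:
  assumes f: "(f \<longlongrightarrow> (l::'c)) F" and l: "l \<noteq> 0"
  shows "((\<lambda>x. inverse (f x)) \<longlongrightarrow> inverse l) F"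
  unfolding tendsto_absv
proof (intro allI impI)
  fix e :: real assume e: "e > 0"
  have "e * absv l * absv l > 0" "absv l > 0" using e l by auto
  then have "eventually (\<lambda>x. absv (f x - l) < e * absv l * absv l) F"
    "eventually (\<lambda>x. absv (f x - l) < absv l) F"
    using f unfolding tendsto_absv by blast+
  then show "eventually (\<lambda>x. absv (inverse (f x) - inverse l) < e) F"
  proof eventually_elim
    case (elim x)
    have abs: "absv (f x) = absv l" using elim(2) by (rule absv_eqI)
    then have "f x \<noteq> 0" using l by auto
    then have "inverse (f x) - inverse l = (l - f x) / (f x * l)" using l by (simp add: field_simps)
    then have eq: "absv (inverse (f x) - inverse l) = absv (f x - l) / (absv l * absv l)"
      by (simp add: absv_divide absv_mult abs absv_commute)
    show ?case unfolding eq using elim(1) l by (simp add: pos_divide_less_eq mult.assoc)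
  qed
qed

lemma tendsto_divide_absv:
  assumes "(f \<longlongrightarrow> (l::'c)) F" "(g \<longlongrightarrow> m) F" "m \<noteq> 0"
  shows "((\<lambda>x. f x / g x) \<longlongrightarrow> l / m) F"
  using tendsto_mult_absv[OF assms(1) tendsto_inverse_absv[OF assms(2,3)]] by (simp add: divide_inverse)

lemma tendsto_power_absv:
  assumes "(f \<longlongrightarrow> (l::'c)) F"
  shows "((\<lambda>x. f x ^ n) \<longlongrightarrow> l ^ n) F"
  by (induction n) (auto intro: tendsto_mult_absv assms)

lemma tendsto_sum_absv:
  assumes "\<And>i. i \<in> I \<Longrightarrow> (f i \<longlongrightarrow> (l i::'c)) F"
  shows "((\<lambda>x. \<Sum>i\<in>I. f i x) \<longlongrightarrow> (\<Sum>i\<in>I. l i)) F"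
  using assms by (induction I rule: infinite_finite_induct) (auto intro: tendsto_add_absv)

lemma tendsto_unique_absv:
  assumes "(f \<longlongrightarrow> (l::'c)) F" "(f \<longlongrightarrow> m) F" "F \<noteq> bot"
  shows "l = m"
  using tendsto_unique[OF assms(3,1,2)] .

lemma Cauchy_absvI:
  assumes "\<And>e. e > 0 \<Longrightarrow> \<exists>N. \<forall>m\<ge>N. \<forall>n\<ge>N. absv (f m - f n :: 'c) < e"
  shows "\<exists>l. f \<longlonglongrightarrow> l"
proof -
  have "Cauchy f" using assms by (intro metric_CauchyI) (simp add: dist_absv)
  then show ?thesis using Cauchy_convergent convergent_def by blast
qed

text \<open>Closed balls are closed: values near l have the same distance from a as l has, by the
  isosceles principle.\<close>

lemma tendsto_absv_le:
  assumes "(f \<longlongrightarrow> (l::'c)) F" "F \<noteq> bot" "eventually (\<lambda>x. absv (f x - a) \<le> B) F"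
  shows "absv (l - a) \<le> B"
proof (rule ccontr)
  assume "\<not> ?thesis"
  then have "absv (l - a) > B" by simp
  have B: "B \<ge> 0"
    using assms(2,3) absv_nonneg by (metis (mono_tags, lifting) eventually_happens order_trans)
  then have "absv (l - a) > 0" using \<open>absv (l - a) > B\<close> by linarith
  then have "eventually (\<lambda>x. absv (f x - l) < absv (l - a)) F"
    using assms(1) unfolding tendsto_absv by blast
  with assms(3) have "eventually (\<lambda>x. absv (f x - a) \<le> B \<and> absv (f x - l) < absv (l - a)) F"
    by (rule eventually_conj)
  then obtain x where x: "absv (f x - a) \<le> B" "absv (f x - l) < absv (l - a)"
    using assms(2) eventually_happens by blast
  have "absv (f x - a) = absv (l - a)" using x(2) by (intro absv_eqI) simp
  with x \<open>absv (l - a) > B\<close> show False by simp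
qed

section \<open>Uniqueness of the coefficients of q-power series\<close>

lemma ex_small_absv: "e > 0 \<Longrightarrow> \<exists>z::'c. z \<noteq> 0 \<and> absv z \<le> 1 \<and> absv z < e"
proof -
  assume "e > 0"
  then obtain k where k: "(1 / absv TT) ^ k < e"
    using real_arch_pow_inv[of e "1 / absv TT"] absv_TT_gt_1 by auto
  have "(1 / absv TT) ^ k \<le> 1" using absv_TT_gt_1 by (intro power_le_one) auto
  with k show ?thesis
    by (intro exI[of _ "(1 / TT) ^ k"]) (auto simp: absv_power absv_divide)
qed

text \<open>For small \<open>z\<close> the first nonvanishing term dominates the series.\<close>

lemma q_series_eq_0:
  assumes sums: "\<And>z. (\<lambda>i. a i * z ^ (CARD('f) ^ i)) sums (0::'c)"
  shows "a k = 0"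
proof (induction k rule: less_induct)
  case (less k)
  show ?case
  proof (rule ccontr)
    assume ak: "a k \<noteq> 0"
    \<comment> \<open>Convergence at z = 1 bounds the \<open>a n\<close>, which are differences of
      consecutive partial sums; \<open>M\<close> below bounds all of them.\<close>
    obtain N where N: "\<And>n. n \<ge> N \<Longrightarrow> absv (\<Sum>i<n. a i) < 1"
    proof -
      have "eventually (\<lambda>n. absv ((\<Sum>i<n. a i * 1 ^ (CARD('f) ^ i)) - 0) < 1) sequentially"
        using sums[of 1] zero_less_one unfolding sums_def tendsto_absv by blast
      then show ?thesis using that by (auto simp: eventually_sequentially)
    qed
    have aN: "absv (a n) \<le> 1" if "n \<ge> N" for n
    proof -
      have "a n = (\<Sum>i<Suc n. a i) - (\<Sum>i<n. a i)" by simp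
      then have "absv (a n) < 1" using N[of n] N[of "Suc n"] that by (metis absv_diff_lessI le_SucI)
      then show ?thesis by simp
    qed
    define M where "M = 1 + (\<Sum>i<N. absv (a i))"
    have M: "absv (a n) \<le> M" for n
    proof (cases "n < N")
      case True
      then have "absv (a n) \<le> (\<Sum>i<N. absv (a i))" by (intro member_le_sum) auto
      then show ?thesis by (simp add: M_def)
    next
      case False
      moreover have "0 \<le> (\<Sum>i<N. absv (a i))" by (intro sum_nonneg) auto
      ultimately show ?thesis using aN[of n] by (simp add: M_def)
    qed
    have Mpos: "M > 0" using sum_nonneg[of "{..<N}" "\<lambda>i. absv (a i)"] by (simp add: M_def)
    \<comment> \<open>This size makes every later term, at most M times the power
      \<open>q^k + 1\<close> of the size of z, strictly smaller than the k-th term.\<close>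
    obtain z :: 'c where z: "z \<noteq> 0" "absv z \<le> 1" "absv z < absv (a k) / M"
      using ex_small_absv[of "absv (a k) / M"] ak Mpos by auto
    define t where "t = absv (a k) * absv z ^ (CARD('f) ^ k)"
    have t: "t > 0" using ak z by (simp add: t_def)
    have "absv (\<Sum>i<n. a i * z ^ (CARD('f) ^ i)) = t" if n: "n > k" for n
    proof -
      have "(\<Sum>i<n. a i * z ^ (CARD('f) ^ i)) =
          a k * z ^ (CARD('f) ^ k) + (\<Sum>i\<in>{..<n} - {k}. a i * z ^ (CARD('f) ^ i))"
        using n by (intro sum.remove) auto
      moreover have "absv (\<Sum>i\<in>{..<n} - {k}. a i * z ^ (CARD('f) ^ i)) < t"
      proof (rule absv_sum_less[OF _ t])
        fix i assume i: "i \<in> {..<n} - {k}"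
        show "absv (a i * z ^ (CARD('f) ^ i)) < t"
        proof (cases "i < k")
          case True
          then show ?thesis using less t by simp
        next
          case False
          then have "CARD('f) ^ k < CARD('f) ^ i"
            using i q_ge_2 by (intro power_strict_increasing) auto
          then have "absv z ^ (CARD('f) ^ i) \<le> absv z ^ Suc (CARD('f) ^ k)"
            using z by (intro power_decreasing) auto
          then have "absv (a i * z ^ (CARD('f) ^ i)) \<le> M * absv z ^ Suc (CARD('f) ^ k)"
            unfolding absv_mult absv_power using M[of i] Mpos by (intro mult_mono) auto
          also have "\<dots> = (M * absv z) * absv z ^ (CARD('f) ^ k)" by simp
          also have "\<dots> < t"
            unfolding t_def using z Mpos by (intro mult_strict_right_mono) (auto simp: field_simps)
          finally show ?thesis .
        qed
      qed
      ultimately show ?thesis using absv_add_eq by (simp add: t_def absv_mult absv_power)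
    qed
    moreover obtain N' where "\<And>n. n \<ge> N' \<Longrightarrow> absv (\<Sum>i<n. a i * z ^ (CARD('f) ^ i)) < t"
    proof -
      have "eventually (\<lambda>n. absv ((\<Sum>i<n. a i * z ^ (CARD('f) ^ i)) - 0) < t) sequentially"
        using sums[of z] t unfolding sums_def tendsto_absv by blast
      then show ?thesis using that by (auto simp: eventually_sequentially)
    qed
    ultimately show False by (metis less_irrefl max.cobounded1 max.cobounded2 lessI Suc_le_lessD)
  qed
qed

lemma q_series_unique:
  assumes "\<And>z. (\<lambda>i. a i * z ^ (CARD('f) ^ i)) sums (f z :: 'c)"
    "\<And>z. (\<lambda>i. b i * z ^ (CARD('f) ^ i)) sums f z"
  shows "a = b"
proof
  fix k
  have "(\<lambda>i. (a i - b i) * z ^ (CARD('f) ^ i)) sums 0" for z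
    using tendsto_diff_absv[OF assms[unfolded sums_def], of z z]
    by (simp add: sums_def left_diff_distrib sum_subtractf)
  from q_series_eq_0[of "\<lambda>i. a i - b i", OF this] show "a k = b k" by simp
qed

section \<open>Infinite products over discrete sets\<close>

text \<open>A bound for the Gauss norm on the disc of radius \<rho>. It controls coefficients and
  values simultaneously and is submultiplicative, so one estimate settles the convergence of both
  for the partial products.\<close>

definition gauss_le :: "real \<Rightarrow> real \<Rightarrow> 'c poly \<Rightarrow> bool" where
  "gauss_le \<rho> B p \<longleftrightarrow> (\<forall>j. absv (Polynomial.coeff p j) * \<rho> ^ j \<le> B)"

lemma gauss_le_mult:
  assumes "gauss_le \<rho> B p" "gauss_le \<rho> B' p'" "\<rho> > 0" "B \<ge> 0" "B' \<ge> 0"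
  shows "gauss_le \<rho> (B * B') (p * p')"
  unfolding gauss_le_def
proof
  fix j
  have pos: "\<rho> ^ j > 0" using assms(3) by simp
  have "absv (Polynomial.coeff (p * p') j) \<le> B * B' / \<rho> ^ j"
    unfolding coeff_mult
  proof (rule absv_sum_le)
    fix i assume i: "i \<in> {..j}"
    then have eq: "\<rho> ^ j = \<rho> ^ i * \<rho> ^ (j - i)" by (simp flip: power_add)
    have "absv (Polynomial.coeff p i * Polynomial.coeff p' (j - i)) * \<rho> ^ j =
        (absv (Polynomial.coeff p i) * \<rho> ^ i) * (absv (Polynomial.coeff p' (j - i)) * \<rho> ^ (j - i))"
      by (simp only: absv_mult eq mult_ac)
    also have "\<dots> \<le> B * B'"
      using assms by (intro mult_mono) (auto simp: gauss_le_def)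
    finally show "absv (Polynomial.coeff p i * Polynomial.coeff p' (j - i)) \<le> B * B' / \<rho> ^ j"
      using pos by (simp add: pos_le_divide_eq)
  qed (use assms pos in simp)
  then show "absv (Polynomial.coeff (p * p') j) * \<rho> ^ j \<le> B * B'"
    using pos by (simp add: pos_le_divide_eq)
qed

lemma gauss_le_diff: "gauss_le \<rho> B p \<Longrightarrow> gauss_le \<rho> B p' \<Longrightarrow> \<rho> \<ge> 0 \<Longrightarrow> gauss_le \<rho> B (p - p')"
  unfolding gauss_le_def
proof
  fix j assume *: "\<forall>j. absv (Polynomial.coeff p j) * \<rho> ^ j \<le> B" "\<forall>j. absv (Polynomial.coeff p' j) * \<rho> ^ j \<le> B" "\<rho> \<ge> 0"
  have "absv (Polynomial.coeff (p - p') j) * \<rho> ^ j \<le> max (absv (Polynomial.coeff p j)) (absv (Polynomial.coeff p' j)) * \<rho> ^ j"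
    using *(3) by (intro mult_right_mono) (auto simp: absv_diff_le)
  also have "\<dots> \<le> B" using * by (auto simp: max_def)
  finally show "absv (Polynomial.coeff (p - p') j) * \<rho> ^ j \<le> B" .
qed

lemma gauss_le_add: "gauss_le \<rho> B p \<Longrightarrow> gauss_le \<rho> B p' \<Longrightarrow> \<rho> \<ge> 0 \<Longrightarrow> gauss_le \<rho> B (p + p')"
  using gauss_le_diff[of \<rho> B p "- p'"] by (simp add: gauss_le_def)

lemma gauss_le_1: "gauss_le \<rho> 1 1"
  by (simp add: gauss_le_def coeff_1)

lemma gauss_le_mono: "gauss_le \<rho> B p \<Longrightarrow> B \<le> B' \<Longrightarrow> gauss_le \<rho> B' p"
  unfolding gauss_le_def by (meson order_trans)

lemma gauss_le_exists: "\<exists>B>0. gauss_le \<rho> B p" if "\<rho> \<ge> 0"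
proof -
  let ?B = "1 + (\<Sum>j\<le>Polynomial.degree p. absv (Polynomial.coeff p j) * \<rho> ^ j)"
  have nn: "0 \<le> (\<Sum>j\<le>Polynomial.degree p. absv (Polynomial.coeff p j) * \<rho> ^ j)"
    using that by (intro sum_nonneg) auto
  have "absv (Polynomial.coeff p j) * \<rho> ^ j \<le> ?B" for j
  proof (cases "j \<le> Polynomial.degree p")
    case True
    then have "absv (Polynomial.coeff p j) * \<rho> ^ j \<le> (\<Sum>j\<le>Polynomial.degree p. absv (Polynomial.coeff p j) * \<rho> ^ j)"
      using that by (intro member_le_sum) auto
    then show ?thesis by simp
  next
    case False
    then show ?thesis using nn by (simp add: coeff_eq_0)
  qed
  then show ?thesis using nn by (intro exI[of _ ?B]) (auto simp: gauss_le_def)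
qed

lemma gauss_le_poly:
  assumes "gauss_le \<rho> B p" "absv z \<le> \<rho>"
  shows "absv (poly p z) \<le> B"
proof -
  have \<rho>: "\<rho> \<ge> 0" using assms(2) absv_nonneg order_trans by blast
  have B: "B \<ge> 0" using assms(1) \<rho> unfolding gauss_le_def
    by (metis absv_nonneg mult_nonneg_nonneg order_trans zero_le_power)
  show ?thesis
    unfolding poly_altdef
  proof (rule absv_sum_le[OF _ B])
    fix i
    have "absv (Polynomial.coeff p i * z ^ i) \<le> absv (Polynomial.coeff p i) * \<rho> ^ i"
      using assms(2) by (auto simp: absv_mult absv_power intro!: mult_left_mono power_mono)
    also have "\<dots> \<le> B" using assms(1) by (simp add: gauss_le_def)
    finally show "absv (Polynomial.coeff p i * z ^ i) \<le> B" .
  qed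
qed

definition prodpoly :: "'c set \<Rightarrow> 'c poly" where
  "prodpoly M = (\<Prod>\<mu>\<in>M. [:1, - inverse \<mu>:])"

lemma poly_prodpoly: "poly (prodpoly M) z = (\<Prod>\<mu>\<in>M. 1 - z / \<mu>)"
  by (simp add: prodpoly_def poly_prod divide_inverse)

lemma gauss_le_linear:
  assumes "\<mu> \<noteq> 0" "\<rho> \<ge> 0" "\<rho> \<le> \<epsilon> * absv \<mu>"
  shows "gauss_le \<rho> \<epsilon> ([:1, - inverse \<mu>:] - 1)"
proof -
  have eq: "Polynomial.coeff ([:1, - inverse \<mu>:] - 1) j = (if j = 1 then - inverse \<mu> else 0)" for j
    by (auto simp: coeff_pCons coeff_1 split: nat.splits)
  have "\<rho> / absv \<mu> \<le> \<epsilon>" using assms by (simp add: pos_divide_le_eq)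
  moreover from this have "\<epsilon> \<ge> 0" using assms(2) by (smt (verit) absv_nonneg divide_nonneg_nonneg)
  ultimately show ?thesis
    by (simp only: gauss_le_def eq) (simp add: absv_divide inverse_eq_divide)
qed

text \<open>Each factor 1 - X/\<mu> differs from 1 by at most \<epsilon> in Gauss norm, and by the
  ultrametric inequality these deviations do not accumulate in the product.\<close>

lemma gauss_le_prodpoly_minus_1:
  assumes "finite M" "\<And>\<mu>. \<mu> \<in> M \<Longrightarrow> \<mu> \<noteq> 0" "\<And>\<mu>. \<mu> \<in> M \<Longrightarrow> \<rho> \<le> \<epsilon> * absv \<mu>" "\<rho> > 0" "0 \<le> \<epsilon>" "\<epsilon> \<le> 1"
  shows "gauss_le \<rho> \<epsilon> (prodpoly M - 1) \<and> gauss_le \<rho> 1 (prodpoly M)"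
  using assms(1-3)
proof (induction M)
  case empty
  then show ?case using assms by (simp add: prodpoly_def gauss_le_1) (simp add: gauss_le_def)
next
  case (insert \<mu> M)
  have IH: "gauss_le \<rho> \<epsilon> (prodpoly M - 1)" "gauss_le \<rho> 1 (prodpoly M)" using insert by auto
  have 1: "gauss_le \<rho> \<epsilon> ([:1, - inverse \<mu>:] - 1)"
    using insert.prems assms by (intro gauss_le_linear) auto
  have eq: "prodpoly (insert \<mu> M) - 1 = ([:1, - inverse \<mu>:] - 1) * prodpoly M + (prodpoly M - 1)"
    using insert by (simp add: prodpoly_def left_diff_distrib)
  have "gauss_le \<rho> (\<epsilon> * 1) (([:1, - inverse \<mu>:] - 1) * prodpoly M)"
    using 1 IH assms by (intro gauss_le_mult) auto
  then have 2: "gauss_le \<rho> \<epsilon> (prodpoly (insert \<mu> M) - 1)"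
    unfolding eq using IH assms by (intro gauss_le_add) auto
  then have "gauss_le \<rho> 1 (prodpoly (insert \<mu> M) - 1 + 1)"
    using assms by (intro gauss_le_add gauss_le_1) (auto intro: gauss_le_mono)
  with 2 show ?case by simp
qed

lemma prodpoly_Un: "finite M \<Longrightarrow> M0 \<subseteq> M \<Longrightarrow> prodpoly M = prodpoly M0 * prodpoly (M - M0)"
  unfolding prodpoly_def by (subst prod.subset_diff[of M0 M]) (simp_all only: mult.commute)

text \<open>Zero is excluded because the elements occur as denominators; finiteness of balls makes
  the truncations to bounded size finite sets.\<close>

definition discrete_set :: "'c set \<Rightarrow> bool" where
  "discrete_set S \<longleftrightarrow> 0 \<notin> S \<and> (\<forall>B. finite {\<mu> \<in> S. absv \<mu> \<le> B})"

text \<open>Both products are compared with the one over \<mu> of size at most \<rho>/\<epsilon>.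
  The larger \<mu> contribute a factor within \<epsilon> of 1. The \<mu> of size at most \<rho>
  account for B and those between have Gauss norm at most 1, so B is independent of
  \<epsilon>.\<close>

lemma prodpoly_Cauchy:
  assumes S: "discrete_set S" and \<rho>: "\<rho> > 0"
  shows "\<exists>B>0. \<forall>\<epsilon> M M'. 0 < \<epsilon> \<and> \<epsilon> \<le> 1 \<and> finite M \<and> finite M' \<and> M \<subseteq> S \<and> M' \<subseteq> S \<and>
     {\<mu> \<in> S. absv \<mu> \<le> \<rho> / \<epsilon>} \<subseteq> M \<and> {\<mu> \<in> S. absv \<mu> \<le> \<rho> / \<epsilon>} \<subseteq> M' \<longrightarrow>
     gauss_le \<rho> (B * \<epsilon>) (prodpoly M - prodpoly M')"
proof -
  define M1 where "M1 = {\<mu> \<in> S. absv \<mu> \<le> \<rho>}"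
  obtain B where B: "B > 0" "gauss_le \<rho> B (prodpoly M1)" using gauss_le_exists[of \<rho>] \<rho> by auto
  have main: "gauss_le \<rho> (B * \<epsilon>) (prodpoly M - prodpoly {\<mu> \<in> S. absv \<mu> \<le> \<rho> / \<epsilon>})"
    if \<epsilon>: "0 < \<epsilon>" "\<epsilon> \<le> 1" and M: "finite M" "M \<subseteq> S" "{\<mu> \<in> S. absv \<mu> \<le> \<rho> / \<epsilon>} \<subseteq> M" for \<epsilon> M
  proof -
    define M0 where "M0 = {\<mu> \<in> S. absv \<mu> \<le> \<rho> / \<epsilon>}"
    have fin: "finite M0" using S by (simp add: M0_def discrete_set_def)
    have "\<rho> \<le> \<rho> / \<epsilon>" using \<epsilon> \<rho> by (simp add: pos_le_divide_eq mult_left_le)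
    then have sub: "M1 \<subseteq> M0" by (auto simp: M0_def M1_def)
    have "gauss_le \<rho> 1 (prodpoly (M0 - M1))"
      using fin \<rho> S
      by (intro conjunct2[OF gauss_le_prodpoly_minus_1[of "M0 - M1" \<rho> 1]])
        (auto simp: M0_def M1_def discrete_set_def)
    then have "gauss_le \<rho> (B * 1) (prodpoly M0)"
      unfolding prodpoly_Un[OF fin sub] using B \<rho> by (intro gauss_le_mult) auto
    moreover have "gauss_le \<rho> \<epsilon> (prodpoly (M - M0) - 1)"
    proof (rule conjunct1[OF gauss_le_prodpoly_minus_1])
      fix \<mu> assume \<mu>: "\<mu> \<in> M - M0"
      then have "absv \<mu> > \<rho> / \<epsilon>" using M by (auto simp: M0_def)
      then show "\<rho> \<le> \<epsilon> * absv \<mu>" using \<epsilon> by (simp add: field_simps)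
      show "\<mu> \<noteq> 0" using \<mu> M S by (auto simp: discrete_set_def)
    qed (use M \<epsilon> \<rho> in auto)
    ultimately have "gauss_le \<rho> (B * 1 * \<epsilon>) (prodpoly M0 * (prodpoly (M - M0) - 1))"
      using B \<epsilon> \<rho> by (intro gauss_le_mult) auto
    moreover have "prodpoly M - prodpoly M0 = prodpoly M0 * (prodpoly (M - M0) - 1)"
      using prodpoly_Un[OF M(1) M(3)[folded M0_def]] by (simp add: algebra_simps)
    ultimately show ?thesis by (simp add: M0_def)
  qed
  have "gauss_le \<rho> (B * \<epsilon>) (prodpoly M - prodpoly M')"
    if "0 < \<epsilon> \<and> \<epsilon> \<le> 1 \<and> finite M \<and> finite M' \<and> M \<subseteq> S \<and> M' \<subseteq> S \<and>
     {\<mu> \<in> S. absv \<mu> \<le> \<rho> / \<epsilon>} \<subseteq> M \<and> {\<mu> \<in> S. absv \<mu> \<le> \<rho> / \<epsilon>} \<subseteq> M'" for \<epsilon> M M'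
    using gauss_le_diff[OF main[of \<epsilon> M] main[of \<epsilon> M']] that \<rho> by simp
  with B(1) show ?thesis by blast
qed

text \<open>\<open>A\<close> and \<open>h\<close> are the limits of coefficients and values along
  the truncations to size at most n. The common rate, uniform in j and in z of size at most \<rho>,
  is what later identifies h as the sum of the series with coefficients A.\<close>

lemma prodpoly_limit:
  assumes S: "discrete_set S"
  shows "\<exists>A h. (\<forall>\<rho>>0. \<exists>B>0. \<forall>\<epsilon> M. 0 < \<epsilon> \<and> \<epsilon> \<le> 1 \<and> finite M \<and> M \<subseteq> S \<and>
       {\<mu> \<in> S. absv \<mu> \<le> \<rho> / \<epsilon>} \<subseteq> M \<longrightarrow>
       (\<forall>j. absv (A j - Polynomial.coeff (prodpoly M) j) * \<rho> ^ j \<le> B * \<epsilon>) \<and>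
       (\<forall>z. absv z \<le> \<rho> \<longrightarrow> absv (h z - poly (prodpoly M) z) \<le> B * \<epsilon>))"
proof -
  define F where "F n = {\<mu> \<in> S. absv \<mu> \<le> real n}" for n
  have F: "finite (F n)" "F n \<subseteq> S" for n using S by (auto simp: F_def discrete_set_def)
  have Fsub: "{\<mu> \<in> S. absv \<mu> \<le> x} \<subseteq> F n" if "n \<ge> nat \<lceil>x\<rceil>" for x n
  proof -
    have "x \<le> real n" using that by linarith
    then show ?thesis by (auto simp: F_def)
  qed
  have ev: "\<exists>N. \<forall>m\<ge>N. \<forall>n\<ge>N. gauss_le \<rho> e (prodpoly (F m) - prodpoly (F n))"
    if "\<rho> > 0" "e > 0" for \<rho> e
  proof -
    obtain B where B: "B > 0" "\<And>\<epsilon> M M'. 0 < \<epsilon> \<Longrightarrow> \<epsilon> \<le> 1 \<Longrightarrow> finite M \<Longrightarrow> finite M' \<Longrightarrow> M \<subseteq> S \<Longrightarrow> M' \<subseteq> S \<Longrightarrow>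
      {\<mu> \<in> S. absv \<mu> \<le> \<rho> / \<epsilon>} \<subseteq> M \<Longrightarrow> {\<mu> \<in> S. absv \<mu> \<le> \<rho> / \<epsilon>} \<subseteq> M' \<Longrightarrow>
      gauss_le \<rho> (B * \<epsilon>) (prodpoly M - prodpoly M')" using prodpoly_Cauchy[OF S \<open>\<rho> > 0\<close>] by blast
    define \<epsilon> where "\<epsilon> = min 1 (e / B)"
    have \<epsilon>: "0 < \<epsilon>" "\<epsilon> \<le> 1" "B * \<epsilon> \<le> e"
      using B(1) that by (auto simp: \<epsilon>_def min_def field_simps)
    have "gauss_le \<rho> e (prodpoly (F m) - prodpoly (F n))" if "m \<ge> nat \<lceil>\<rho> / \<epsilon>\<rceil>" "n \<ge> nat \<lceil>\<rho> / \<epsilon>\<rceil>" for m n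
      using B(2)[OF \<epsilon>(1,2) F(1) F(1) F(2) F(2) Fsub[OF that(1)] Fsub[OF that(2)]] \<epsilon>(3)
      by (rule gauss_le_mono)
    then show ?thesis by blast
  qed
  have "\<exists>l. (\<lambda>n. Polynomial.coeff (prodpoly (F n)) j) \<longlonglongrightarrow> l" for j
  proof (rule Cauchy_absvI)
    fix e :: real assume e: "e > 0"
    obtain N where N: "\<forall>m\<ge>N. \<forall>n\<ge>N. gauss_le 1 (e / 2) (prodpoly (F m) - prodpoly (F n))"
      using ev[of 1 "e / 2"] e by auto
    have "absv (Polynomial.coeff (prodpoly (F m)) j - Polynomial.coeff (prodpoly (F n)) j) < e"
      if "m \<ge> N" "n \<ge> N" for m n
    proof -
      have "gauss_le 1 (e / 2) (prodpoly (F m) - prodpoly (F n))" using N that by blast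
      then have "absv (Polynomial.coeff (prodpoly (F m) - prodpoly (F n)) j) * 1 ^ j \<le> e / 2"
        unfolding gauss_le_def by blast
      then show ?thesis using e by simp
    qed
    then show "\<exists>N. \<forall>m\<ge>N. \<forall>n\<ge>N. absv (Polynomial.coeff (prodpoly (F m)) j - Polynomial.coeff (prodpoly (F n)) j) < e"
      by blast
  qed
  then obtain A where A: "\<And>j. (\<lambda>n. Polynomial.coeff (prodpoly (F n)) j) \<longlonglongrightarrow> A j" by metis
  have "\<exists>l. (\<lambda>n. poly (prodpoly (F n)) z) \<longlonglongrightarrow> l" for z
  proof (rule Cauchy_absvI)
    fix e :: real assume e: "e > 0"
    \<comment> \<open>The radius must be positive even for z = 0, hence the added 1.\<close>
    have "absv z + 1 > 0" using absv_nonneg[of z] by linarith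
    then obtain N where N: "\<forall>m\<ge>N. \<forall>n\<ge>N. gauss_le (absv z + 1) (e / 2) (prodpoly (F m) - prodpoly (F n))"
      using ev[of "absv z + 1" "e / 2"] e by auto
    have "absv (poly (prodpoly (F m)) z - poly (prodpoly (F n)) z) < e" if "m \<ge> N" "n \<ge> N" for m n
    proof -
      have "gauss_le (absv z + 1) (e / 2) (prodpoly (F m) - prodpoly (F n))" using N that by blast
      from gauss_le_poly[OF this, of z] show ?thesis using e by simp
    qed
    then show "\<exists>N. \<forall>m\<ge>N. \<forall>n\<ge>N. absv (poly (prodpoly (F m)) z - poly (prodpoly (F n)) z) < e"
      by blast
  qed
  then obtain h where h: "\<And>z. (\<lambda>n. poly (prodpoly (F n)) z) \<longlonglongrightarrow> h z" by metis
  have "\<exists>B>0. \<forall>\<epsilon> M. 0 < \<epsilon> \<and> \<epsilon> \<le> 1 \<and> finite M \<and> M \<subseteq> S \<and>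
       {\<mu> \<in> S. absv \<mu> \<le> \<rho> / \<epsilon>} \<subseteq> M \<longrightarrow>
       (\<forall>j. absv (A j - Polynomial.coeff (prodpoly M) j) * \<rho> ^ j \<le> B * \<epsilon>) \<and>
       (\<forall>z. absv z \<le> \<rho> \<longrightarrow> absv (h z - poly (prodpoly M) z) \<le> B * \<epsilon>)" if \<rho>: "\<rho> > 0" for \<rho>
  proof -
    obtain B where B: "B > 0" "\<And>\<epsilon> M M'. 0 < \<epsilon> \<Longrightarrow> \<epsilon> \<le> 1 \<Longrightarrow> finite M \<Longrightarrow> finite M' \<Longrightarrow> M \<subseteq> S \<Longrightarrow> M' \<subseteq> S \<Longrightarrow>
      {\<mu> \<in> S. absv \<mu> \<le> \<rho> / \<epsilon>} \<subseteq> M \<Longrightarrow> {\<mu> \<in> S. absv \<mu> \<le> \<rho> / \<epsilon>} \<subseteq> M' \<Longrightarrow>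
      gauss_le \<rho> (B * \<epsilon>) (prodpoly M - prodpoly M')" using prodpoly_Cauchy[OF S \<rho>] by blast
    have "(\<forall>j. absv (A j - Polynomial.coeff (prodpoly M) j) * \<rho> ^ j \<le> B * \<epsilon>) \<and>
       (\<forall>z. absv z \<le> \<rho> \<longrightarrow> absv (h z - poly (prodpoly M) z) \<le> B * \<epsilon>)"
      if \<epsilon>: "0 < \<epsilon>" "\<epsilon> \<le> 1" and M: "finite M" "M \<subseteq> S" "{\<mu> \<in> S. absv \<mu> \<le> \<rho> / \<epsilon>} \<subseteq> M" for \<epsilon> M
    proof -
      have g: "gauss_le \<rho> (B * \<epsilon>) (prodpoly (F n) - prodpoly M)" if "n \<ge> nat \<lceil>\<rho> / \<epsilon>\<rceil>" for n
        using B(2)[OF \<epsilon> F(1) M(1) F(2) M(2) Fsub[OF that] M(3)] .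
      have "absv (A j - Polynomial.coeff (prodpoly M) j) \<le> B * \<epsilon> / \<rho> ^ j" for j
      proof (rule tendsto_absv_le[OF A])
        show "eventually (\<lambda>n. absv (Polynomial.coeff (prodpoly (F n)) j - Polynomial.coeff (prodpoly M) j) \<le> B * \<epsilon> / \<rho> ^ j) sequentially"
          using g \<rho> unfolding eventually_sequentially gauss_le_def
          by (intro exI[of _ "nat \<lceil>\<rho> / \<epsilon>\<rceil>"]) (auto simp: pos_le_divide_eq)
      qed simp
      moreover have "absv (h z - poly (prodpoly M) z) \<le> B * \<epsilon>" if "absv z \<le> \<rho>" for z
      proof (rule tendsto_absv_le[OF h])
        have "absv (poly (prodpoly (F n)) z - poly (prodpoly M) z) \<le> B * \<epsilon>" if "n \<ge> nat \<lceil>\<rho> / \<epsilon>\<rceil>" for n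
          using gauss_le_poly[OF g[OF that] \<open>absv z \<le> \<rho>\<close>] by simp
        then show "eventually (\<lambda>n. absv (poly (prodpoly (F n)) z - poly (prodpoly M) z) \<le> B * \<epsilon>) sequentially"
          unfolding eventually_sequentially by blast
      qed simp
      ultimately show ?thesis using \<rho> by (auto simp: pos_le_divide_eq)
    qed
    with B(1) show ?thesis by blast
  qed
  then show ?thesis by blast
qed

section \<open>The product over a discrete set as an entire power series\<close>

definition lattice_prod :: "'c set \<Rightarrow> 'c \<Rightarrow> 'c" where
  "lattice_prod \<Lambda> z = Lim (finite_subsets_at_top (\<Lambda> - {0})) (\<lambda>M. \<Prod>\<mu>\<in>M. 1 - z / \<mu>)"

lemma lattice_exp_eq: "lattice_exp \<Lambda> z = z * lattice_prod \<Lambda> z"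
  by (simp add: lattice_exp_def lattice_prod_def)

text \<open>The third clause holds because all factors have Gauss norm at most 1 on the radius
  \<delta>. The last one reduces the vanishing of a coefficient to a cofinal choice of finite sets,
  so that the levels of a period lattice can be used, whose partial products have only few nonzero
  coefficients.\<close>

lemma lattice_prod_expansion:
  assumes disc: "discrete_set (\<Lambda> - {0})"
  shows "\<exists>A. (\<forall>z. ((\<lambda>M. \<Prod>\<mu>\<in>M. 1 - z / \<mu>) \<longlongrightarrow> lattice_prod \<Lambda> z) (finite_subsets_at_top (\<Lambda> - {0}))) \<and>
    (\<forall>z. (\<lambda>j. A j * z ^ j) sums lattice_prod \<Lambda> z) \<and>
    (\<forall>\<delta>>0. (\<forall>\<mu>\<in>\<Lambda> - {0}. \<delta> \<le> absv \<mu>) \<longrightarrow> (\<forall>j. absv (A j) * \<delta> ^ j \<le> 1)) \<and>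
    (\<forall>j. (\<forall>B. \<exists>M. finite M \<and> M \<subseteq> \<Lambda> - {0} \<and> {\<mu> \<in> \<Lambda> - {0}. absv \<mu> \<le> B} \<subseteq> M \<and>
       Polynomial.coeff (prodpoly M) j = 0) \<longrightarrow> A j = 0)"
proof -
  define S where "S = \<Lambda> - {0}"
  have S: "discrete_set S" using disc by (simp add: S_def)
  from prodpoly_limit[OF S] obtain A h where Ah: "\<forall>\<rho>>0. \<exists>B>0. \<forall>\<epsilon> M. 0 < \<epsilon> \<and> \<epsilon> \<le> 1 \<and> finite M \<and> M \<subseteq> S \<and>
       {\<mu> \<in> S. absv \<mu> \<le> \<rho> / \<epsilon>} \<subseteq> M \<longrightarrow>
       (\<forall>j. absv (A j - Polynomial.coeff (prodpoly M) j) * \<rho> ^ j \<le> B * \<epsilon>) \<and>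
       (\<forall>z. absv z \<le> \<rho> \<longrightarrow> absv (h z - poly (prodpoly M) z) \<le> B * \<epsilon>)"
    by (elim exE) (rule that)
  have approx: "\<exists>B. \<forall>M. finite M \<and> M \<subseteq> S \<and> {\<mu> \<in> S. absv \<mu> \<le> B} \<subseteq> M \<longrightarrow>
       (\<forall>j. absv (A j - Polynomial.coeff (prodpoly M) j) * \<rho> ^ j < e) \<and>
       (\<forall>z. absv z \<le> \<rho> \<longrightarrow> absv (h z - poly (prodpoly M) z) < e)" if "\<rho> > 0" "e > 0" for \<rho> e
  proof -
    obtain B where B: "B > 0" "\<And>\<epsilon> M. 0 < \<epsilon> \<and> \<epsilon> \<le> 1 \<and> finite M \<and> M \<subseteq> S \<and>
       {\<mu> \<in> S. absv \<mu> \<le> \<rho> / \<epsilon>} \<subseteq> M \<Longrightarrow>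
       (\<forall>j. absv (A j - Polynomial.coeff (prodpoly M) j) * \<rho> ^ j \<le> B * \<epsilon>) \<and>
       (\<forall>z. absv z \<le> \<rho> \<longrightarrow> absv (h z - poly (prodpoly M) z) \<le> B * \<epsilon>)" using Ah[THEN spec, THEN mp, OF \<open>\<rho> > 0\<close>] by blast
    define \<epsilon> where "\<epsilon> = min 1 (e / (2 * B))"
    have "\<epsilon> \<le> e / (2 * B)" by (simp add: \<epsilon>_def)
    then have "B * \<epsilon> \<le> B * (e / (2 * B))" using B(1) by (intro mult_left_mono) auto
    also have "\<dots> = e / 2" using B(1) by simp
    finally have *: "B * \<epsilon> < e" using that by simp
    have "0 < \<epsilon>" "\<epsilon> \<le> 1" using B(1) that by (auto simp: \<epsilon>_def)
    then have "finite M \<and> M \<subseteq> S \<and> {\<mu> \<in> S. absv \<mu> \<le> \<rho> / \<epsilon>} \<subseteq> M \<Longrightarrow>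
       (\<forall>j. absv (A j - Polynomial.coeff (prodpoly M) j) * \<rho> ^ j < e) \<and>
       (\<forall>z. absv z \<le> \<rho> \<longrightarrow> absv (h z - poly (prodpoly M) z) < e)" for M
      using B(2)[of \<epsilon> M] * by (meson le_less_trans)
    then show ?thesis by blast
  qed
  have finS: "finite {\<mu> \<in> S. absv \<mu> \<le> B}" for B using S by (simp add: discrete_set_def)
  have lim: "((\<lambda>M. \<Prod>\<mu>\<in>M. 1 - z / \<mu>) \<longlongrightarrow> h z) (finite_subsets_at_top S)" for z
    unfolding tendsto_absv
  proof (intro allI impI)
    fix e :: real assume "e > 0"
    have "absv z + 1 > 0" using absv_nonneg[of z] by linarith
    from approx[OF this \<open>e > 0\<close>] obtain B where B: "\<And>M. finite M \<Longrightarrow> M \<subseteq> S \<Longrightarrow> {\<mu> \<in> S. absv \<mu> \<le> B} \<subseteq> M \<Longrightarrow>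
       absv (h z - poly (prodpoly M) z) < e" by force
    have "absv ((\<Prod>\<mu>\<in>M. 1 - z / \<mu>) - h z) < e" if "finite M" "M \<subseteq> S" "{\<mu> \<in> S. absv \<mu> \<le> B} \<subseteq> M" for M
      using B[OF that] by (simp add: poly_prodpoly absv_commute)
    then show "eventually (\<lambda>M. absv ((\<Prod>\<mu>\<in>M. 1 - z / \<mu>) - h z) < e) (finite_subsets_at_top S)"
      using finS[of B] unfolding eventually_finite_subsets_at_top
      by (intro exI[of _ "{\<mu> \<in> S. absv \<mu> \<le> B}"]) auto
  qed
  have h: "lattice_prod \<Lambda> z = h z" for z
    unfolding lattice_prod_def by (rule tendsto_Lim) (use lim[of z] in \<open>simp_all add: S_def\<close>)
  have sums: "(\<lambda>j. A j * z ^ j) sums h z" for z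
    unfolding sums_def tendsto_absv
  proof (intro allI impI)
    fix e :: real assume "e > 0"
    have pos: "absv z + 1 > 0" using absv_nonneg[of z] by linarith
    from approx[OF this \<open>e > 0\<close>] obtain B where B: "\<forall>M. finite M \<and> M \<subseteq> S \<and> {\<mu> \<in> S. absv \<mu> \<le> B} \<subseteq> M \<longrightarrow>
       (\<forall>j. absv (A j - Polynomial.coeff (prodpoly M) j) * (absv z + 1) ^ j < e) \<and>
       (\<forall>x. absv x \<le> absv z + 1 \<longrightarrow> absv (h x - poly (prodpoly M) x) < e)" by (rule exE)
    \<comment> \<open>A single polynomial approximates all coefficients and the value at z; past its
      degree, its partial sums equal its value, so the two errors can be compared.\<close>
    define P where "P = prodpoly {\<mu> \<in> S. absv \<mu> \<le> B}"
    have "finite {\<mu> \<in> S. absv \<mu> \<le> B} \<and> {\<mu> \<in> S. absv \<mu> \<le> B} \<subseteq> S \<and> {\<mu> \<in> S. absv \<mu> \<le> B} \<subseteq> {\<mu> \<in> S. absv \<mu> \<le> B}"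
      using finS by auto
    from B[THEN spec, THEN mp, OF this]
    have P: "absv (A j - Polynomial.coeff P j) * (absv z + 1) ^ j < e" "absv (h z - poly P z) < e" for j
      unfolding P_def by simp_all
    have "absv ((\<Sum>j<n. A j * z ^ j) - h z) < e" if n: "n > Polynomial.degree P" for n
    proof -
      have "(\<Sum>j\<le>Polynomial.degree P. Polynomial.coeff P j * z ^ j) = (\<Sum>j<n. Polynomial.coeff P j * z ^ j)"
        using n by (intro sum.mono_neutral_left) (auto simp: coeff_eq_0)
      then have eq: "(\<Sum>j<n. A j * z ^ j) - h z =
          (\<Sum>j<n. (A j - Polynomial.coeff P j) * z ^ j) - (h z - poly P z)"
        by (simp add: poly_altdef left_diff_distrib sum_subtractf)
      have 1: "absv (\<Sum>j<n. (A j - Polynomial.coeff P j) * z ^ j) < e"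
      proof (rule absv_sum_less[OF _ \<open>e > 0\<close>])
        fix j
        have "absv ((A j - Polynomial.coeff P j) * z ^ j) \<le> absv (A j - Polynomial.coeff P j) * (absv z + 1) ^ j"
          unfolding absv_mult absv_power by (intro mult_left_mono power_mono) auto
        with P(1)[of j] show "absv ((A j - Polynomial.coeff P j) * z ^ j) < e" by linarith
      qed
      show ?thesis unfolding eq by (rule absv_diff_lessI[OF 1 P(2)])
    qed
    then show "eventually (\<lambda>n. absv ((\<Sum>j<n. A j * z ^ j) - h z) < e) sequentially"
      unfolding eventually_sequentially by (intro exI[of _ "Suc (Polynomial.degree P)"]) auto
  qed
  have bound: "absv (A j) * \<delta> ^ j \<le> 1" if \<delta>: "\<delta> > 0" "\<forall>\<mu>\<in>S. \<delta> \<le> absv \<mu>" for \<delta> j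
  proof -
    from approx[OF \<delta>(1) zero_less_one] obtain B where B: "\<forall>M. finite M \<and> M \<subseteq> S \<and> {\<mu> \<in> S. absv \<mu> \<le> B} \<subseteq> M \<longrightarrow>
       (\<forall>j. absv (A j - Polynomial.coeff (prodpoly M) j) * \<delta> ^ j < 1) \<and>
       (\<forall>x. absv x \<le> \<delta> \<longrightarrow> absv (h x - poly (prodpoly M) x) < 1)" by (rule exE)
    define P where "P = prodpoly {\<mu> \<in> S. absv \<mu> \<le> B}"
    have "finite {\<mu> \<in> S. absv \<mu> \<le> B} \<and> {\<mu> \<in> S. absv \<mu> \<le> B} \<subseteq> S \<and> {\<mu> \<in> S. absv \<mu> \<le> B} \<subseteq> {\<mu> \<in> S. absv \<mu> \<le> B}"
      using finS by auto
    from B[THEN spec, THEN mp, OF this]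
    have P: "absv (A j - Polynomial.coeff P j) * \<delta> ^ j < 1" unfolding P_def by simp
    have "gauss_le \<delta> 1 P"
      unfolding P_def using \<delta> finS S
      by (intro conjunct2[OF gauss_le_prodpoly_minus_1[of _ \<delta> 1]]) (auto simp: discrete_set_def)
    then have "absv (Polynomial.coeff P j) * \<delta> ^ j \<le> 1" by (simp add: gauss_le_def)
    then have "absv (Polynomial.coeff P j) \<le> 1 / \<delta> ^ j" using \<delta> by (simp add: pos_le_divide_eq)
    moreover have "absv (A j - Polynomial.coeff P j) \<le> 1 / \<delta> ^ j"
      using P \<delta> by (simp add: pos_le_divide_eq)
    ultimately have "absv ((A j - Polynomial.coeff P j) + Polynomial.coeff P j) \<le> 1 / \<delta> ^ j"
      by (intro absv_add_leI)
    then show ?thesis using \<delta> by (simp add: pos_le_divide_eq)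
  qed
  have zero: "A i = 0" if i: "\<forall>B. \<exists>M. finite M \<and> M \<subseteq> S \<and> {\<mu> \<in> S. absv \<mu> \<le> B} \<subseteq> M \<and>
       Polynomial.coeff (prodpoly M) i = 0" for i
  proof (rule ccontr)
    assume "A i \<noteq> 0"
    define e where "e = absv (A i)"
    have e: "e > 0" using \<open>A i \<noteq> 0\<close> by (simp add: e_def)
    from approx[OF zero_less_one e] obtain B where B: "\<forall>M. finite M \<and> M \<subseteq> S \<and> {\<mu> \<in> S. absv \<mu> \<le> B} \<subseteq> M \<longrightarrow>
       (\<forall>j. absv (A j - Polynomial.coeff (prodpoly M) j) * 1 ^ j < e) \<and>
       (\<forall>x. absv x \<le> 1 \<longrightarrow> absv (h x - poly (prodpoly M) x) < e)" by (rule exE)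
    from i[THEN spec, of B] obtain M where M: "finite M \<and> M \<subseteq> S \<and> {\<mu> \<in> S. absv \<mu> \<le> B} \<subseteq> M"
      "Polynomial.coeff (prodpoly M) i = 0" by (elim exE conjE) simp
    have "absv (A i - Polynomial.coeff (prodpoly M) i) * 1 ^ i < e"
      using B[THEN spec, THEN mp, OF M(1), THEN conjunct1, THEN spec, of i] .
    with M(2) show False by (simp add: e_def)
  qed
  show ?thesis
    unfolding S_def[symmetric] h
    by (rule exI[of _ A], intro conjI allI impI) (use lim sums bound zero in \<open>auto simp: conj_assoc\<close>)
qed

text \<open>Factors with \<mu> larger than z have absolute value 1. Hence all partial products that
  contain the finitely many other factors share one nonzero absolute value, and so cannot tend to
  0.\<close>

lemma lattice_prod_nonzero:
  assumes disc: "discrete_set (\<Lambda> - {0})" and z: "z \<notin> \<Lambda> - {0}"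
  shows "lattice_prod \<Lambda> z \<noteq> 0"
proof
  assume zero: "lattice_prod \<Lambda> z = 0"
  define S where "S = \<Lambda> - {0}"
  have S: "discrete_set S" using disc by (simp add: S_def)
  define M1 where "M1 = {\<mu> \<in> S. absv \<mu> \<le> absv z}"
  have M1: "finite M1" "M1 \<subseteq> S" using S by (auto simp: M1_def discrete_set_def)
  define \<kappa> where "\<kappa> = absv (\<Prod>\<mu>\<in>M1. 1 - z / \<mu>)"
  have nz: "1 - z / \<mu> \<noteq> 0" if "\<mu> \<in> M1" for \<mu>
  proof
    assume "1 - z / \<mu> = 0"
    moreover have "\<mu> \<noteq> 0" using that S by (auto simp: M1_def discrete_set_def)
    ultimately have "z = \<mu>" by simp
    then show False using z that M1 by (auto simp: S_def)
  qed
  have \<kappa>: "\<kappa> > 0"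
    unfolding \<kappa>_def absv_pos prod_zero_iff[OF M1(1)] using nz by blast
  have "((\<lambda>M. \<Prod>\<mu>\<in>M. 1 - z / \<mu>) \<longlongrightarrow> 0) (finite_subsets_at_top S)"
    using lattice_prod_expansion[OF disc] zero unfolding S_def by metis
  then have "eventually (\<lambda>M. absv ((\<Prod>\<mu>\<in>M. 1 - z / \<mu>) - 0) < \<kappa>) (finite_subsets_at_top S)"
    using \<kappa> unfolding tendsto_absv by blast
  then obtain M2 where M2: "finite M2" "M2 \<subseteq> S"
    "\<And>M. finite M \<Longrightarrow> M2 \<subseteq> M \<Longrightarrow> M \<subseteq> S \<Longrightarrow> absv (\<Prod>\<mu>\<in>M. 1 - z / \<mu>) < \<kappa>"
    unfolding eventually_finite_subsets_at_top by auto
  have "absv (\<Prod>\<mu>\<in>M2 \<union> M1. 1 - z / \<mu>) = absv (\<Prod>\<mu>\<in>M2 \<union> M1 - M1. 1 - z / \<mu>) * \<kappa>"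
    unfolding \<kappa>_def by (subst prod.subset_diff[of M1]) (use M2 M1 in \<open>simp_all add: absv_mult\<close>)
  also have "absv (\<Prod>\<mu>\<in>M2 \<union> M1 - M1. 1 - z / \<mu>) = 1"
    unfolding absv_prod
  proof (rule prod.neutral, rule ballI)
    fix \<mu> assume "\<mu> \<in> M2 \<union> M1 - M1"
    then have \<mu>: "absv \<mu> > absv z" using M2(2) by (auto simp: M1_def)
    moreover have "absv \<mu> > 0" using \<mu> absv_nonneg[of z] by linarith
    ultimately have "absv (- (z / \<mu>)) < absv (1::'c)" by (simp add: absv_divide)
    from absv_add_eq[OF this] show "absv (1 - z / \<mu>) = 1" by simp
  qed
  finally show False using M2(3)[of "M2 \<union> M1"] M2 M1 by simp
qed

text \<open>The factor z moves the exponent \<open>q^i - 1\<close> to \<open>q^i\<close>; the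
  regrouped partial sums are the subsequence of the original ones taken up to
  \<open>q^n - 1\<close>.\<close>

lemma sums_q_powers:
  assumes sums: "(\<lambda>j. A j * z ^ j) sums (h::'c)"
    and supp: "\<And>j. A j \<noteq> 0 \<Longrightarrow> \<exists>i. Suc j = CARD('f) ^ i"
  shows "(\<lambda>i. A (CARD('f) ^ i - 1) * z ^ (CARD('f) ^ i)) sums (z * h)"
proof -
  have inj: "inj_on (\<lambda>i. CARD('f) ^ i - 1) {..<n}" for n
  proof (rule inj_onI)
    fix i i' assume "CARD('f) ^ i - 1 = CARD('f) ^ i' - 1"
    then have "CARD('f) ^ i = CARD('f) ^ i'"
      by (metis q_pos Suc_pred' zero_less_power)
    then show "i = i'" using q_ge_2 by (simp add: power_inject_exp)
  qed
  have eq: "(\<Sum>i<n. A (CARD('f) ^ i - 1) * z ^ (CARD('f) ^ i)) = z * (\<Sum>j<CARD('f) ^ n - 1. A j * z ^ j)" for n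
  proof -
    have "(\<Sum>j<CARD('f) ^ n - 1. A j * z ^ j) = (\<Sum>j\<in>(\<lambda>i. CARD('f) ^ i - 1) ` {..<n}. A j * z ^ j)"
    proof (rule sum.mono_neutral_right)
      show "(\<lambda>i. CARD('f) ^ i - 1) ` {..<n} \<subseteq> {..<CARD('f) ^ n - 1}"
      proof safe
        fix i assume "i < n"
        then have "CARD('f) ^ i < CARD('f) ^ n" using q_ge_2 by (intro power_strict_increasing) auto
        moreover have "CARD('f) ^ i > 0" by simp
        ultimately show "CARD('f) ^ i - 1 < CARD('f) ^ n - 1" by linarith
      qed
      show "\<forall>j\<in>{..<CARD('f) ^ n - 1} - (\<lambda>i. CARD('f) ^ i - 1) ` {..<n}. A j * z ^ j = 0"
      proof (rule ballI, rule ccontr)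
        fix j assume j: "j \<in> {..<CARD('f) ^ n - 1} - (\<lambda>i. CARD('f) ^ i - 1) ` {..<n}"
        assume "A j * z ^ j \<noteq> 0"
        then obtain i where i: "Suc j = CARD('f) ^ i" using supp by fastforce
        then have j': "j = CARD('f) ^ i - 1" by simp
        have "CARD('f) ^ i < CARD('f) ^ n" using i j by auto
        then have "i < n" using q_ge_2 by (simp add: power_strict_increasing_iff)
        with j j' show False by blast
      qed
    qed simp
    also have "\<dots> = (\<Sum>i<n. A (CARD('f) ^ i - 1) * z ^ (CARD('f) ^ i - 1))"
      by (simp only: sum.reindex[OF inj] comp_def)
    also have "z * \<dots> = (\<Sum>i<n. A (CARD('f) ^ i - 1) * z ^ (CARD('f) ^ i))"
      unfolding sum_distrib_left
    proof (rule sum.cong[OF refl])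
      fix i
      have "z ^ (CARD('f) ^ i) = z * z ^ (CARD('f) ^ i - 1)"
        by (metis q_pos Suc_pred' power_Suc zero_less_power)
      then show "z * (A (CARD('f) ^ i - 1) * z ^ (CARD('f) ^ i - 1)) = A (CARD('f) ^ i - 1) * z ^ (CARD('f) ^ i)"
        by simp
    qed
    finally show ?thesis by simp
  qed
  have "filterlim (\<lambda>n. CARD('f) ^ n - 1) sequentially sequentially"
  proof (rule filterlim_at_top_mono[OF filterlim_ident])
    show "eventually (\<lambda>n. n \<le> CARD('f) ^ n - 1) sequentially"
    proof (rule always_eventually, rule allI)
      fix n
      have "n < 2 ^ n" by (rule less_exp)
      also have "2 ^ n \<le> CARD('f) ^ n" using q_ge_2 by (intro power_mono) auto
      finally show "n \<le> CARD('f) ^ n - 1" by linarith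
    qed
  qed
  from tendsto_cmult_absv[OF filterlim_compose[OF sums[unfolded sums_def] this], of z]
  show ?thesis unfolding sums_def eq .
qed

section \<open>Polynomials with a subspace of roots\<close>

lemma Fq_vector_space: "vector_space (\<lambda>(c::'f) (x::'c). con c * x)"
  by unfold_locales (simp_all add: algebra_simps embK_add embK_mult flip: fls_plus_const fls_const_mult_const)

definition Fq_span :: "'c set \<Rightarrow> 'c set" where
  "Fq_span = module.span (\<lambda>(c::'f) (x::'c). con c * x)"

text \<open>Induction on generators. A new b splits the span into translates by the multiples e b,
  and with P the old product, linearity gives \<Prod>(P(z) - e P(b)) =
  \<open>P(z)^q - P(b)^(q-1) * P(z)\<close>. Generators may be dependent, so \<open>card B\<close>
  is only an upper bound; it later becomes the degree bound for \<open>ell\<close>.\<close>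

lemma prod_span_q_polynomial:
  assumes "finite B"
  shows "finite (Fq_span B) \<and> (\<exists>c. \<forall>z. (\<Prod>s\<in>Fq_span B. z - s) = (\<Sum>i\<le>card B. c i * z ^ (CARD('f) ^ i)))"
proof -
  interpret Fq: vector_space "\<lambda>(c::'f) (x::'c). con c * x" by (rule Fq_vector_space)
  from assms show ?thesis
  proof (induction B)
    case empty
    have "Fq_span {} = {0}" unfolding Fq_span_def by simp
    then show ?case by (auto intro!: exI[of _ "\<lambda>_. 1"])
  next
    case (insert b B)
    obtain c where fin: "finite (Fq_span B)"
      and c: "\<And>z. (\<Prod>s\<in>Fq_span B. z - s) = (\<Sum>i\<le>card B. c i * z ^ (CARD('f) ^ i))"
      using insert.IH by blast
    define P where "P z = (\<Prod>s\<in>Fq_span B. z - s)" for z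
    show ?case
    proof (cases "b \<in> Fq_span B")
      case True
      then have eq: "Fq_span (insert b B) = Fq_span B" unfolding Fq_span_def by (rule Fq.span_redundant)
      have P: "(\<Prod>s\<in>Fq_span B. z - s) = (\<Sum>i\<le>card (insert b B). (if i \<le> card B then c i else 0) * z ^ (CARD('f) ^ i))" for z
        using insert by (simp add: c)
      show ?thesis
        unfolding eq by (intro conjI fin exI[of _ "\<lambda>i. if i \<le> card B then c i else 0"] allI P)
    next
      case False
      have Pdiff: "P (z - con e * b) = P z - con e * P b" for z e
      proof -
        have "con e ^ (CARD('f) ^ i) = con e" for i
          by (induction i) (simp_all add: power_mult con_power_q)
        then show ?thesis
          by (simp add: P_def c frob_diff power_mult_distrib right_diff_distrib sum_subtractf sum_distrib_left mult_ac)
      qed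
      have bij: "bij_betw (\<lambda>(e, s). s + con e * b) (UNIV \<times> Fq_span B) (Fq_span (insert b B))"
        unfolding bij_betw_def
      proof
        show "inj_on (\<lambda>(e, s). s + con e * b) (UNIV \<times> Fq_span B)"
        proof (rule inj_onI, clarsimp)
          fix e s e' s' assume s: "s \<in> Fq_span B" "s' \<in> Fq_span B" and eq: "s + con e * b = s' + con e' * b"
          have "con (e - e') * b = s' - s"
            using eq by (simp add: embK_diff algebra_simps flip: fls_minus_const)
          also have "s' - s \<in> Fq_span B" using s unfolding Fq_span_def by (intro Fq.span_diff)
          finally have in': "con (e - e') * b \<in> Fq_span B" .
          have "e = e'"
          proof (rule ccontr)
            assume "e \<noteq> e'"
            then have "inverse (e - e') * (e - e') = 1" by simp
            then have "con (inverse (e - e')) * con (e - e') = 1"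
              by (simp only: fls_const_1 embK_1 fls_const_mult_const flip: embK_mult)
            then have "con (inverse (e - e')) * (con (e - e') * b) = b"
              by (simp only: mult.assoc[symmetric] mult_1_left)
            moreover have "con (inverse (e - e')) * (con (e - e') * b) \<in> Fq_span B"
              using in' unfolding Fq_span_def by (rule Fq.span_scale)
            ultimately show False using False by metis
          qed
          with eq show "e = e' \<and> s = s'" by simp
        qed
        show "(\<lambda>(e, s). s + con e * b) ` (UNIV \<times> Fq_span B) = Fq_span (insert b B)"
        proof -
          have "Fq_span (insert b B) = {x. \<exists>k. x - con k * b \<in> Fq_span B}"
            unfolding Fq_span_def by (rule Fq.span_insert)
          also have "\<dots> = (\<lambda>(e, s). s + con e * b) ` (UNIV \<times> Fq_span B)"
          proof (intro equalityI subsetI)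
            fix x assume "x \<in> {x. \<exists>k. x - con k * b \<in> Fq_span B}"
            then obtain k where "x - con k * b \<in> Fq_span B" by blast
            then have "(k, x - con k * b) \<in> UNIV \<times> Fq_span B" by simp
            then show "x \<in> (\<lambda>(e, s). s + con e * b) ` (UNIV \<times> Fq_span B)"
              by (rule rev_image_eqI) simp
          next
            fix x assume "x \<in> (\<lambda>(e, s). s + con e * b) ` (UNIV \<times> Fq_span B)"
            then obtain e s where s: "s \<in> Fq_span B" "x = s + con e * b" by auto
            then have "x - con e * b \<in> Fq_span B" by simp
            then show "x \<in> {x. \<exists>k. x - con k * b \<in> Fq_span B}" by blast
          qed
          finally show ?thesis by simp
        qed
      qed
      have "(\<Prod>s\<in>Fq_span (insert b B). z - s) = (P z) ^ CARD('f) - (P b) ^ (CARD('f) - 1) * P z" for z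
      proof -
        have "(\<Prod>s\<in>Fq_span (insert b B). z - s) = (\<Prod>(e, s)\<in>UNIV \<times> Fq_span B. z - (s + con e * b))"
          using prod.reindex_bij_betw[OF bij, of "\<lambda>x. z - x"] by (simp add: case_prod_unfold)
        also have "\<dots> = (\<Prod>e\<in>UNIV. \<Prod>s\<in>Fq_span B. (z - con e * b) - s)"
          by (simp add: prod.cartesian_product algebra_simps)
        also have "\<dots> = (\<Prod>e\<in>UNIV. P z - con e * P b)"
          by (simp add: Pdiff flip: P_def)
        finally show ?thesis by (simp add: prod_diff_con_mult)
      qed
      moreover have "(P z) ^ CARD('f) - (P b) ^ (CARD('f) - 1) * P z =
          (\<Sum>i\<le>card (insert b B). ((if i = 0 then 0 else c (i - 1) ^ CARD('f)) -
             (if i \<le> card B then P b ^ (CARD('f) - 1) * c i else 0)) * z ^ (CARD('f) ^ i))" for z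
      proof -
        have "(P z) ^ CARD('f) = (\<Sum>i\<le>card B. c i ^ CARD('f) * z ^ (CARD('f) ^ Suc i))"
          using frob_sum[of "\<lambda>i. c i * z ^ (CARD('f) ^ i)" "{..card B}" 1]
          by (simp add: P_def c power_mult_distrib mult.commute flip: power_mult)
        also have "\<dots> = (\<Sum>i\<le>Suc (card B). (if i = 0 then 0 else c (i - 1) ^ CARD('f)) * z ^ (CARD('f) ^ i))"
          by (subst sum.atMost_Suc_shift) simp
        finally have 1: "(P z) ^ CARD('f) = \<dots>" .
        have 2: "(P b) ^ (CARD('f) - 1) * P z =
          (\<Sum>i\<le>Suc (card B). (if i \<le> card B then P b ^ (CARD('f) - 1) * c i else 0) * z ^ (CARD('f) ^ i))"
          unfolding P_def[of z] c by (simp add: sum_distrib_left mult.assoc)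
        have cB: "card (insert b B) = Suc (card B)" using insert by simp
        show ?thesis
          unfolding 1 2 cB by (simp only: left_diff_distrib sum_subtractf)
      qed
      ultimately have "\<forall>z. (\<Prod>s\<in>Fq_span (insert b B). z - s) =
          (\<Sum>i\<le>card (insert b B). ((if i = 0 then 0 else c (i - 1) ^ CARD('f)) -
             (if i \<le> card B then P b ^ (CARD('f) - 1) * c i else 0)) * z ^ (CARD('f) ^ i))"
        by simp
      moreover have "finite (Fq_span (insert b B))"
        using bij_betw_finite[OF bij] fin by simp
      ultimately show ?thesis
        by (intro conjI exI[of _ "\<lambda>i. (if i = 0 then 0 else c (i - 1) ^ CARD('f)) -
             (if i \<le> card B then P b ^ (CARD('f) - 1) * c i else 0)"])
    qed
  qed
qed

section \<open>Division in the period lattice\<close>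

lemma embA_monom: "embA \<iota> (Polynomial.monom c n) = con c * TT ^ n"
  by (induction n) (simp_all add: monom_0 monom_Suc embA_pCons)

lemma embA_sum: "embA \<iota> (\<Sum>i\<in>I. f i) = (\<Sum>i\<in>I. embA \<iota> (f i))"
  by (induction I rule: infinite_finite_induct) (simp_all add: embA_add)

definition lam :: "nat \<Rightarrow> (nat \<Rightarrow> 'c) \<Rightarrow> (nat \<Rightarrow> 'f poly) \<Rightarrow> 'c" where
  "lam r \<omega> b = (\<Sum>i=1..r. embA \<iota> (b i) * normalized r \<omega> i)"

lemma period_lattice_eq: "period_lattice \<iota> r \<omega> = range (lam r \<omega>)"
  by (simp add: period_lattice_def lam_def[abs_def])

lemma lam_add: "lam r \<omega> (\<lambda>i. b i + c i) = lam r \<omega> b + lam r \<omega> c"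
  by (simp add: lam_def embA_add algebra_simps sum.distrib)

lemma lam_diff: "lam r \<omega> (\<lambda>i. b i - c i) = lam r \<omega> b - lam r \<omega> c"
  by (simp add: lam_def embA_diff algebra_simps sum_subtractf)

lemma lam_mult: "lam r \<omega> (\<lambda>i. a * b i) = embA \<iota> a * lam r \<omega> b"
  by (simp add: lam_def embA_mult sum_distrib_left mult.assoc)

lemma lam_0 [simp]: "lam r \<omega> (\<lambda>i. 0) = 0"
  by (simp add: lam_def)

lemma lam_single:
  assumes "i \<in> {1..r}"
  shows "lam r \<omega> (\<lambda>k. if k = i then p else 0) = embA \<iota> p * normalized r \<omega> i"
proof -
  have "lam r \<omega> (\<lambda>k. if k = i then p else 0) = (\<Sum>k=1..r. if k = i then embA \<iota> p * normalized r \<omega> k else 0)"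
    unfolding lam_def by (intro sum.cong) auto
  then show ?thesis using assms by simp
qed

lemma lam_lower:
  assumes "separated r \<delta> \<omega>" "i \<in> {1..r}"
  shows "\<delta> * absv (embA \<iota> (b i)) \<le> absv (lam r \<omega> b)"
  using assms(1)[unfolded separated_def, THEN spec, of "\<lambda>i. poly (map_poly fls_const (b i)) fls_X_inv"] assms(2)
  unfolding lam_def embA_def by blast

lemma lam_eq_0:
  assumes "separated r \<delta> \<omega>" "\<delta> > 0" "lam r \<omega> b = 0" "i \<in> {1..r}"
  shows "b i = 0"
proof (rule ccontr)
  assume "b i \<noteq> 0"
  then have "absv (embA \<iota> (b i)) > 0" by simp
  then have "\<delta> * absv (embA \<iota> (b i)) > 0" using assms(2) by simp
  with lam_lower[OF assms(1,4), of b] assms(3) show False by simp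
qed

text \<open>The zero polynomial has degree 0, so the separate case p = 0 matters for n = 0: it makes
  level 0 the zero space, the correct set of remainders modulo a constant.\<close>

abbreviation small :: "nat \<Rightarrow> 'f poly \<Rightarrow> bool" where
  "small n p \<equiv> p = 0 \<or> Polynomial.degree p < n"

lemma small_add: "small n p \<Longrightarrow> small n p' \<Longrightarrow> small n (p + p')"
  by (cases "p = 0"; cases "p' = 0") (auto intro: le_less_trans[OF degree_add_le_max])

lemma small_diff: "small n p \<Longrightarrow> small n p' \<Longrightarrow> small n (p - p')"
  by (cases "p = 0"; cases "p' = 0") (auto intro: le_less_trans[OF degree_diff_le_max])

definition level :: "nat \<Rightarrow> (nat \<Rightarrow> 'c) \<Rightarrow> nat \<Rightarrow> 'c set" where
  "level r \<omega> n = lam r \<omega> ` {b. \<forall>i. small n (b i)}"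

definition level_gens :: "nat \<Rightarrow> (nat \<Rightarrow> 'c) \<Rightarrow> nat \<Rightarrow> 'c set" where
  "level_gens r \<omega> n = (\<lambda>(j, i). TT ^ j * normalized r \<omega> i) ` ({..<n} \<times> {1..r})"

lemma finite_level_gens: "finite (level_gens r \<omega> n)"
  by (simp add: level_gens_def)

lemma card_level_gens: "card (level_gens r \<omega> n) \<le> r * n"
proof -
  have "card (level_gens r \<omega> n) \<le> card ({..<n} \<times> {1..r})"
    unfolding level_gens_def by (intro card_image_le) auto
  then show ?thesis by (simp add: mult.commute)
qed

text \<open>The multiples of the r periods by powers of T below n generate. This makes a level
  finite, its root polynomial a q-polynomial, and counts at most \<open>r * n\<close>
  generators.\<close>

lemma level_eq_span: "level r \<omega> n = Fq_span (level_gens r \<omega> n)"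
proof -
  interpret Fq: vector_space "\<lambda>(c::'f) (x::'c). con c * x" by (rule Fq_vector_space)
  show ?thesis
    unfolding Fq_span_def
  proof (intro equalityI Fq.span_minimal subsetI)
    show "Fq.subspace (level r \<omega> n)"
    proof (rule Fq.subspaceI)
      show "0 \<in> level r \<omega> n" unfolding level_def by (intro image_eqI[of _ _ "\<lambda>_. 0"]) auto
    next
      fix x y assume "x \<in> level r \<omega> n" "y \<in> level r \<omega> n"
      then obtain b c where bc: "x = lam r \<omega> b" "y = lam r \<omega> c" "\<forall>i. small n (b i)" "\<forall>i. small n (c i)"
        unfolding level_def by auto
      have "\<forall>i. small n (b i + c i)" using bc(3,4) by (intro allI small_add) auto
      then show "x + y \<in> level r \<omega> n"
        unfolding level_def bc lam_add[symmetric] by blast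
    next
      fix e x assume "x \<in> level r \<omega> n"
      then obtain b where b: "x = lam r \<omega> b" "\<forall>i. small n (b i)" unfolding level_def by auto
      have "con e * x = lam r \<omega> (\<lambda>i. [:e:] * b i)" by (simp only: b lam_mult embA_const)
      moreover have "small n ([:e:] * b i)" for i
        using b(2) by (auto intro: le_less_trans[OF degree_smult_le])
      ultimately show "con e * x \<in> level r \<omega> n" unfolding level_def by blast
    qed
  next
    fix x assume "x \<in> level_gens r \<omega> n"
    then obtain j i where "j < n" "i \<in> {1..r}" "x = TT ^ j * normalized r \<omega> i"
      unfolding level_gens_def by auto
    then show "x \<in> level r \<omega> n"
      unfolding level_def
      by (intro image_eqI[of _ _ "\<lambda>k. if k = i then Polynomial.monom 1 j else 0"])
        (auto simp: lam_single embA_monom degree_monom_eq)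
  next
    fix x assume "x \<in> level r \<omega> n"
    then obtain b where b: "x = lam r \<omega> b" "\<forall>i. small n (b i)" unfolding level_def by auto
    have "embA \<iota> (b i) * normalized r \<omega> i \<in> Fq.span (level_gens r \<omega> n)" if i: "i \<in> {1..r}" for i
    proof -
      have "embA \<iota> (b i) = embA \<iota> (\<Sum>j\<le>Polynomial.degree (b i). Polynomial.monom (Polynomial.coeff (b i) j) j)"
        by (simp only: poly_as_sum_of_monoms)
      also have "\<dots> = (\<Sum>j\<le>Polynomial.degree (b i). con (Polynomial.coeff (b i) j) * TT ^ j)"
        by (simp add: embA_sum embA_monom)
      finally have eq: "embA \<iota> (b i) * normalized r \<omega> i =
          (\<Sum>j\<le>Polynomial.degree (b i). con (Polynomial.coeff (b i) j) * (TT ^ j * normalized r \<omega> i))"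
        by (simp add: sum_distrib_right mult.assoc)
      have "con (Polynomial.coeff (b i) j) * (TT ^ j * normalized r \<omega> i) \<in> Fq.span (level_gens r \<omega> n)"
        if j: "j \<le> Polynomial.degree (b i)" for j
      proof (cases "b i = 0")
        case True
        then show ?thesis by (simp add: Fq.span_zero)
      next
        case False
        then have "j < n" using b(2) j by (meson le_less_trans)
        then have "TT ^ j * normalized r \<omega> i \<in> level_gens r \<omega> n"
          using i unfolding level_gens_def by (intro image_eqI[of _ _ "(j, i)"]) auto
        then show ?thesis by (intro Fq.span_scale Fq.span_base)
      qed
      then show ?thesis unfolding eq by (intro Fq.span_sum) auto
    qed
    then show "x \<in> Fq.span (level_gens r \<omega> n)"
      unfolding b(1) lam_def by (intro Fq.span_sum) auto
  qed
qed

lemma finite_level: "finite (level r \<omega> n)"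
  using prod_span_q_polynomial[OF finite_level_gens[of r \<omega> n]] by (simp add: level_eq_span)

lemma prod_level_q_polynomial:
  "\<exists>c m. \<forall>z. (\<Prod>s\<in>level r \<omega> n. z - s) = (\<Sum>i\<le>m. c i * z ^ (CARD('f) ^ i))"
  using prod_span_q_polynomial[OF finite_level_gens[of r \<omega> n]] unfolding level_eq_span by blast

lemma level_0: "0 \<in> level r \<omega> n"
  unfolding level_def by (intro image_eqI[of _ _ "\<lambda>_. 0"]) auto

lemma level_minus: "x \<in> level r \<omega> n \<Longrightarrow> - x \<in> level r \<omega> n"
proof -
  assume "x \<in> level r \<omega> n"
  then obtain b where "x = lam r \<omega> b" "\<forall>i. small n (b i)" unfolding level_def by auto
  then show "- x \<in> level r \<omega> n"
    unfolding level_def using lam_diff[of r \<omega> "\<lambda>_. 0" b]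
    by (intro image_eqI[of _ _ "\<lambda>i. - b i"]) auto
qed

lemma level_mono: "m \<le> n \<Longrightarrow> level r \<omega> m \<subseteq> level r \<omega> n"
  unfolding level_def by (intro image_mono) (auto dest: spec intro: less_le_trans)

lemma level_subset: "level r \<omega> n \<subseteq> period_lattice \<iota> r \<omega>"
  by (auto simp: level_def period_lattice_eq)

text \<open>Separation turns a bound on a lattice vector into a bound on its coefficients, hence on
  their degrees.\<close>

lemma bounded_subset_level:
  assumes "separated r \<delta> \<omega>" "\<delta> > 0"
  shows "\<exists>n. {\<mu> \<in> period_lattice \<iota> r \<omega>. absv \<mu> \<le> B} \<subseteq> level r \<omega> n"
proof -
  obtain n where n: "B / \<delta> < real CARD('f) ^ n"
    using real_arch_pow[of "real CARD('f)"] q_ge_2 by auto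
  have "x \<in> level r \<omega> n" if x: "x \<in> period_lattice \<iota> r \<omega>" "absv x \<le> B" for x
  proof -
    obtain b where b: "x = lam r \<omega> b" using x unfolding period_lattice_eq by auto
    \<comment> \<open>Entries outside 1..r do not affect the vector, but \<open>level\<close>
      restricts them too, so they are set to 0.\<close>
    define b' where "b' i = (if i \<in> {1..r} then b i else 0)" for i
    have "x = lam r \<omega> b'" by (simp add: b b'_def lam_def)
    moreover have "small n (b' i)" for i
    proof (cases "b' i = 0")
      case False
      then have i: "i \<in> {1..r}" by (auto simp: b'_def split: if_splits)
      have "\<delta> * absv (embA \<iota> (b i)) \<le> B"
        using lam_lower[OF assms(1) i, of b] x(2) b by simp
      then have "absv (embA \<iota> (b i)) \<le> B / \<delta>" using assms(2) by (simp add: field_simps)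
      then have "real CARD('f) ^ Polynomial.degree (b i) < real CARD('f) ^ n"
        using n False i by (simp add: absv_embA b'_def)
      then have "Polynomial.degree (b i) < n" using q_ge_2 by (simp add: power_strict_increasing_iff)
      then show ?thesis using i by (simp add: b'_def)
    qed simp
    ultimately show ?thesis unfolding level_def by blast
  qed
  then show ?thesis by blast
qed

lemma discrete_period_lattice:
  assumes "separated r \<delta> \<omega>" "\<delta> > 0"
  shows "discrete_set (period_lattice \<iota> r \<omega> - {0})"
  unfolding discrete_set_def
proof (intro conjI allI)
  fix B
  obtain n where "{\<mu> \<in> period_lattice \<iota> r \<omega>. absv \<mu> \<le> B} \<subseteq> level r \<omega> n"
    using bounded_subset_level[OF assms] by blast
  then show "finite {\<mu> \<in> period_lattice \<iota> r \<omega> - {0}. absv \<mu> \<le> B}"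
    by (intro finite_subset[OF _ finite_level[of r \<omega> n]]) auto
qed simp

text \<open>A finite set of lattice vectors is bounded and so lies in some level. This cofinality
  replaces limits over finite subsets by limits of sequences.\<close>

lemma level_tendsto:
  assumes "separated r \<delta> \<omega>" "\<delta> > 0"
  shows "filterlim (\<lambda>n. level r \<omega> n - {0}) (finite_subsets_at_top (period_lattice \<iota> r \<omega> - {0})) sequentially"
  unfolding filterlim_finite_subsets_at_top
proof (intro allI impI)
  fix M assume M: "finite M \<and> M \<subseteq> period_lattice \<iota> r \<omega> - {0}"
  define B where "B = (\<Sum>x\<in>M. absv x)"
  have "absv x \<le> B" if "x \<in> M" for x
    unfolding B_def using M that by (intro member_le_sum) auto
  then have "M \<subseteq> {\<mu> \<in> period_lattice \<iota> r \<omega>. absv \<mu> \<le> B}" using M by auto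
  then obtain N where N: "M \<subseteq> level r \<omega> N" using bounded_subset_level[OF assms] by (meson order_trans)
  have "finite (level r \<omega> n - {0}) \<and> M \<subseteq> level r \<omega> n - {0} \<and> level r \<omega> n - {0} \<subseteq> period_lattice \<iota> r \<omega> - {0}"
    if n: "n \<ge> N" for n
  proof -
    have "M \<subseteq> level r \<omega> n" using N level_mono[OF n] by (rule order_trans)
    then show ?thesis using M finite_level level_subset by blast
  qed
  then show "eventually (\<lambda>n. finite (level r \<omega> n - {0}) \<and> M \<subseteq> level r \<omega> n - {0} \<and>
      level r \<omega> n - {0} \<subseteq> period_lattice \<iota> r \<omega> - {0}) sequentially"
    unfolding eventually_sequentially by blast
qed

text \<open>Coordinatewise division with remainder by a: the level of deg a represents the lattice
  modulo its a-multiples. For injectivity, separation makes coefficient vectors unique, and a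
  nonzero multiple of a has degree at least deg a.\<close>

lemma bij_betw_level_division:
  assumes sep: "separated r \<delta> \<omega>" "\<delta> > 0" and a: "a \<noteq> 0"
  shows "bij_betw (\<lambda>(s, \<mu>). s + embA \<iota> a * \<mu>) (level r \<omega> (Polynomial.degree a) \<times> level r \<omega> n)
    (level r \<omega> (n + Polynomial.degree a))"
  unfolding bij_betw_def
proof
  show "inj_on (\<lambda>(s, \<mu>). s + embA \<iota> a * \<mu>) (level r \<omega> (Polynomial.degree a) \<times> level r \<omega> n)"
  proof (rule inj_onI, clarify)
    fix s \<mu> s' \<mu>'
    assume "s \<in> level r \<omega> (Polynomial.degree a)" "\<mu> \<in> level r \<omega> n"
      "s' \<in> level r \<omega> (Polynomial.degree a)" "\<mu>' \<in> level r \<omega> n"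
    then obtain b c b' c' where b: "s = lam r \<omega> b" "\<forall>i. small (Polynomial.degree a) (b i)"
      and b': "s' = lam r \<omega> b'" "\<forall>i. small (Polynomial.degree a) (b' i)"
      and c: "\<mu> = lam r \<omega> c" "\<mu>' = lam r \<omega> c'"
      unfolding level_def by auto
    assume eq: "s + embA \<iota> a * \<mu> = s' + embA \<iota> a * \<mu>'"
    have eq0: "lam r \<omega> (\<lambda>i. (b i - b' i) - a * (c' i - c i)) = 0"
      unfolding lam_diff lam_mult using eq by (simp add: b b' c algebra_simps)
    have z: "b i - b' i = a * (c' i - c i)" if "i \<in> {1..r}" for i
      using lam_eq_0[OF sep eq0 that] by simp
    have "c i = c' i" if i: "i \<in> {1..r}" for i
    proof (rule ccontr)
      assume ne: "c i \<noteq> c' i"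
      then have "a * (c' i - c i) \<noteq> 0" using a by simp
      moreover have "small (Polynomial.degree a) (b i - b' i)" using b b' by (intro small_diff) auto
      moreover have "Polynomial.degree (a * (c' i - c i)) = Polynomial.degree a + Polynomial.degree (c' i - c i)"
        using a ne by (intro degree_mult_eq) auto
      ultimately show False using z[OF i] by auto
    qed
    then have "\<mu> = \<mu>'" unfolding c lam_def by (intro sum.cong) auto
    with eq show "s = s' \<and> \<mu> = \<mu>'" by simp
  qed
  show "(\<lambda>(s, \<mu>). s + embA \<iota> a * \<mu>) ` (level r \<omega> (Polynomial.degree a) \<times> level r \<omega> n) =
      level r \<omega> (n + Polynomial.degree a)"
  proof (intro equalityI subsetI)
    fix x assume "x \<in> (\<lambda>(s, \<mu>). s + embA \<iota> a * \<mu>) ` (level r \<omega> (Polynomial.degree a) \<times> level r \<omega> n)"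
    then obtain b c where x: "x = lam r \<omega> b + embA \<iota> a * lam r \<omega> c"
      and b: "\<forall>i. small (Polynomial.degree a) (b i)" and c: "\<forall>i. small n (c i)"
      unfolding level_def by auto
    have "x = lam r \<omega> (\<lambda>i. b i + a * c i)" by (simp add: x lam_add lam_mult)
    moreover have "small (n + Polynomial.degree a) (b i + a * c i)" for i
    proof (rule small_add)
      show "small (n + Polynomial.degree a) (b i)" using b by (metis trans_less_add2)
      show "small (n + Polynomial.degree a) (a * c i)"
        using c a by (cases "c i = 0") (auto simp: degree_mult_eq)
    qed
    ultimately show "x \<in> level r \<omega> (n + Polynomial.degree a)" unfolding level_def by blast
  next
    fix x assume "x \<in> level r \<omega> (n + Polynomial.degree a)"
    then obtain b where x: "x = lam r \<omega> b" and b: "\<forall>i. small (n + Polynomial.degree a) (b i)"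
      unfolding level_def by auto
    have "x = lam r \<omega> (\<lambda>i. b i mod a) + embA \<iota> a * lam r \<omega> (\<lambda>i. b i div a)"
      by (simp add: x mult.commute flip: lam_add lam_mult)
    moreover have "small (Polynomial.degree a) (b i mod a)" for i
      using degree_mod_less[OF a, of "b i"] by simp
    then have "lam r \<omega> (\<lambda>i. b i mod a) \<in> level r \<omega> (Polynomial.degree a)" unfolding level_def by blast
    moreover have "small n (b i div a)" for i
    proof (cases "b i div a = 0")
      case False
      have "small (n + Polynomial.degree a) (b i mod a)"
        using degree_mod_less[OF a, of "b i"] by auto
      then have "small (n + Polynomial.degree a) (b i - b i mod a)" using b by (intro small_diff) auto
      then have "small (n + Polynomial.degree a) (a * (b i div a))" by (simp only: minus_mod_eq_mult_div)
      then show ?thesis using False a by (auto simp: degree_mult_eq)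
    qed simp
    then have "lam r \<omega> (\<lambda>i. b i div a) \<in> level r \<omega> n" unfolding level_def by blast
    ultimately show "x \<in> (\<lambda>(s, \<mu>). s + embA \<iota> a * \<mu>) ` (level r \<omega> (Polynomial.degree a) \<times> level r \<omega> n)"
      by (intro image_eqI[of _ _ "(lam r \<omega> (\<lambda>i. b i mod a), lam r \<omega> (\<lambda>i. b i div a))"]) auto
  qed
qed

section \<open>Exponential functions of period lattices\<close>

lemma infinite_UNIV_c: "infinite (UNIV :: 'c set)"
proof
  assume "finite (UNIV :: 'c set)"
  then have "finite (range (\<lambda>n. TT ^ n))" by (rule finite_subset[rotated]) simp
  moreover have "inj (\<lambda>n. TT ^ n)"
  proof (rule injI)
    fix m n assume "TT ^ m = TT ^ n"
    then have "absv TT ^ m = absv TT ^ n" by (simp flip: absv_power)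
    then show "m = n" using absv_TT_gt_1 by (simp add: power_inject_exp)
  qed
  ultimately show False using finite_imageD infinite_UNIV_nat by blast
qed

lemma poly_eqI_all:
  assumes "\<And>z::'c. poly p z = poly p' z"
  shows "p = p'"
proof (rule ccontr)
  assume "p \<noteq> p'"
  then have "finite {z. poly (p - p') z = 0}" by (intro poly_roots_finite) simp
  moreover have "{z. poly (p - p') z = 0} = UNIV" using assms by simp
  ultimately show False using infinite_UNIV_c by simp
qed

definition level_exp :: "nat \<Rightarrow> (nat \<Rightarrow> 'c) \<Rightarrow> nat \<Rightarrow> 'c \<Rightarrow> 'c" where
  "level_exp r \<omega> n z = z * (\<Prod>\<mu>\<in>level r \<omega> n - {0}. 1 - z / \<mu>)"

lemma prod_level_eq:
  "(\<Prod>s\<in>level r \<omega> n. z - s) = (\<Prod>\<mu>\<in>level r \<omega> n - {0}. - \<mu>) * level_exp r \<omega> n z"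
proof -
  have "(\<Prod>s\<in>level r \<omega> n. z - s) = z * (\<Prod>s\<in>level r \<omega> n - {0}. z - s)"
    using prod.remove[OF finite_level level_0, of "\<lambda>s. z - s"] by simp
  also have "(\<Prod>s\<in>level r \<omega> n - {0}. z - s) = (\<Prod>\<mu>\<in>level r \<omega> n - {0}. (- \<mu>) * (1 - z / \<mu>))"
    by (intro prod.cong) (auto simp: algebra_simps)
  finally show ?thesis by (simp only: level_exp_def prod.distrib mult_ac)
qed

lemma level_prod_nonzero: "(\<Prod>\<mu>\<in>level r \<omega> n - {0}. - \<mu>) \<noteq> 0"
  using finite_level[of r \<omega> n] by simp

text \<open>Up to a nonzero constant, X times the partial product is \<Prod>(X - s) over the level,
  a q-polynomial; the factor X explains \<open>Suc j\<close>.\<close>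

lemma coeff_prodpoly_level:
  assumes "\<And>i. Suc j \<noteq> CARD('f) ^ i"
  shows "Polynomial.coeff (prodpoly (level r \<omega> n - {0})) j = 0"
proof -
  define \<kappa> where "\<kappa> = (\<Prod>\<mu>\<in>level r \<omega> n - {0}. - \<mu>)"
  have \<kappa>: "\<kappa> \<noteq> 0" unfolding \<kappa>_def by (rule level_prod_nonzero)
  obtain c m where c: "\<And>z. (\<Prod>s\<in>level r \<omega> n. z - s) = (\<Sum>i\<le>m. c i * z ^ (CARD('f) ^ i))"
    using prod_level_q_polynomial[of r \<omega> n] by blast
  have "Polynomial.smult \<kappa> (pCons 0 (prodpoly (level r \<omega> n - {0}))) =
      (\<Sum>i\<le>m. Polynomial.monom (c i) (CARD('f) ^ i))"
  proof (rule poly_eqI_all)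
    fix z
    show "poly (Polynomial.smult \<kappa> (pCons 0 (prodpoly (level r \<omega> n - {0})))) z =
        poly (\<Sum>i\<le>m. Polynomial.monom (c i) (CARD('f) ^ i)) z"
      using c[of z] prod_level_eq[where z = z and r = r and \<omega> = \<omega> and n = n]
      by (simp add: poly_prodpoly poly_sum poly_monom level_exp_def \<kappa>_def mult.left_commute)
  qed
  then have "Polynomial.coeff (Polynomial.smult \<kappa> (pCons 0 (prodpoly (level r \<omega> n - {0})))) (Suc j) =
      Polynomial.coeff (\<Sum>i\<le>m. Polynomial.monom (c i) (CARD('f) ^ i)) (Suc j)" by simp
  also have "\<dots> = 0"
  proof -
    have "Polynomial.coeff (Polynomial.monom (c i) (CARD('f) ^ i)) (Suc j) = 0" for i
      using assms[of i] by (metis coeff_monom)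
    then show ?thesis by (simp only: coeff_sum sum.neutral_const)
  qed
  finally show ?thesis using \<kappa> by simp
qed

lemma level_exp_tendsto:
  assumes "separated r \<delta> \<omega>" "\<delta> > 0"
  shows "(\<lambda>n. level_exp r \<omega> n z) \<longlonglongrightarrow> lattice_exp (period_lattice \<iota> r \<omega>) z"
proof -
  have "((\<lambda>M. \<Prod>\<mu>\<in>M. 1 - z / \<mu>) \<longlongrightarrow> lattice_prod (period_lattice \<iota> r \<omega>) z)
      (finite_subsets_at_top (period_lattice \<iota> r \<omega> - {0}))"
    using lattice_prod_expansion[OF discrete_period_lattice[OF assms]] by (elim exE conjE) (rule spec)
  from filterlim_compose[OF this level_tendsto[OF assms]]
  have "(\<lambda>n. \<Prod>\<mu>\<in>level r \<omega> n - {0}. 1 - z / \<mu>) \<longlonglongrightarrow> lattice_prod (period_lattice \<iota> r \<omega>) z" .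
  from tendsto_cmult_absv[OF this, of z] show ?thesis
    by (simp add: level_exp_def lattice_exp_eq)
qed

lemma lattice_exp_nonzero:
  assumes "separated r \<delta> \<omega>" "\<delta> > 0" "z \<notin> period_lattice \<iota> r \<omega>"
  shows "lattice_exp (period_lattice \<iota> r \<omega>) z \<noteq> 0"
proof -
  have "0 \<in> period_lattice \<iota> r \<omega>"
    unfolding period_lattice_eq by (intro image_eqI[of _ _ "\<lambda>_. 0"]) auto
  then have "z \<noteq> 0" using assms(3) by auto
  moreover have "lattice_prod (period_lattice \<iota> r \<omega>) z \<noteq> 0"
    using assms by (intro lattice_prod_nonzero discrete_period_lattice) auto
  ultimately show ?thesis by (simp add: lattice_exp_eq)
qed

text \<open>The levels are cofinal, so the vanishing criterion leaves only the coefficients at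
  exponents \<open>q^i - 1\<close> of the product. Evaluation of the product at 0 gives the constant
  term 1.\<close>

lemma lattice_exp_series:
  assumes sep: "separated r \<delta> \<omega>" "\<delta> > 0"
  shows "\<exists>\<alpha>. (\<forall>z. (\<lambda>i. \<alpha> i * z ^ (CARD('f) ^ i)) sums lattice_exp (period_lattice \<iota> r \<omega>) z) \<and>
    \<alpha> 0 = 1 \<and> (r \<ge> 1 \<longrightarrow> (\<forall>i. absv (\<alpha> i) * \<delta> ^ (CARD('f) ^ i - 1) \<le> 1))"
proof -
  define \<Lambda> where "\<Lambda> = period_lattice \<iota> r \<omega>"
  have disc: "discrete_set (\<Lambda> - {0})" unfolding \<Lambda>_def by (rule discrete_period_lattice[OF sep])
  from lattice_prod_expansion[OF disc] obtain A where
    lim: "\<forall>z. ((\<lambda>M. \<Prod>\<mu>\<in>M. 1 - z / \<mu>) \<longlongrightarrow> lattice_prod \<Lambda> z) (finite_subsets_at_top (\<Lambda> - {0}))"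
    and sums: "\<forall>z. (\<lambda>j. A j * z ^ j) sums lattice_prod \<Lambda> z"
    and bound: "\<forall>\<delta>>0. (\<forall>\<mu>\<in>\<Lambda> - {0}. \<delta> \<le> absv \<mu>) \<longrightarrow> (\<forall>j. absv (A j) * \<delta> ^ j \<le> 1)"
    and zero: "\<forall>j. (\<forall>B. \<exists>M. finite M \<and> M \<subseteq> \<Lambda> - {0} \<and> {\<mu> \<in> \<Lambda> - {0}. absv \<mu> \<le> B} \<subseteq> M \<and>
       Polynomial.coeff (prodpoly M) j = 0) \<longrightarrow> A j = 0"
    by (elim exE conjE) (rule that)
  have supp: "\<exists>i. Suc j = CARD('f) ^ i" if "A j \<noteq> 0" for j
  proof (rule ccontr)
    assume "\<not> (\<exists>i. Suc j = CARD('f) ^ i)"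
    then have c: "Polynomial.coeff (prodpoly (level r \<omega> n - {0})) j = 0" for n
      by (intro coeff_prodpoly_level) auto
    have "\<exists>M. finite M \<and> M \<subseteq> \<Lambda> - {0} \<and> {\<mu> \<in> \<Lambda> - {0}. absv \<mu> \<le> B} \<subseteq> M \<and>
       Polynomial.coeff (prodpoly M) j = 0" for B
    proof -
      obtain n where n: "{\<mu> \<in> \<Lambda>. absv \<mu> \<le> B} \<subseteq> level r \<omega> n"
        using bounded_subset_level[OF sep] unfolding \<Lambda>_def by blast
      have "level r \<omega> n \<subseteq> \<Lambda>" unfolding \<Lambda>_def by (rule level_subset)
      then show ?thesis
        using n c[of n] finite_level by (intro exI[of _ "level r \<omega> n - {0}"]) auto
    qed
    then have "A j = 0" using zero by blast
    with that show False by simp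
  qed
  define \<alpha> where "\<alpha> i = A (CARD('f) ^ i - 1)" for i
  have 1: "(\<lambda>i. \<alpha> i * z ^ (CARD('f) ^ i)) sums lattice_exp \<Lambda> z" for z
    unfolding \<alpha>_def lattice_exp_eq by (rule sums_q_powers[OF sums[THEN spec] supp])
  have "lattice_prod \<Lambda> 0 = 1"
  proof (rule tendsto_unique_absv[OF lim[THEN spec, of 0]])
    show "((\<lambda>M. \<Prod>\<mu>\<in>M. 1 - 0 / \<mu>) \<longlongrightarrow> 1) (finite_subsets_at_top (\<Lambda> - {0}))" by simp
  qed simp
  moreover have "(\<lambda>j. A j * 0 ^ j) sums (\<Sum>j\<in>{0}. A j * 0 ^ j)"
    by (rule sums_finite) (auto simp: power_0_left)
  ultimately have "A 0 = 1" using sums[THEN spec, of 0] sums_unique2 by fastforce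
  then have 2: "\<alpha> 0 = 1" by (simp add: \<alpha>_def)
  have 3: "absv (\<alpha> i) * \<delta> ^ (CARD('f) ^ i - 1) \<le> 1" if "r \<ge> 1" for i
  proof -
    \<comment> \<open>A nonzero lattice vector has a nonzero coefficient in A, of absolute value at
      least 1.\<close>
    have "\<delta> \<le> absv \<mu>" if \<mu>: "\<mu> \<in> \<Lambda> - {0}" for \<mu>
    proof -
      obtain b where b: "\<mu> = lam r \<omega> b" using \<mu> unfolding \<Lambda>_def period_lattice_eq by auto
      obtain j where j: "j \<in> {1..r}" "b j \<noteq> 0"
      proof (rule ccontr)
        assume "\<not> thesis"
        then have "\<forall>j\<in>{1..r}. b j = 0" using that by blast
        then have "\<mu> = 0" by (simp add: b lam_def)
        with \<mu> show False by simp
      qed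
      have "\<delta> * 1 \<le> \<delta> * absv (embA \<iota> (b j))"
        using sep(2) absv_embA_ge_1[OF j(2)] by (intro mult_left_mono) auto
      also have "\<dots> \<le> absv \<mu>" unfolding b by (rule lam_lower[OF sep(1) j(1)])
      finally show ?thesis by simp
    qed
    then show ?thesis using bound sep(2) unfolding \<alpha>_def by blast
  qed
  show ?thesis
    unfolding \<Lambda>_def[symmetric] using 1 2 3 by blast
qed

text \<open>Uniqueness of q-power series makes the definite description in \<open>alpha\<close>
  denote the series already found; the three clauses are the interface through which
  \<open>alpha\<close> is used.\<close>

lemma alpha_series:
  assumes sep: "separated r \<delta> \<omega>" "\<delta> > 0" and r: "r \<ge> 1"
  shows "(\<lambda>i. alpha \<iota> r i \<omega> * z ^ (CARD('f) ^ i)) sums lattice_exp (period_lattice \<iota> r \<omega>) z"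
    and "alpha \<iota> r 0 \<omega> = 1"
    and "absv (alpha \<iota> r i \<omega>) * \<delta> ^ (CARD('f) ^ i - 1) \<le> 1"
proof -
  obtain \<alpha> where \<alpha>: "\<forall>z. (\<lambda>i. \<alpha> i * z ^ (CARD('f) ^ i)) sums lattice_exp (period_lattice \<iota> r \<omega>) z"
    "\<alpha> 0 = 1" "\<forall>i. absv (\<alpha> i) * \<delta> ^ (CARD('f) ^ i - 1) \<le> 1"
    using lattice_exp_series[OF sep] r by blast
  have "(THE \<alpha> :: nat \<Rightarrow> 'c. \<forall>z.
        (\<lambda>i. \<alpha> i * z ^ (CARD('f) ^ i)) sums lattice_exp (period_lattice \<iota> r \<omega>) z) = \<alpha>"
    using \<alpha>(1) by (intro the_equality) (auto intro: q_series_unique)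
  then have "alpha \<iota> r i \<omega> = \<alpha> i" for i by (simp add: alpha_def)
  with \<alpha> show "(\<lambda>i. alpha \<iota> r i \<omega> * z ^ (CARD('f) ^ i)) sums lattice_exp (period_lattice \<iota> r \<omega>) z"
    "alpha \<iota> r 0 \<omega> = 1" "absv (alpha \<iota> r i \<omega>) * \<delta> ^ (CARD('f) ^ i - 1) \<le> 1" by auto
qed

lemma lattice_exp_add:
  assumes "separated r \<delta> \<omega>" "\<delta> > 0" "r \<ge> 1"
  shows "lattice_exp (period_lattice \<iota> r \<omega>) (x + y) =
    lattice_exp (period_lattice \<iota> r \<omega>) x + lattice_exp (period_lattice \<iota> r \<omega>) y"
proof (rule tendsto_unique_absv[OF alpha_series(1)[OF assms, unfolded sums_def]])
  show "(\<lambda>n. \<Sum>i<n. alpha \<iota> r i \<omega> * (x + y) ^ (CARD('f) ^ i)) \<longlonglongrightarrow>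
    lattice_exp (period_lattice \<iota> r \<omega>) x + lattice_exp (period_lattice \<iota> r \<omega>) y"
    using tendsto_add_absv[OF alpha_series(1)[OF assms, unfolded sums_def, of x]
        alpha_series(1)[OF assms, unfolded sums_def, of y]]
    by (simp add: frob_add distrib_left sum.distrib)
qed simp

lemma con_power_q_power: "con e ^ (CARD('f) ^ i) = con e"
  by (induction i) (simp_all add: power_mult con_power_q)

lemma lattice_exp_con_mult:
  assumes "separated r \<delta> \<omega>" "\<delta> > 0" "r \<ge> 1"
  shows "lattice_exp (period_lattice \<iota> r \<omega>) (con e * x) = con e * lattice_exp (period_lattice \<iota> r \<omega>) x"
proof (rule tendsto_unique_absv[OF alpha_series(1)[OF assms, unfolded sums_def]])
  show "(\<lambda>n. \<Sum>i<n. alpha \<iota> r i \<omega> * (con e * x) ^ (CARD('f) ^ i)) \<longlonglongrightarrow>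
    con e * lattice_exp (period_lattice \<iota> r \<omega>) x"
    using tendsto_cmult_absv[OF alpha_series(1)[OF assms, unfolded sums_def, of x], of "con e"]
    by (simp add: power_mult_distrib con_power_q_power sum_distrib_left mult_ac)
qed simp

lemma prod_level_diff:
  "(\<Prod>s\<in>level r \<omega> n. (x - y) - s) = (\<Prod>s\<in>level r \<omega> n. x - s) - (\<Prod>s\<in>level r \<omega> n. y - s)"
proof -
  obtain c m where c: "\<And>z. (\<Prod>s\<in>level r \<omega> n. z - s) = (\<Sum>i\<le>m. c i * z ^ (CARD('f) ^ i))"
    using prod_level_q_polynomial[of r \<omega> n] by blast
  show ?thesis by (simp add: c frob_diff right_diff_distrib sum_subtractf)
qed

text \<open>The finite functional equation. With P(z) = \<Prod>(z - \<mu>) over level n, the factors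
  belonging to a remainder s \<noteq> 0 multiply to P(s/a - z)/P(s/a), and additivity of P turns
  this into 1 - P(z)/P(s/a); the constant between P and \<open>level_exp\<close> cancels. The
  remainder 0 contributes the product for z itself.\<close>

lemma level_exp_division:
  assumes sep: "separated r \<delta> \<omega>" "\<delta> > 0" and a: "a \<noteq> 0"
  shows "level_exp r \<omega> (n + Polynomial.degree a) (embA \<iota> a * z) = embA \<iota> a * level_exp r \<omega> n z *
    (\<Prod>s\<in>level r \<omega> (Polynomial.degree a) - {0}. 1 - level_exp r \<omega> n z / level_exp r \<omega> n (s / embA \<iota> a))"
proof -
  define A where "A = embA \<iota> a"
  define L where "L = level r \<omega> n"
  define D where "D = level r \<omega> (Polynomial.degree a)"
  define P where "P z = (\<Prod>s\<in>L. z - s)" for z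
  define \<kappa> where "\<kappa> = (\<Prod>\<mu>\<in>L - {0}. - \<mu>)"
  have P: "P z = \<kappa> * level_exp r \<omega> n z" for z
    unfolding P_def \<kappa>_def L_def by (rule prod_level_eq)
  have \<kappa>: "\<kappa> \<noteq> 0" unfolding \<kappa>_def L_def by (rule level_prod_nonzero)
  have A: "A \<noteq> 0" using a by (simp add: A_def)
  have fin: "finite L" "finite D" by (simp_all add: L_def D_def finite_level)
  have bij: "bij_betw (\<lambda>(s, \<mu>). s + A * \<mu>) (D \<times> L) (level r \<omega> (n + Polynomial.degree a))"
    unfolding A_def L_def D_def by (rule bij_betw_level_division[OF sep a])
  \<comment> \<open>Division by 0 yields 0, so the factor at \<mu> = 0 is 1 and products may run
    over a whole F_q-space.\<close>
  have drop0: "(\<Prod>\<mu>\<in>M - {0}. 1 - x / \<mu>) = (\<Prod>\<mu>\<in>M. 1 - x / \<mu>)" if "finite M" for M and x :: 'c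
    using that by (intro prod.mono_neutral_left) auto
  have P_plus: "(\<Prod>\<mu>\<in>L. x + \<mu>) = P x" for x
    unfolding P_def L_def
    by (rule prod.reindex_bij_witness[of _ uminus uminus]) (auto intro: level_minus)
  have inner: "(\<Prod>\<mu>\<in>L. 1 - A * z / (s + A * \<mu>)) = 1 - level_exp r \<omega> n z / level_exp r \<omega> n (s / A)"
    if s: "s \<in> D - {0}" for s
  proof -
    have nz: "s + A * \<mu> \<noteq> 0" if "\<mu> \<in> L" for \<mu>
    proof
      assume "s + A * \<mu> = 0"
      then have "(\<lambda>(s, \<mu>). s + A * \<mu>) (s, \<mu>) = (\<lambda>(s, \<mu>). s + A * \<mu>) (0, 0)" by simp
      moreover have "(s, \<mu>) \<in> D \<times> L" "(0, 0) \<in> D \<times> L"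
        using s that by (auto simp: D_def L_def level_0)
      ultimately have "(s, \<mu>) = (0, 0)" using bij unfolding bij_betw_def inj_on_def by blast
      with s show False by simp
    qed
    have "(\<Prod>\<mu>\<in>L. 1 - A * z / (s + A * \<mu>)) = (\<Prod>\<mu>\<in>L. ((s / A - z) + \<mu>) / (s / A + \<mu>))"
    proof (rule prod.cong[OF refl])
      fix \<mu> assume "\<mu> \<in> L"
      then have nz1: "s + A * \<mu> \<noteq> 0" by (rule nz)
      have eq: "s / A + \<mu> = (s + A * \<mu>) / A" "(s / A - z) + \<mu> = (s + A * \<mu> - A * z) / A"
        using A by (simp_all add: field_simps)
      have "1 - A * z / u = ((u - A * z) / A) / (u / A)" if "u \<noteq> 0" for u
        using A that by (simp add: field_simps)
      then show "1 - A * z / (s + A * \<mu>) = ((s / A - z) + \<mu>) / (s / A + \<mu>)"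
        unfolding eq using nz1 by blast
    qed
    also have "\<dots> = P (s / A - z) / P (s / A)"
      by (simp add: prod_dividef P_plus)
    also have "P (s / A - z) = P (s / A) - P z"
      unfolding P_def L_def by (rule prod_level_diff)
    finally have eq: "(\<Prod>\<mu>\<in>L. 1 - A * z / (s + A * \<mu>)) = (P (s / A) - P z) / P (s / A)" .
    have "P (s / A) \<noteq> 0"
    proof -
      have "s / A + \<mu> \<noteq> 0" if "\<mu> \<in> L" for \<mu>
        using nz[OF that] A by (simp add: field_simps)
      then have "(\<Prod>\<mu>\<in>L. s / A + \<mu>) \<noteq> 0" using fin by simp
      then show ?thesis by (simp add: P_plus)
    qed
    then show ?thesis using \<kappa> unfolding eq by (simp add: P diff_divide_distrib)
  qed
  have "level_exp r \<omega> (n + Polynomial.degree a) (A * z) =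
      A * z * (\<Prod>x\<in>level r \<omega> (n + Polynomial.degree a). 1 - A * z / x)"
    by (simp add: level_exp_def drop0 finite_level)
  also have "(\<Prod>x\<in>level r \<omega> (n + Polynomial.degree a). 1 - A * z / x) =
      (\<Prod>s\<in>D. \<Prod>\<mu>\<in>L. 1 - A * z / (s + A * \<mu>))"
    using prod.reindex_bij_betw[OF bij, of "\<lambda>x. 1 - A * z / x"]
    by (simp add: case_prod_unfold prod.cartesian_product)
  also have "\<dots> = (\<Prod>\<mu>\<in>L. 1 - A * z / (0 + A * \<mu>)) * (\<Prod>s\<in>D - {0}. \<Prod>\<mu>\<in>L. 1 - A * z / (s + A * \<mu>))"
    by (rule prod.remove) (simp_all add: D_def level_0 finite_level)
  also have "(\<Prod>\<mu>\<in>L. 1 - A * z / (0 + A * \<mu>)) = (\<Prod>\<mu>\<in>L - {0}. 1 - z / \<mu>)"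
    using A by (simp add: drop0 fin)
  also have "(\<Prod>s\<in>D - {0}. \<Prod>\<mu>\<in>L. 1 - A * z / (s + A * \<mu>)) =
      (\<Prod>s\<in>D - {0}. 1 - level_exp r \<omega> n z / level_exp r \<omega> n (s / A))"
    by (rule prod.cong[OF refl]) (rule inner)
  finally show ?thesis
    by (simp add: level_exp_def A_def D_def L_def mult.assoc)
qed

text \<open>A nonzero remainder is no a-multiple of a lattice vector, by degrees. This keeps the
  denominators in the division formula away from the zeros of the exponential.\<close>

lemma quotient_not_in_lattice:
  assumes sep: "separated r \<delta> \<omega>" "\<delta> > 0" and a: "a \<noteq> 0"
    and s: "s \<in> level r \<omega> (Polynomial.degree a)" "s \<noteq> 0"
  shows "s / embA \<iota> a \<notin> period_lattice \<iota> r \<omega>"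
proof
  assume "s / embA \<iota> a \<in> period_lattice \<iota> r \<omega>"
  then obtain c where c: "s / embA \<iota> a = lam r \<omega> c" unfolding period_lattice_eq by auto
  obtain b where b: "s = lam r \<omega> b" "\<forall>i. small (Polynomial.degree a) (b i)"
    using s(1) unfolding level_def by auto
  have "s = embA \<iota> a * lam r \<omega> c" using c a by (simp add: field_simps)
  then have eq0: "lam r \<omega> (\<lambda>i. b i - a * c i) = 0" unfolding lam_diff lam_mult by (simp add: b)
  have "b i = 0" if "i \<in> {1..r}" for i
  proof (rule ccontr)
    assume "b i \<noteq> 0"
    moreover have eq: "b i = a * c i" using lam_eq_0[OF sep eq0 that] by simp
    ultimately have "Polynomial.degree (b i) = Polynomial.degree a + Polynomial.degree (c i)"
      using a by (simp add: degree_mult_eq)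
    then show False using b(2) \<open>b i \<noteq> 0\<close> by (metis not_add_less1)
  qed
  then have "s = 0" by (simp add: b(1) lam_def)
  with s(2) show False by simp
qed

text \<open>The set of remainders does not depend on n, so the finite identity passes to the limit
  factor by factor.\<close>

lemma lattice_exp_division:
  assumes sep: "separated r \<delta> \<omega>" "\<delta> > 0" and a: "a \<noteq> 0"
  defines "E \<equiv> lattice_exp (period_lattice \<iota> r \<omega>)"
  shows "E (embA \<iota> a * z) = embA \<iota> a * E z *
    (\<Prod>s\<in>level r \<omega> (Polynomial.degree a) - {0}. 1 - E z / E (s / embA \<iota> a))"
proof (rule tendsto_unique_absv)
  have lim: "(\<lambda>n. level_exp r \<omega> n z) \<longlonglongrightarrow> E z" for z
    unfolding E_def by (rule level_exp_tendsto[OF sep])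
  show "(\<lambda>n. level_exp r \<omega> (n + Polynomial.degree a) (embA \<iota> a * z)) \<longlonglongrightarrow> E (embA \<iota> a * z)"
    using lim by (rule LIMSEQ_ignore_initial_segment)
  have "E (s / embA \<iota> a) \<noteq> 0" if "s \<in> level r \<omega> (Polynomial.degree a) - {0}" for s
    unfolding E_def using that quotient_not_in_lattice[OF sep a] by (intro lattice_exp_nonzero[OF sep]) auto
  then show "(\<lambda>n. level_exp r \<omega> (n + Polynomial.degree a) (embA \<iota> a * z)) \<longlonglongrightarrow> embA \<iota> a * E z *
    (\<Prod>s\<in>level r \<omega> (Polynomial.degree a) - {0}. 1 - E z / E (s / embA \<iota> a))"
    unfolding level_exp_division[OF sep a]
    by (intro tendsto_mult_absv tendsto_prod_absv tendsto_diff_absv tendsto_divide_absv tendsto_const lim) auto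
qed simp

text \<open>The values \<open>g s\<close> of the exponential at s/a are the a-torsion of the
  Drinfeld module. As g is additive, F_q-linear and nonzero on nonzero remainders, they form a space
  with at most \<open>r * degree a\<close> generators, and \<open>E (A * z)\<close> is a constant
  times the product of the \<open>E z - g s\<close>, a q-polynomial in \<open>E z\<close>.\<close>

lemma ell_exists:
  assumes sep: "separated r \<delta> \<omega>" "\<delta> > 0" and a: "a \<noteq> 0" and r: "r \<ge> 1"
  defines "E \<equiv> lattice_exp (period_lattice \<iota> r \<omega>)"
  shows "\<exists>l. (\<forall>i>r * Polynomial.degree a. l i = 0) \<and>
    (\<forall>z. E (embA \<iota> a * z) = (\<Sum>i\<le>r * Polynomial.degree a. l i * E z ^ (CARD('f) ^ i)))"
proof -
  define A where "A = embA \<iota> a"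
  define D where "D = level r \<omega> (Polynomial.degree a)"
  define G where "G = level_gens r \<omega> (Polynomial.degree a)"
  define g where "g s = E (s / A)" for s
  have A: "A \<noteq> 0" using a by (simp add: A_def)
  interpret Fq: vector_space "\<lambda>(c::'f) (x::'c). con c * x" by (rule Fq_vector_space)
  have g_add: "g (x + y) = g x + g y" for x y
    unfolding g_def E_def add_divide_distrib by (rule lattice_exp_add[OF sep r])
  have g_con: "g (con e * x) = con e * g x" for e x
    unfolding g_def E_def times_divide_eq_right[symmetric] by (rule lattice_exp_con_mult[OF sep r])
  have g_nz: "g s \<noteq> 0" if "s \<in> D" "s \<noteq> 0" for s
    unfolding g_def E_def A_def
    using that quotient_not_in_lattice[OF sep a] by (intro lattice_exp_nonzero[OF sep]) (auto simp: D_def)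
  have hom: "module_hom (\<lambda>(c::'f) (x::'c). con c * x) (\<lambda>(c::'f) (x::'c). con c * x) g"
    unfolding module_hom_iff using Fq.module_axioms g_add g_con by blast
  have img: "Fq_span (g ` G) = g ` D"
    unfolding D_def level_eq_span G_def Fq_span_def by (rule module_hom.span_image[OF hom])
  have inj: "inj_on g D"
  proof (rule inj_onI)
    fix x y assume xy: "x \<in> D" "y \<in> D" "g x = g y"
    have "g ((x - y) + y) = g (x - y) + g y" by (rule g_add)
    then have "g (x - y) = 0" using xy by simp
    moreover have "x - y \<in> D"
      using xy(1,2) unfolding D_def level_eq_span Fq_span_def by (rule Fq.span_diff)
    ultimately show "x = y" using g_nz by fastforce
  qed
  have finD: "finite D" by (simp add: D_def finite_level)
  have D0: "0 \<in> D" by (simp add: D_def level_0)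
  have g0: "g 0 = 0" using g_con[of 0 0] by simp
  obtain c where c: "\<And>z. (\<Prod>s\<in>Fq_span (g ` G). z - s) = (\<Sum>i\<le>card (g ` G). c i * z ^ (CARD('f) ^ i))"
    using prod_span_q_polynomial[of "g ` G"] finite_level_gens unfolding G_def by blast
  have card: "card (g ` G) \<le> r * Polynomial.degree a"
    using card_image_le[of G g] finite_level_gens card_level_gens unfolding G_def by (meson order_trans)
  \<comment> \<open>\<open>K\<close> clears the denominators in
    \<open>1 - X / g s = - inverse (g s) * (X - g s)\<close>; the separate factor \<open>E z\<close>
    supplies the root \<open>g 0 = 0\<close>.\<close>
  define K where "K = A * (\<Prod>s\<in>D - {0}. - inverse (g s))"
  have "E (A * z) = K * (\<Prod>s\<in>D. E z - g s)" for z
  proof -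
    have "E (A * z) = A * E z * (\<Prod>s\<in>D - {0}. 1 - E z / g s)"
      unfolding A_def D_def g_def E_def by (rule lattice_exp_division[OF sep a])
    also have "(\<Prod>s\<in>D - {0}. 1 - E z / g s) = (\<Prod>s\<in>D - {0}. - inverse (g s) * (E z - g s))"
      using g_nz by (intro prod.cong) (auto simp: field_simps)
    also have "\<dots> = (\<Prod>s\<in>D - {0}. - inverse (g s)) * (\<Prod>s\<in>D - {0}. E z - g s)"
      by (rule prod.distrib)
    also have "A * E z * \<dots> = K * ((E z - g 0) * (\<Prod>s\<in>D - {0}. E z - g s))"
      unfolding K_def g0 by (simp only: mult_ac diff_zero)
    also have "(E z - g 0) * (\<Prod>s\<in>D - {0}. E z - g s) = (\<Prod>s\<in>D. E z - g s)"
      using prod.remove[OF finD D0, of "\<lambda>s. E z - g s"] by simp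
    finally show ?thesis .
  qed
  also have "(\<Prod>s\<in>D. E z - g s) = (\<Sum>i\<le>card (g ` G). c i * E z ^ (CARD('f) ^ i))" for z
    using c[of "E z"] unfolding img by (simp add: prod.reindex[OF inj])
  finally have eq: "E (A * z) = K * (\<Sum>i\<le>card (g ` G). c i * E z ^ (CARD('f) ^ i))" for z .
  define l where "l i = (if i \<le> card (g ` G) then K * c i else 0)" for i
  have "E (A * z) = (\<Sum>i\<le>r * Polynomial.degree a. l i * E z ^ (CARD('f) ^ i))" for z
  proof -
    have "(\<Sum>i\<le>r * Polynomial.degree a. l i * E z ^ (CARD('f) ^ i)) =
        (\<Sum>i\<le>card (g ` G). l i * E z ^ (CARD('f) ^ i))"
      using card by (intro sum.mono_neutral_right) (auto simp: l_def)
    then show ?thesis by (simp add: eq l_def sum_distrib_left mult.assoc)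
  qed
  moreover have "l i = 0" if "i > r * Polynomial.degree a" for i using that card by (simp add: l_def)
  ultimately show ?thesis unfolding A_def by blast
qed

text \<open>Raising a q-power series to the power \<open>q^k\<close> acts on each term and shifts
  the index by k; both sides become q-power series, whose coefficients are unique.\<close>

lemma functional_equation_coeff:
  assumes sums: "\<And>z. (\<lambda>i. \<alpha> i * z ^ (CARD('f) ^ i)) sums (E z :: 'c)"
    and l0: "\<And>i. i > D \<Longrightarrow> l i = 0"
    and eq: "\<And>z. E (A * z) = (\<Sum>i\<le>D. l i * E z ^ (CARD('f) ^ i))"
  shows "\<alpha> m * A ^ (CARD('f) ^ m) = (\<Sum>k\<le>m. l k * \<alpha> (m - k) ^ (CARD('f) ^ k))"
proof -
  have shift: "(\<lambda>m. if m < k then 0 else \<alpha> (m - k) ^ (CARD('f) ^ k) * z ^ (CARD('f) ^ m)) sums (E z ^ (CARD('f) ^ k))"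
    for k z
  proof -
    define f where "f m = (if m < k then 0 else \<alpha> (m - k) ^ (CARD('f) ^ k) * z ^ (CARD('f) ^ m))" for m
    have "(\<Sum>m<n + k. f m) = (\<Sum>i<n. \<alpha> i * z ^ (CARD('f) ^ i)) ^ (CARD('f) ^ k)" for n
    proof -
      have "(\<Sum>m<n + k. f m) = (\<Sum>i<n. \<alpha> i ^ (CARD('f) ^ k) * z ^ (CARD('f) ^ (i + k)))"
        by (induction n) (simp_all add: f_def)
      also have "\<dots> = (\<Sum>i<n. (\<alpha> i * z ^ (CARD('f) ^ i)) ^ (CARD('f) ^ k))"
        by (simp add: power_mult_distrib power_add power_mult)
      finally show ?thesis by (simp add: frob_sum)
    qed
    then have "(\<lambda>n. \<Sum>m<n + k. f m) \<longlonglongrightarrow> E z ^ (CARD('f) ^ k)"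
      using tendsto_power_absv[OF sums[unfolded sums_def]] by simp
    then have "(\<lambda>n. \<Sum>m<n. f m) \<longlonglongrightarrow> E z ^ (CARD('f) ^ k)" by (rule LIMSEQ_offset)
    then show ?thesis by (simp add: sums_def f_def)
  qed
  \<comment> \<open>Terms with k > m are kept with value 0 so that the sums over k and m can be
    exchanged. The range D is afterwards traded for m, as \<open>l\<close> vanishes beyond
    D.\<close>
  define R where "R m = (\<Sum>k\<le>D. l k * (if m < k then 0 else \<alpha> (m - k) ^ (CARD('f) ^ k)))" for m
  have "(\<lambda>m. R m * z ^ (CARD('f) ^ m)) sums E (A * z)" for z
  proof -
    have "(\<lambda>n. \<Sum>k\<le>D. l k * (\<Sum>m<n. if m < k then 0 else \<alpha> (m - k) ^ (CARD('f) ^ k) * z ^ (CARD('f) ^ m)))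
        \<longlonglongrightarrow> (\<Sum>k\<le>D. l k * E z ^ (CARD('f) ^ k))"
      by (intro tendsto_sum_absv tendsto_cmult_absv shift[unfolded sums_def])
    moreover have "(\<Sum>k\<le>D. l k * (\<Sum>m<n. if m < k then 0 else \<alpha> (m - k) ^ (CARD('f) ^ k) * z ^ (CARD('f) ^ m))) =
        (\<Sum>m<n. R m * z ^ (CARD('f) ^ m))" for n
      unfolding R_def sum_distrib_left sum_distrib_right
      by (subst sum.swap) (intro sum.cong refl, auto)
    ultimately show ?thesis unfolding sums_def eq by simp
  qed
  moreover have "(\<lambda>m. (\<alpha> m * A ^ (CARD('f) ^ m)) * z ^ (CARD('f) ^ m)) sums E (A * z)" for z
    using sums[of "A * z"] by (simp add: power_mult_distrib mult.assoc)
  ultimately have "R = (\<lambda>m. \<alpha> m * A ^ (CARD('f) ^ m))" by (intro q_series_unique)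
  then have "\<alpha> m * A ^ (CARD('f) ^ m) = R m" by simp
  also have "R m = (\<Sum>k\<le>max D m. l k * (if m < k then 0 else \<alpha> (m - k) ^ (CARD('f) ^ k)))"
    unfolding R_def using l0 by (intro sum.mono_neutral_left) auto
  also have "\<dots> = (\<Sum>k\<le>m. l k * (if m < k then 0 else \<alpha> (m - k) ^ (CARD('f) ^ k)))"
    by (intro sum.mono_neutral_right) auto
  also have "\<dots> = (\<Sum>k\<le>m. l k * \<alpha> (m - k) ^ (CARD('f) ^ k))" by (intro sum.cong) auto
  finally show ?thesis .
qed

text \<open>Since \<open>alpha \<iota> r 0 \<omega> = 1\<close>, the recursion determines each
  coefficient from the earlier ones; this uniqueness is what makes the definite description in
  \<open>ell\<close> meaningful.\<close>

lemma ell_recursion: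
  assumes sep: "separated r \<delta> \<omega>" "\<delta> > 0" and a: "a \<noteq> 0" and r: "r \<ge> 1"
  shows "alpha \<iota> r m \<omega> * embA \<iota> a ^ (CARD('f) ^ m) =
    (\<Sum>k\<le>m. ell \<iota> r a k \<omega> * alpha \<iota> r (m - k) \<omega> ^ (CARD('f) ^ k))"
proof -
  define E where "E = lattice_exp (period_lattice \<iota> r \<omega>)"
  define D where "D = r * Polynomial.degree a"
  define Q where "Q l \<longleftrightarrow> (\<forall>i > D. l i = 0) \<and>
        (\<forall>z. E (embA \<iota> a * z) = (\<Sum>i\<le>D. l i * E z ^ (CARD('f) ^ i)))" for l
  obtain l where l: "Q l"
    using ell_exists[OF sep a r] unfolding Q_def E_def D_def by blast
  have rec: "alpha \<iota> r m \<omega> * embA \<iota> a ^ (CARD('f) ^ m) =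
      (\<Sum>k\<le>m. l k * alpha \<iota> r (m - k) \<omega> ^ (CARD('f) ^ k))" if "Q l" for l m
  proof (rule functional_equation_coeff)
    show "(\<lambda>i. alpha \<iota> r i \<omega> * z ^ (CARD('f) ^ i)) sums E z" for z
      unfolding E_def by (rule alpha_series(1)[OF sep r])
  qed (use that in \<open>auto simp: Q_def\<close>)
  have a0: "alpha \<iota> r 0 \<omega> = 1" by (rule alpha_series(2)[OF sep r])
  have "l' = l" if l': "Q l'" for l'
  proof
    fix m show "l' m = l m"
    proof (induction m rule: less_induct)
      case (less m)
      have "(\<Sum>k<m. l' k * alpha \<iota> r (m - k) \<omega> ^ (CARD('f) ^ k)) =
          (\<Sum>k<m. l k * alpha \<iota> r (m - k) \<omega> ^ (CARD('f) ^ k))"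
        using less by (intro sum.cong) auto
      with rec[OF l', of m] rec[OF l, of m] show ?case
        by (simp add: a0 flip: lessThan_Suc_atMost)
    qed
  qed
  with l have "(THE l. Q l) = l" by (intro the_equality)
  then have "ell \<iota> r a k \<omega> = l k" for k
    unfolding ell_def Q_def E_def D_def by simp
  with rec[OF l] show ?thesis by simp
qed

end

section \<open>The coefficients of the Carlitz module\<close>

text \<open>Frobenius raises the monomials separately and so multiplies all exponents by q.\<close>

lemma coeff_power_card:
  fixes p :: "'a::comm_ring_1 poly"
  assumes "CHAR('a) = CHAR('f::finite_field)"
  shows "Polynomial.coeff (p ^ CARD('f)) n =
    (if CARD('f) dvd n then Polynomial.coeff p (n div CARD('f)) ^ CARD('f) else 0)"
proof -
  let ?q = "CARD('f)"
  have q: "?q > 0" using card_finite_field_ge_2[where 'f = 'f] by simp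
  have char: "CHAR('a poly) = CHAR('f)" using assms by simp
  have "p ^ ?q = (\<Sum>i\<le>Polynomial.degree p. Polynomial.monom (Polynomial.coeff p i) i) ^ (?q ^ 1)"
    by (simp only: poly_as_sum_of_monoms power_one_right)
  also have "\<dots> = (\<Sum>i\<le>Polynomial.degree p. Polynomial.monom (Polynomial.coeff p i) i ^ (?q ^ 1))"
    by (rule power_card_power_sum[OF char])
  also have "\<dots> = (\<Sum>i\<le>Polynomial.degree p. Polynomial.monom (Polynomial.coeff p i ^ ?q) (i * ?q))"
    by (simp add: monom_power)
  finally have eq: "Polynomial.coeff (p ^ ?q) n =
      (\<Sum>i\<le>Polynomial.degree p. if i * ?q = n then Polynomial.coeff p i ^ ?q else 0)"
    by (simp add: coeff_sum)
  show ?thesis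
  proof (cases "?q dvd n")
    case True
    then obtain m where m: "n = m * ?q" by (metis dvd_def mult.commute)
    have "(i * ?q = n) = (i = m)" for i using q by (simp add: m)
    then have "Polynomial.coeff (p ^ ?q) n = (\<Sum>i\<le>Polynomial.degree p. if i = m then Polynomial.coeff p i ^ ?q else 0)"
      by (simp only: eq)
    also have "\<dots> = Polynomial.coeff p m ^ ?q"
      using q by (auto simp: coeff_eq_0 power_0_left)
    finally show ?thesis using q by (simp add: m)
  next
    case False
    then have "i * ?q \<noteq> n" for i by auto
    with False show ?thesis by (simp add: eq)
  qed
qed

definition carlitz_iter :: "nat \<Rightarrow> 'f::finite_field poly poly" where
  "carlitz_iter i = (pcompose carlitz_T ^^ i) [:0, 1:]"

lemma carlitz_iter_Suc:
  "carlitz_iter (Suc i) = Polynomial.smult [:0, 1:] (carlitz_iter i) + (carlitz_iter i :: 'f::finite_field poly poly) ^ CARD('f)"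
proof -
  have power: "pcompose (p ^ n) r = pcompose p r ^ n" for p r :: "'f poly poly" and n
    by (induction n) (simp_all add: pcompose_1 pcompose_mult)
  show ?thesis
    by (simp add: carlitz_iter_def carlitz_T_def pcompose_add pcompose_pCons monom_altdef power)
qed

text \<open>The coefficient of the k-th power of Frobenius in the operator that the Carlitz module
  assigns to \<open>T^i\<close>.\<close>

abbreviation carlitz_tau :: "nat \<Rightarrow> nat \<Rightarrow> 'f::finite_field poly" where
  "carlitz_tau i k \<equiv> Polynomial.coeff (carlitz_iter i) (CARD('f) ^ k)"

lemma carlitz_tau_Suc_0:
  "(carlitz_tau (Suc i) 0 :: 'f::finite_field poly) = [:0, 1:] * carlitz_tau i 0"
  using card_finite_field_ge_2[where 'f = 'f]
  by (simp add: carlitz_iter_Suc coeff_power_card[where 'f = 'f])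

lemma carlitz_tau_Suc_Suc:
  "(carlitz_tau (Suc i) (Suc k) :: 'f::finite_field poly) =
    [:0, 1:] * carlitz_tau i (Suc k) + carlitz_tau i k ^ CARD('f)"
  using card_finite_field_ge_2[where 'f = 'f]
  by (simp add: carlitz_iter_Suc coeff_power_card[where 'f = 'f])

lemma carlitz_tau_0: "(carlitz_tau i 0 :: 'f::finite_field poly) = Polynomial.monom 1 i"
proof (induction i)
  case 0
  then show ?case by (simp add: carlitz_iter_def one_pCons monom_0)
next
  case (Suc i)
  then show ?case by (simp only: carlitz_tau_Suc_0) (simp add: monom_Suc)
qed

lemma power_card_diff_poly:
  "((x :: 'f::finite_field poly) - y) ^ CARD('f) = x ^ CARD('f) - y ^ CARD('f)"
proof -
  have "CHAR('f poly) = CHAR('f)" by simp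
  from power_card_add[OF this, of "x - y" y] show ?thesis by simp
qed

text \<open>The commutation \<open>\<rho>\<^sub>a \<circ> \<rho>\<^sub>T = \<rho>\<^sub>T \<circ> \<rho>\<^sub>a\<close>, read off on coefficients, for \<open>a = T\<^sup>i\<close>.\<close>

lemma bracket_carlitz_tau:
  "bracket (Suc k) * carlitz_tau i (Suc k) = (carlitz_tau i k :: 'f::finite_field poly) ^ CARD('f) - carlitz_tau i k"
proof (induction i arbitrary: k)
  case 0
  have z: "(carlitz_tau 0 (Suc k) :: 'f poly) = 0" for k
  proof -
    have "CARD('f) ^ Suc k \<noteq> 1" using card_finite_field_ge_2[where 'f = 'f] by simp
    moreover have "CARD('f) ^ Suc k \<noteq> 0" using card_finite_field_ge_2[where 'f = 'f] by simp
    ultimately show ?thesis by (simp add: carlitz_iter_def coeff_pCons split: nat.splits)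
  qed
  have one: "(carlitz_tau 0 0 :: 'f poly) = 1" by (simp add: carlitz_iter_def)
  show ?case
    using card_finite_field_ge_2[where 'f = 'f] by (cases k) (simp_all only: z one, simp_all add: power_0_left)
next
  case (Suc i)
  define tt :: "'f poly" where "tt = [:0, 1:]"
  define t where "t k = (carlitz_tau i k :: 'f poly)" for k
  have br: "bracket k = tt ^ (CARD('f) ^ k) - tt" for k
    by (simp add: bracket_def tt_def monom_altdef)
  have IH: "(tt ^ (CARD('f) ^ Suc k) - tt) * t (Suc k) = t k ^ CARD('f) - t k" for k
    using Suc.IH[of k] by (simp only: t_def br)
  have add: "(x + y) ^ CARD('f) = x ^ CARD('f) + y ^ CARD('f)" for x y :: "'f poly"
    by (rule power_card_add) simp
  \<comment> \<open>The recursion in i for index \<open>Suc k\<close> involves index k, which itself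
    has a recursion with a Frobenius term only when k > 0.\<close>
  show ?case
  proof (cases k)
    case 0
    have "(tt ^ (CARD('f) ^ Suc 0) - tt) * (tt * t (Suc 0) + t 0 ^ CARD('f)) =
        tt * ((tt ^ (CARD('f) ^ Suc 0) - tt) * t (Suc 0)) + (tt ^ CARD('f) - tt) * t 0 ^ CARD('f)"
      by (simp add: algebra_simps)
    also have "\<dots> = (tt * t 0) ^ CARD('f) - tt * t 0"
      unfolding IH by (simp add: algebra_simps power_mult_distrib)
    finally show ?thesis
      unfolding 0 carlitz_tau_Suc_Suc carlitz_tau_Suc_0 br
      unfolding t_def tt_def .
  next
    case (Suc j)
    \<comment> \<open>In bracket notation: \<open>[j+1]^q = [j+2] - [1]\<close>. This rewrites the
      factor \<open>[j+2]\<close> in front of the Frobenius term so that the induction hypothesis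
      for j, raised to the q-th power, applies.\<close>
    have pw: "(tt ^ (CARD('f) ^ Suc j) - tt) ^ CARD('f) = tt ^ (CARD('f) ^ Suc (Suc j)) - tt ^ CARD('f)"
      by (simp add: power_card_diff_poly mult.commute flip: power_mult)
    have "(tt ^ (CARD('f) ^ Suc (Suc j)) - tt) * (tt * t (Suc (Suc j)) + t (Suc j) ^ CARD('f)) =
        tt * ((tt ^ (CARD('f) ^ Suc (Suc j)) - tt) * t (Suc (Suc j))) +
        (tt ^ (CARD('f) ^ Suc (Suc j)) - tt) * t (Suc j) ^ CARD('f)"
      by (simp only: distrib_left mult_ac)
    also have "\<dots> = tt * (t (Suc j) ^ CARD('f) - t (Suc j)) +
        (((tt ^ (CARD('f) ^ Suc j) - tt) ^ CARD('f) + tt ^ CARD('f)) - tt) * t (Suc j) ^ CARD('f)"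
      unfolding IH pw by simp
    also have "\<dots> = ((tt ^ (CARD('f) ^ Suc j) - tt) * t (Suc j)) ^ CARD('f) + (tt * t (Suc j)) ^ CARD('f) - tt * t (Suc j)"
      by (simp only: power_mult_distrib) (simp add: algebra_simps)
    also have "\<dots> = (t j ^ CARD('f)) ^ CARD('f) - t j ^ CARD('f) + (tt * t (Suc j)) ^ CARD('f) - tt * t (Suc j)"
      unfolding IH power_card_diff_poly ..
    also have "\<dots> = (tt * t (Suc j) + t j ^ CARD('f)) ^ CARD('f) - (tt * t (Suc j) + t j ^ CARD('f))"
      by (simp only: add) (simp add: algebra_simps)
    finally show ?thesis
      unfolding Suc carlitz_tau_Suc_Suc br
      unfolding t_def tt_def .
  qed
qed

lemma carlitz_coeff_eq:
  "carlitz_coeff a k = (\<Sum>i\<le>Polynomial.degree a. [:Polynomial.coeff a i:] * (carlitz_tau i k :: 'f::finite_field poly))"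
  by (simp add: carlitz_coeff_def carlitz_def carlitz_iter_def coeff_sum)

lemma carlitz_coeff_0: "carlitz_coeff a 0 = (a :: 'f::finite_field poly)"
proof -
  have "carlitz_coeff a 0 = (\<Sum>i\<le>Polynomial.degree a. Polynomial.monom (Polynomial.coeff a i) i)"
    unfolding carlitz_coeff_eq carlitz_tau_0 by (simp add: smult_monom)
  then show ?thesis by (simp add: poly_as_sum_of_monoms)
qed

text \<open>Constants satisfy \<open>c^q = c\<close>, so the relation is F_q-linear in a and extends
  from the powers of T.\<close>

lemma bracket_carlitz_coeff:
  "bracket (Suc k) * carlitz_coeff a (Suc k) = carlitz_coeff (a :: 'f::finite_field poly) k ^ CARD('f) - carlitz_coeff a k"
proof -
  have char: "CHAR('f poly) = CHAR('f)" by simp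
  have "bracket (Suc k) * carlitz_coeff a (Suc k) =
      (\<Sum>i\<le>Polynomial.degree a. [:Polynomial.coeff a i:] * (bracket (Suc k) * carlitz_tau i (Suc k)))"
    unfolding carlitz_coeff_eq sum_distrib_left by (intro sum.cong refl) (simp only: mult_ac)
  also have "\<dots> = (\<Sum>i\<le>Polynomial.degree a. ([:Polynomial.coeff a i:] * carlitz_tau i k) ^ CARD('f) -
      [:Polynomial.coeff a i:] * carlitz_tau i k)"
    unfolding bracket_carlitz_tau power_mult_distrib poly_const_pow finite_field_power_card_eq_same right_diff_distrib ..
  also have "\<dots> = carlitz_coeff a k ^ (CARD('f) ^ 1) - carlitz_coeff a k"
    unfolding carlitz_coeff_eq power_card_power_sum[OF char] sum_subtractf by simp
  finally show ?thesis by simp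
qed

lemma carlitz_D_0: "carlitz_D 0 = 1"
  by (simp add: carlitz_D_def)

lemma carlitz_D_Suc: "(carlitz_D (Suc k) :: 'f::finite_field poly) = bracket (Suc k) * carlitz_D k ^ CARD('f)"
proof -
  have "carlitz_D k ^ CARD('f) = (\<Prod>i=1..k. (bracket i :: 'f poly) ^ (CARD('f) ^ (Suc k - i)))"
    unfolding carlitz_D_def prod_power_distrib
    by (intro prod.cong refl) (simp add: Suc_diff_le mult.commute flip: power_mult)
  then show ?thesis by (simp add: carlitz_D_def mult.commute)
qed

context C_infinity
begin

lemma embA_bracket_nonzero: "embA \<iota> (bracket (Suc k)) \<noteq> 0"
proof -
  have "bracket (Suc k) \<noteq> (0 :: 'f poly)"
  proof
    assume "bracket (Suc k) = (0 :: 'f poly)"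
    then have "Polynomial.degree (Polynomial.monom 1 (CARD('f) ^ Suc k) :: 'f poly) = Polynomial.degree (Polynomial.monom 1 1 :: 'f poly)"
      by (simp add: bracket_def)
    then have "CARD('f) ^ Suc k = 1" by (simp add: degree_monom_eq)
    then show False using q_ge_2 by simp
  qed
  then show ?thesis by simp
qed

lemma embA_carlitz_D_nonzero: "embA \<iota> (carlitz_D k) \<noteq> 0"
  by (induction k)
    (simp_all only: carlitz_D_0 carlitz_D_Suc embA_mult embA_power embA_1 one_neq_zero mult_eq_0_iff power_eq_0_iff embA_bracket_nonzero simp_thms not_False_eq_True)

section \<open>Uniform convergence\<close>

text \<open>The exponents \<open>q^k\<close> and \<open>q^m\<close> differ by at least 1 and a has
  absolute value at least 1. This gap is the source of every error term 1/|a|.\<close>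

lemma absv_ratio_le:
  assumes "a \<noteq> 0" "k < m"
  shows "absv (embA \<iota> a ^ (CARD('f) ^ k) / embA \<iota> a ^ (CARD('f) ^ m)) \<le> 1 / absv (embA \<iota> a)"
proof -
  have A: "absv (embA \<iota> a) \<ge> 1" using assms(1) by (rule absv_embA_ge_1)
  have "CARD('f) ^ k < CARD('f) ^ m" using assms(2) q_ge_2 by (intro power_strict_increasing) auto
  then have "absv (embA \<iota> a) ^ Suc (CARD('f) ^ k) \<le> absv (embA \<iota> a) ^ (CARD('f) ^ m)"
    using A by (intro power_increasing) auto
  then have "absv (embA \<iota> a) ^ (CARD('f) ^ k) * absv (embA \<iota> a) \<le> absv (embA \<iota> a) ^ (CARD('f) ^ m)"
    by (simp add: mult.commute)
  moreover have pos: "absv (embA \<iota> a) > 0" using A by linarith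
  moreover have "absv (embA \<iota> a) ^ (CARD('f) ^ m) > 0" using pos by (rule zero_less_power)
  ultimately show ?thesis by (simp add: absv_divide absv_power divide_simps mult.commute)
qed

text \<open>For \<open>u = c_k / a^(q^k)\<close> the recursion expresses the next quotient as
  \<open>u^q\<close> minus u times a ratio of size at most 1/|a|, divided by \<open>[k+1]\<close>.
  Frobenius gives \<open>u^q - d^q = (u - d)^q\<close> for the limit d = 1/D_k, and
  \<open>d^q / [k+1]\<close> is the reciprocal of the next D.\<close>

lemma carlitz_coeff_asymp:
  "\<exists>C\<ge>0. \<forall>a. a \<noteq> 0 \<longrightarrow>
    absv (embA \<iota> (carlitz_coeff a k) / embA \<iota> a ^ (CARD('f) ^ k) - 1 / embA \<iota> (carlitz_D k)) \<le> C / absv (embA \<iota> a)"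
proof (induction k)
  case 0
  then show ?case by (intro exI[of _ 0]) (simp add: carlitz_coeff_0 carlitz_D_0)
next
  case (Suc k)
  define u where "u a = embA \<iota> (carlitz_coeff a k) / embA \<iota> a ^ (CARD('f) ^ k)" for a :: "'f poly"
  define d where "d = 1 / embA \<iota> (carlitz_D k)"
  define B where "B = embA \<iota> (bracket (Suc k))"
  obtain C where C: "C \<ge> 0" "\<And>a. a \<noteq> 0 \<Longrightarrow> absv (u a - d) \<le> C / absv (embA \<iota> a)"
    using Suc.IH unfolding u_def d_def by blast
  \<comment> \<open>\<open>C^q\<close> covers the Frobenius error, C and the size of d together
    cover the size of u.\<close>
  define K where "K = max (C ^ CARD('f)) (max C (absv d))"
  have K: "C ^ CARD('f) \<le> K" "C \<le> K" "absv d \<le> K" "K \<ge> 0" using C(1) by (auto simp: K_def)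
  have B: "B \<noteq> 0" unfolding B_def by (rule embA_bracket_nonzero)
  have main: "absv (embA \<iota> (carlitz_coeff a (Suc k)) / embA \<iota> a ^ (CARD('f) ^ Suc k) - 1 / embA \<iota> (carlitz_D (Suc k)))
      \<le> (K / absv B) / absv (embA \<iota> a)" if a: "a \<noteq> 0" for a :: "'f poly"
  proof -
    define A where "A = embA \<iota> a"
    have A: "A \<noteq> 0" "absv A \<ge> 1" using a absv_embA_ge_1 by (auto simp: A_def)
    have "B * embA \<iota> (carlitz_coeff a (Suc k)) = embA \<iota> (carlitz_coeff a k) ^ CARD('f) - embA \<iota> (carlitz_coeff a k)"
      unfolding B_def by (simp only: bracket_carlitz_coeff flip: embA_mult embA_power embA_diff)
    then have c: "embA \<iota> (carlitz_coeff a (Suc k)) =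
        (embA \<iota> (carlitz_coeff a k) ^ CARD('f) - embA \<iota> (carlitz_coeff a k)) / B"
      using B by (simp add: field_simps)
    have ck: "embA \<iota> (carlitz_coeff a k) = u a * A ^ (CARD('f) ^ k)"
      using A by (simp add: u_def A_def)
    have pw: "A ^ (CARD('f) ^ Suc k) = (A ^ (CARD('f) ^ k)) ^ CARD('f)"
      by (simp add: mult.commute flip: power_mult)
    have "embA \<iota> (carlitz_coeff a (Suc k)) / A ^ (CARD('f) ^ Suc k) =
        (u a ^ CARD('f) - u a * (A ^ (CARD('f) ^ k) / A ^ (CARD('f) ^ Suc k))) / B"
      unfolding c ck pw using A B by (simp add: field_simps power_mult_distrib)
    moreover have "1 / embA \<iota> (carlitz_D (Suc k)) = d ^ CARD('f) / B"
      unfolding carlitz_D_Suc embA_mult embA_power B_def d_def by (simp add: power_one_over)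
    moreover have "u a ^ CARD('f) - d ^ CARD('f) = (u a - d) ^ CARD('f)"
      using frob_diff[of "u a" d 1] by simp
    ultimately have eq: "embA \<iota> (carlitz_coeff a (Suc k)) / A ^ (CARD('f) ^ Suc k) - 1 / embA \<iota> (carlitz_D (Suc k)) =
        ((u a - d) ^ CARD('f) - u a * (A ^ (CARD('f) ^ k) / A ^ (CARD('f) ^ Suc k))) / B"
      by (simp flip: diff_divide_distrib)
    have ud: "absv (u a - d) \<le> C / absv A" using C(2)[OF a] by (simp add: A_def)
    have "absv ((u a - d) ^ CARD('f)) \<le> (C / absv A) ^ CARD('f)"
      unfolding absv_power using ud by (intro power_mono) auto
    also have "\<dots> = C ^ CARD('f) / absv A ^ CARD('f)" by (rule power_divide)
    also have "\<dots> \<le> K / absv A ^ 1"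
      using A K C(1) q_ge_2 by (intro frac_le power_increasing) auto
    finally have 1: "absv ((u a - d) ^ CARD('f)) \<le> K / absv A" by simp
    have "C / absv A \<le> C / 1" using A C(1) by (intro divide_left_mono) auto
    then have "absv ((u a - d) + d) \<le> K" using ud K by (intro absv_add_leI) auto
    then have "absv (u a) \<le> K" by simp
    moreover have "absv (A ^ (CARD('f) ^ k) / A ^ (CARD('f) ^ Suc k)) \<le> 1 / absv A"
      unfolding A_def by (rule absv_ratio_le[OF a]) simp
    ultimately have 2: "absv (u a * (A ^ (CARD('f) ^ k) / A ^ (CARD('f) ^ Suc k))) \<le> K * (1 / absv A)"
      unfolding absv_mult[of "u a"] using K by (intro mult_mono) auto
    have "absv ((u a - d) ^ CARD('f) - u a * (A ^ (CARD('f) ^ k) / A ^ (CARD('f) ^ Suc k))) \<le> K / absv A"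
      using 1 2 by (intro absv_diff_leI) auto
    then have "absv (embA \<iota> (carlitz_coeff a (Suc k)) / A ^ (CARD('f) ^ Suc k) - 1 / embA \<iota> (carlitz_D (Suc k))) \<le>
        (K / absv A) / absv B"
      unfolding eq absv_divide[of _ B] using B by (intro divide_right_mono) auto
    then show ?thesis by (simp add: A_def mult.commute)
  qed
  then show ?case using K B by (intro exI[of _ "K / absv B"] conjI allI impI) auto
qed

text \<open>The constant is fixed before \<omega> and a, so the estimate is uniform over all
  \<delta>-separated points; it is built from bounds on the \<open>alpha\<close> that depend on
  \<delta> alone.\<close>

lemma ell_asymp:
  assumes \<delta>: "\<delta> > 0" and r: "r \<ge> 1"
  shows "\<exists>C\<ge>0. \<forall>\<omega> a. separated r \<delta> \<omega> \<longrightarrow> a \<noteq> 0 \<longrightarrow>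
    absv (ell \<iota> r a m \<omega> / embA \<iota> a ^ (CARD('f) ^ m) - alpha \<iota> r m \<omega>) \<le> C / absv (embA \<iota> a)"
proof (induction m rule: less_induct)
  case (less m)
  define b where "b a k \<omega> = ell \<iota> r a k \<omega> / embA \<iota> a ^ (CARD('f) ^ k)" for a k \<omega>
  have "\<forall>k<m. \<exists>C\<ge>0. \<forall>\<omega> a. separated r \<delta> \<omega> \<longrightarrow> a \<noteq> 0 \<longrightarrow>
    absv (b a k \<omega> - alpha \<iota> r k \<omega>) \<le> C / absv (embA \<iota> a)"
    using less unfolding b_def by blast
  then obtain C where C: "\<And>k. k < m \<Longrightarrow> C k \<ge> 0"
    "\<And>k \<omega> a. k < m \<Longrightarrow> separated r \<delta> \<omega> \<Longrightarrow> a \<noteq> 0 \<Longrightarrow>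
    absv (b a k \<omega> - alpha \<iota> r k \<omega>) \<le> C k / absv (embA \<iota> a)" by metis
  define M where "M k = inverse (\<delta> ^ (CARD('f) ^ k - 1))" for k
  have M: "absv (alpha \<iota> r k \<omega>) \<le> M k" "M k \<ge> 0" if "separated r \<delta> \<omega>" for k \<omega>
    using alpha_series(3)[OF that \<delta> r, of k] \<delta> by (simp_all add: M_def inverse_eq_divide pos_le_divide_eq)
  have Mnn: "M k \<ge> 0" for k using \<delta> by (simp add: M_def)
  \<comment> \<open>The k-th summand bounds the k-th term of the recursion apart from the factor
    1/|a|; \<open>M k + C k\<close> bounds the normalized \<open>ell\<close>, as |a| \<ge> 1. The
    sum simply dominates each summand.\<close>
  define K where "K = (\<Sum>k<m. (M k + C k) * M (m - k) ^ (CARD('f) ^ k))"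
  have Knn: "(M k + C k) * M (m - k) ^ (CARD('f) ^ k) \<ge> 0" if "k < m" for k
    using C(1)[OF that] Mnn by simp
  have "K \<ge> 0" unfolding K_def using Knn by (intro sum_nonneg) auto
  moreover have "absv (b a m \<omega> - alpha \<iota> r m \<omega>) \<le> K / absv (embA \<iota> a)"
    if sep: "separated r \<delta> \<omega>" and a: "a \<noteq> 0" for \<omega> a
  proof -
    define A where "A = embA \<iota> a"
    have A: "A \<noteq> 0" "absv A \<ge> 1" using a absv_embA_ge_1 by (auto simp: A_def)
    have ell: "ell \<iota> r a k \<omega> = b a k \<omega> * A ^ (CARD('f) ^ k)" for k
      using A by (simp add: b_def A_def)
    have "alpha \<iota> r m \<omega> * A ^ (CARD('f) ^ m) =
        (\<Sum>k\<le>m. ell \<iota> r a k \<omega> * alpha \<iota> r (m - k) \<omega> ^ (CARD('f) ^ k))"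
      unfolding A_def by (rule ell_recursion[OF sep \<delta> a r])
    also have "\<dots> = (\<Sum>k<m. ell \<iota> r a k \<omega> * alpha \<iota> r (m - k) \<omega> ^ (CARD('f) ^ k)) + b a m \<omega> * A ^ (CARD('f) ^ m)"
      using alpha_series(2)[OF sep \<delta> r] by (simp add: ell flip: lessThan_Suc_atMost)
    finally have "b a m \<omega> - alpha \<iota> r m \<omega> =
        - (\<Sum>k<m. ell \<iota> r a k \<omega> * alpha \<iota> r (m - k) \<omega> ^ (CARD('f) ^ k)) / A ^ (CARD('f) ^ m)"
      using A by (simp add: field_simps)
    also have "\<dots> = - (\<Sum>k<m. b a k \<omega> * alpha \<iota> r (m - k) \<omega> ^ (CARD('f) ^ k) * (A ^ (CARD('f) ^ k) / A ^ (CARD('f) ^ m)))"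
      by (simp add: ell sum_divide_distrib mult_ac)
    finally have eq: "b a m \<omega> - alpha \<iota> r m \<omega> = \<dots>" .
    show ?thesis
      unfolding eq absv_minus
    proof (rule absv_sum_le)
      fix k assume "k \<in> {..<m}"
      then have k: "k < m" by simp
      have "C k / absv A \<le> C k / 1" using A C(1)[OF k] by (intro divide_left_mono) auto
      then have "absv ((b a k \<omega> - alpha \<iota> r k \<omega>) + alpha \<iota> r k \<omega>) \<le> M k + C k"
        using C(2)[OF k sep a] M(1)[OF sep, of k] C(1)[OF k] Mnn[of k]
        by (intro absv_add_leI) (auto simp: A_def)
      then have 1: "absv (b a k \<omega>) \<le> M k + C k" by simp
      have 2: "absv (alpha \<iota> r (m - k) \<omega> ^ (CARD('f) ^ k)) \<le> M (m - k) ^ (CARD('f) ^ k)"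
        unfolding absv_power using M(1)[OF sep] by (intro power_mono) auto
      have 3: "absv (A ^ (CARD('f) ^ k) / A ^ (CARD('f) ^ m)) \<le> 1 / absv A"
        unfolding A_def by (rule absv_ratio_le[OF a k])
      have "absv (b a k \<omega> * alpha \<iota> r (m - k) \<omega> ^ (CARD('f) ^ k)) \<le> (M k + C k) * M (m - k) ^ (CARD('f) ^ k)"
        unfolding absv_mult using 1 2 C(1)[OF k] Mnn by (intro mult_mono) auto
      also have "\<dots> \<le> K"
        unfolding K_def using Knn k by (intro member_le_sum[where f = "\<lambda>k. (M k + C k) * M (m - k) ^ (CARD('f) ^ k)"]) auto
      finally have "absv (b a k \<omega> * alpha \<iota> r (m - k) \<omega> ^ (CARD('f) ^ k) * (A ^ (CARD('f) ^ k) / A ^ (CARD('f) ^ m))) \<le> K * (1 / absv A)"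
        unfolding absv_mult[of "_ * _" "_ / _"] using 3 \<open>K \<ge> 0\<close> by (intro mult_mono) auto
      then show "absv (b a k \<omega> * alpha \<iota> r (m - k) \<omega> ^ (CARD('f) ^ k) * (A ^ (CARD('f) ^ k) / A ^ (CARD('f) ^ m))) \<le> K / absv (embA \<iota> a)"
        by (simp add: A_def)
    qed (use \<open>K \<ge> 0\<close> in auto)
  qed
  ultimately show ?case unfolding b_def by blast
qed

text \<open>Dividing both \<open>ell\<close> and the Carlitz coefficient by \<open>a^(q^k)\<close>
  gives b and u, and leaves their quotient unchanged. Once u is closer to 1/D than the size of 1/D,
  the isosceles principle fixes its absolute value, so division by u costs exactly the factor
  |D|.\<close>

lemma uniform_limit_ell_tilde:
  assumes \<delta>: "\<delta> > 0" and r: "r \<ge> 1" and U: "\<And>\<omega>. \<omega> \<in> U \<Longrightarrow> separated r \<delta> \<omega>"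
  shows "uniform_limit U (\<lambda>a \<omega>. ell_tilde \<iota> \<pi> r a k \<omega>) (alpha_tilde \<iota> \<pi> r k)
       (filtercomap Polynomial.degree at_top)"
proof (rule uniform_limitI)
  fix e :: real assume e: "e > 0"
  define D where "D = embA \<iota> (carlitz_D k)"
  have D: "D \<noteq> 0" unfolding D_def by (rule embA_carlitz_D_nonzero)
  obtain C1 where C1: "C1 \<ge> 0" "\<And>a. a \<noteq> 0 \<Longrightarrow>
    absv (embA \<iota> (carlitz_coeff a k) / embA \<iota> a ^ (CARD('f) ^ k) - 1 / D) \<le> C1 / absv (embA \<iota> a)"
    using carlitz_coeff_asymp[of k] unfolding D_def by blast
  obtain C2 where C2: "C2 \<ge> 0" "\<And>\<omega> a. separated r \<delta> \<omega> \<Longrightarrow> a \<noteq> 0 \<Longrightarrow>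
    absv (ell \<iota> r a k \<omega> / embA \<iota> a ^ (CARD('f) ^ k) - alpha \<iota> r k \<omega>) \<le> C2 / absv (embA \<iota> a)"
    using ell_asymp[OF \<delta> r, of k] by blast
  define M where "M = inverse (\<delta> ^ (CARD('f) ^ k - 1))"
  have M: "absv (alpha \<iota> r k \<omega>) \<le> M" if "separated r \<delta> \<omega>" for \<omega>
    using alpha_series(3)[OF that \<delta> r, of k] \<delta> by (simp add: M_def inverse_eq_divide pos_le_divide_eq)
  have Mnn: "M \<ge> 0" using \<delta> by (simp add: M_def)
  define p where "p = \<pi> powi (1 - int (CARD('f) ^ k))"
  \<comment> \<open>The first summand controls the final error, the second the closeness of u to
    1/D; comparing K with \<open>min e 1\<close> times the size of a yields both.\<close>
  define K where "K = absv p * (C2 * absv D + M * (absv D * absv D * C1)) + absv D * C1"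
  have Knn: "absv p * (C2 * absv D + M * (absv D * absv D * C1)) \<ge> 0" "absv D * C1 \<ge> 0"
    using C1(1) C2(1) Mnn by auto
  obtain N where N: "K / min e 1 < real CARD('f) ^ N"
    using real_arch_pow[of "real CARD('f)"] q_ge_2 by auto
  \<comment> \<open>\<open>Suc N\<close> instead of N excludes a = 0, whose degree is 0.\<close>
  have "dist (ell_tilde \<iota> \<pi> r a k \<omega>) (alpha_tilde \<iota> \<pi> r k \<omega>) < e"
    if deg: "Polynomial.degree a \<ge> Suc N" and \<omega>: "\<omega> \<in> U" for a \<omega>
  proof -
    have sep: "separated r \<delta> \<omega>" using U \<omega> by blast
    have a: "a \<noteq> 0" using deg by auto
    define A where "A = embA \<iota> a"
    define u where "u = embA \<iota> (carlitz_coeff a k) / A ^ (CARD('f) ^ k)"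
    define b where "b = ell \<iota> r a k \<omega> / A ^ (CARD('f) ^ k)"
    define \<alpha> where "\<alpha> = alpha \<iota> r k \<omega>"
    have A: "A \<noteq> 0" "absv A \<ge> 1" using a absv_embA_ge_1 by (auto simp: A_def)
    have Apos: "absv A > 0" using A by simp
    have "real CARD('f) ^ N \<le> absv A"
      using deg a q_ge_2 by (auto simp: A_def absv_embA intro!: power_increasing)
    with N have "K / min e 1 < absv A" by linarith
    then have "K < absv A * min e 1" using e by (simp add: pos_divide_less_eq)
    moreover have "absv A * min e 1 \<le> absv A * e" "absv A * min e 1 \<le> absv A * 1"
      using Apos by (intro mult_left_mono; simp)+
    ultimately have K: "absv p * (C2 * absv D + M * (absv D * absv D * C1)) < e * absv A" "absv D * C1 < absv A"
      using Knn by (simp_all add: K_def mult.commute)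
    have u1: "absv (u - 1 / D) \<le> C1 / absv A" unfolding u_def A_def by (rule C1(2)[OF a])
    also have "C1 / absv A < absv (1 / D)"
      using K(2) D Apos by (simp add: absv_divide field_simps)
    finally have "absv u = absv (1 / D)" by (rule absv_eqI)
    then have absu: "absv u = 1 / absv D" by (simp add: absv_divide)
    then have u: "u \<noteq> 0" using D by auto
    have b1: "absv (b - \<alpha>) \<le> C2 / absv A" unfolding b_def A_def \<alpha>_def by (rule C2(2)[OF sep a])
    have \<alpha>1: "absv \<alpha> \<le> M" unfolding \<alpha>_def by (rule M[OF sep])
    have "ell_tilde \<iota> \<pi> r a k \<omega> = p * (b / u)"
      using A u by (simp add: ell_tilde_def p_def b_def u_def field_simps)
    moreover have "alpha_tilde \<iota> \<pi> r k \<omega> = p * (D * \<alpha>)"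
      by (simp add: alpha_tilde_def p_def D_def \<alpha>_def)
    moreover have "b / u - D * \<alpha> = (b - \<alpha>) / u - \<alpha> * ((u - 1 / D) * D / u)"
      using u D by (simp add: field_simps)
    ultimately have eq: "ell_tilde \<iota> \<pi> r a k \<omega> - alpha_tilde \<iota> \<pi> r k \<omega> =
        p * ((b - \<alpha>) / u - \<alpha> * ((u - 1 / D) * D / u))"
      by (simp only: right_diff_distrib[symmetric])
    have "absv ((b - \<alpha>) / u) \<le> C2 / absv A * absv D"
      unfolding absv_divide absu using mult_right_mono[OF b1, of "absv D"] by simp
    moreover have "absv (\<alpha> * ((u - 1 / D) * D / u)) \<le> M * (C1 / absv A * absv D * absv D)"
      unfolding absv_divide[of _ u] absv_mult absu
      using mult_mono[OF \<alpha>1 mult_right_mono[OF mult_right_mono[OF u1, of "absv D"], of "absv D"]] Mnn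
      by simp
    ultimately have "absv ((b - \<alpha>) / u - \<alpha> * ((u - 1 / D) * D / u)) \<le>
        C2 / absv A * absv D + M * (C1 / absv A * absv D * absv D)"
      using absv_nonneg[of "(b - \<alpha>) / u"] absv_nonneg[of "\<alpha> * ((u - 1 / D) * D / u)"]
      by (intro absv_diff_leI) linarith+
    then have "absv (ell_tilde \<iota> \<pi> r a k \<omega> - alpha_tilde \<iota> \<pi> r k \<omega>) \<le>
        absv p * (C2 / absv A * absv D + M * (C1 / absv A * absv D * absv D))"
      unfolding eq absv_mult[of p] by (intro mult_left_mono) auto
    also have "\<dots> = (absv p * (C2 * absv D + M * (absv D * absv D * C1))) / absv A"
      using Apos by (simp add: field_simps)
    also have "\<dots> < e" using K(1) Apos by (simp add: pos_divide_less_eq)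
    finally show ?thesis by (simp add: dist_absv)
  qed
  then show "\<forall>\<^sub>F a in filtercomap Polynomial.degree at_top.
      \<forall>\<omega>\<in>U. dist (ell_tilde \<iota> \<pi> r a k \<omega>) (alpha_tilde \<iota> \<pi> r k \<omega>) < e"
    unfolding eventually_filtercomap_at_top_linorder by blast
qed

end

theorem theorem4p13:
  fixes \<iota> :: "'f::finite_field fls alg_closure \<Rightarrow> 'c::{field,complete_space}"
    and \<pi> :: 'c and r k :: nat
  assumes "C_infinity \<iota>"
    and "r \<ge> 2"
    and "carlitz_period \<iota> \<pi>"
    and "k \<ge> 1"
  shows "\<exists>\<U>. admissible_covering (r - 1) (Omega \<iota> r) \<U> \<and>
    (\<forall>U\<in>\<U>. uniform_limit U (\<lambda>a \<omega>. ell_tilde \<iota> \<pi> r a k \<omega>) (alpha_tilde \<iota> \<pi> r k)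
       (filtercomap Polynomial.degree at_top))"
proof -
  interpret C_infinity \<iota> by fact
  show ?thesis
  proof (intro exI conjI ballI)
    show "admissible_covering (r - 1) (Omega \<iota> r) {V. open_affinoid (r - 1) V \<and> V \<subseteq> Omega \<iota> r}"
      by (rule open_affinoids_admissible_covering) fact
    fix U assume "U \<in> {V. open_affinoid (r - 1) V \<and> V \<subseteq> Omega \<iota> r}"
    then obtain \<delta> where "\<delta> > 0" "\<forall>\<omega>\<in>U. separated r \<delta> \<omega>"
      using open_affinoid_separated assms(2) by blast
    then show "uniform_limit U (\<lambda>a \<omega>. ell_tilde \<iota> \<pi> r a k \<omega>) (alpha_tilde \<iota> \<pi> r k)
       (filtercomap Polynomial.degree at_top)"
      using assms(2) by (intro uniform_limit_ell_tilde[of \<delta>]) auto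
  qed
qed

end
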